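(* Let $1\le d\le 3$ and $n\ge d+1$. Then the Baues poset $\operatorname{Baues}(C(n,d))$ of all proper polytopal decompositions of the cyclic polytope $C(n,d)$, ordered by refinement, is homotopy equivalent to a sphere of dimension $n-d-2$.
   Context: Let $[n]=\{1,\dots,n\}$. The label $i\in[n]$ is identified with the point $(i,i^2,\dots,i^d)\in\mathbb R^d$. For $V\subseteq[n]$, $C(V,d)$ is the convex hull of the points labelled by $V$, and $C(n,d)=C([n],d)$ is the cyclic $d$-polytope with $n$ vertices. A polytopal decomposition $\delta$ of $C(n,d)$ is a collection $\{V_\alpha\}$ of subsets $V_\alpha\subseteq[n]$ such that: (1) $|V_\alpha|\ge d+1$ for all $\alpha$; (2) for any two distinct members $V_\alpha,V_\beta$, the polytopes $C(V_\alpha,d)$ and $C(V_\beta,d)$ intersect in a common proper face (possibly empty); (3) $\bigcup_\alpha C(V_\alpha,d)=C(n,d)$. It is proper if it is not the trivial decomposition $\{[n]\}$. The Baues poset $\operatorname{Baues}(C(n,d))$ is the set of all proper polytopal decompositions, ordered by refinement: $\{V_\alpha\}\le\{V'_{\alpha'}\}$ iff for every $V_\alpha$ there is some $V'_{\alpha'}$ with $V_\alpha\subseteq V'_{\alpha'}$. The homotopy type of a poset is that of the geometric realization of its order complex (the simplicial complex of finite chains). The $(-1)$-sphere is the empty space. *)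

theory Defs
  imports "HOL-Analysis.Analysis"
begin

(* The dimension d is the cardinality of a linearly ordered index type, so that
   card {..j} runs through 1, ..., d and the point is (i, i^2, ..., i^d). *)
definition moment_point :: "nat \<Rightarrow> real ^ 'd::{finite,linorder}" where
  "moment_point i = (\<chi> j. real i ^ card {..j})"

definition cyclic_hull :: "nat set \<Rightarrow> (real ^ 'd::{finite,linorder}) set" where
  "cyclic_hull V = convex hull (moment_point ` V)"

definition proper_face_of :: "'a::real_vector set \<Rightarrow> 'a set \<Rightarrow> bool" where
  "proper_face_of F P \<longleftrightarrow> F face_of P \<and> F \<noteq> P"

definition polytopal_decomposition ::
  "'d::{finite,linorder} itself \<Rightarrow> nat \<Rightarrow> nat set set \<Rightarrow> bool" where
  "polytopal_decomposition _ n \<delta> \<longleftrightarrow>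
     (\<forall>V\<in>\<delta>. V \<subseteq> {1..n} \<and> card V \<ge> CARD('d) + 1) \<and>
     (\<forall>V\<in>\<delta>. \<forall>W\<in>\<delta>. V \<noteq> W \<longrightarrow>
        (let F = (cyclic_hull V :: (real, 'd) vec set) \<inter> cyclic_hull W
         in proper_face_of F (cyclic_hull V) \<and> proper_face_of F (cyclic_hull W))) \<and>
     (\<Union>V\<in>\<delta>. (cyclic_hull V :: (real, 'd) vec set)) = cyclic_hull {1..n}"

definition Baues :: "'d::{finite,linorder} itself \<Rightarrow> nat \<Rightarrow> nat set set set" where
  "Baues d n = {\<delta>. polytopal_decomposition d n \<delta> \<and> \<delta> \<noteq> {{1..n}}}"

definition refinement_of :: "'a set set \<Rightarrow> 'a set set \<Rightarrow> bool" where
  "refinement_of \<delta> \<delta>' \<longleftrightarrow> (\<forall>V\<in>\<delta>. \<exists>W\<in>\<delta>'. V \<subseteq> W)"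

definition order_complex :: "'a set \<Rightarrow> ('a \<Rightarrow> 'a \<Rightarrow> bool) \<Rightarrow> 'a set set" where
  "order_complex P le =
     {c. c \<subseteq> P \<and> finite c \<and> c \<noteq> {} \<and> Complete_Partial_Order.chain le c}"

(* Points are given by barycentric coordinates, supported on a simplex of K.
   The topology is that of pointwise convergence; it agrees with the weak
   topology when K is finite, as for the order complex of a finite poset
   (see finite_Baues), but not in general. *)
definition geometric_realization :: "'a set set \<Rightarrow> ('a \<Rightarrow> real) topology" where
  "geometric_realization K =
     subtopology (powertop_real UNIV)
       {x. (\<forall>v. 0 \<le> x v) \<and> {v. x v \<noteq> 0} \<in> K \<and> (\<Sum>v | x v \<noteq> 0. x v) = 1}"

(* The (-1)-sphere is the empty space. *)
definition sphere_space :: "int \<Rightarrow> (nat \<Rightarrow> real) topology" where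
  "sphere_space k = (if k < 0 then trivial_topology else nsphere (nat k))"

lemma finite_Baues: "finite (Baues TYPE('d::{finite,linorder}) n)"
proof (rule finite_subset)
  show "Baues TYPE('d) n \<subseteq> Pow (Pow {1..n})"
    by (auto simp: Baues_def polytopal_decomposition_def)
qed simp

lemma refinement_of_refl: "refinement_of \<delta> \<delta>"
  and refinement_of_trans: "refinement_of \<delta> \<delta>' \<Longrightarrow> refinement_of \<delta>' \<delta>'' \<Longrightarrow> refinement_of \<delta> \<delta>''"
  unfolding refinement_of_def by (blast, meson order_trans)

lemma polytopal_decomposition_antichain:
  assumes "polytopal_decomposition TYPE('d::{finite,linorder}) n \<delta>"
    and "V \<in> \<delta>" "W \<in> \<delta>" "V \<subseteq> W"
  shows "V = W"
proof (rule ccontr)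
  assume "V \<noteq> W"
  have "(cyclic_hull V :: (real, 'd) vec set) \<subseteq> cyclic_hull W"
    unfolding cyclic_hull_def using assms(4) by (intro hull_mono image_mono)
  then have "(cyclic_hull V :: (real, 'd) vec set) \<inter> cyclic_hull W = cyclic_hull V"
    by (rule Int_absorb2)
  moreover have "proper_face_of ((cyclic_hull V :: (real, 'd) vec set) \<inter> cyclic_hull W) (cyclic_hull V)"
    using assms \<open>V \<noteq> W\<close> unfolding polytopal_decomposition_def Let_def by blast
  ultimately show False by (simp add: proper_face_of_def)
qed

lemma refinement_of_antisym_Baues:
  assumes "\<delta> \<in> Baues TYPE('d::{finite,linorder}) n" "\<delta>' \<in> Baues TYPE('d) n"
    and "refinement_of \<delta> \<delta>'" "refinement_of \<delta>' \<delta>"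
  shows "\<delta> = \<delta>'"
proof -
  have "A \<subseteq> B"
    if A: "A \<in> Baues TYPE('d) n" and AB: "refinement_of A B" and BA: "refinement_of B A" for A B
  proof
    fix V assume V: "V \<in> A"
    then obtain W where W: "W \<in> B" "V \<subseteq> W" using AB unfolding refinement_of_def by blast
    then obtain V' where V': "V' \<in> A" "W \<subseteq> V'" using BA unfolding refinement_of_def by blast
    have "V = V'"
      using polytopal_decomposition_antichain[where 'd='d and n=n and \<delta>=A and V=V and W=V'] A V V' W
      by (auto simp: Baues_def)
    with W V' show "V \<in> B" by auto
  qed
  then show ?thesis using assms by (intro subset_antisym)
qed

end

theory Submission
  imports Defs
begin

text \<open>Induction on the number of vertices. Sliding the last vertex \<open>m + 1\<close> along the moment curve onto
  \<open>m\<close> turns every decomposition of \<open>C(m + 1, d)\<close> into one of \<open>C(m, d)\<close>; the former is recovered from the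
  latter by recording for each cell at \<open>m\<close> whether it had the vertex \<open>m\<close>, \<open>m + 1\<close> or both. Two proper
  decompositions, both maximal, slide onto the trivial one. On the remaining ones the slide is a
  monotone map onto the proper decompositions of \<open>C(m, d)\<close>, with two monotone sections whose images are
  the elements below the two exceptional ones. If all fibres over principal ideals are contractible,
  the mapping cylinder of the slide shows that the Baues poset of \<open>C(m + 1, d)\<close> is the suspension of
  the one of \<open>C(m, d)\<close>.

  This contractibility is where \<open>d \<le> 3\<close> enters: the cells at \<open>m\<close> then have at most one lower facet
  through \<open>m\<close>, so they form a forest and can be handled one after the other, each being first merged
  with its copy at \<open>m + 1\<close> and then pushed over to \<open>m + 1\<close>.

  Decompositions are identified with the collections
  of cells whose signed sum of upper and lower facets is that of the polytope, by counting how
  a generic vertical line enters and leaves the cells.\<close>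

section \<open>Order complexes as polyhedra\<close>

text \<open>Suspensions are taken of posets, not of spaces: \<open>k\<close> pairs of poles sit on
  top of the poset and the induction covers all \<open>k\<close> at once, so suspension never has to
  be shown to respect homotopy equivalence.

  The trivial decomposition of \<open>C(m, d)\<close> has a single cell and therefore three lifts:
  label 1 gives the trivial decomposition again, labels 0 and 2 give the two exceptional ones.

  The obstacle in a fibre is that labels 0 and 2 are incomparable. A cell can pass from one vertex
  to the other only through label 1, and label 1 is admissible only if the neighbours above it at
  \<open>m\<close> have label 2 and those below it label 0. The first condition forces an order of
  treatment, from the top downwards. The second is where a single lower facet is needed: with
  several of them, the inside of a coarse cell could be at \<open>m + 1\<close> along one and at
  \<open>m\<close> along another, and then not every neighbour below would be bound to label
  0.\<close>

definition order_polyhedron :: "'a set \<Rightarrow> ('a \<Rightarrow> 'a \<Rightarrow> bool) \<Rightarrow> ('a \<Rightarrow> real) set" where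
  "order_polyhedron X le = {x. (\<forall>v. 0 \<le> x v) \<and> (\<forall>v. v \<notin> X \<longrightarrow> x v = 0) \<and>
     (\<forall>u v. x u \<noteq> 0 \<longrightarrow> x v \<noteq> 0 \<longrightarrow> le u v \<or> le v u) \<and> sum x X = 1}"

lemma geometric_realization_order_complex:
  assumes "finite X"
  shows "geometric_realization (order_complex X le) = top_of_set (order_polyhedron X le)"
proof -
  have "((\<forall>v. 0 \<le> x v) \<and> {v. x v \<noteq> 0} \<in> order_complex X le \<and> (\<Sum>v | x v \<noteq> 0. x v) = 1)
      \<longleftrightarrow> x \<in> order_polyhedron X le" for x
  proof -
    have "(\<Sum>v | x v \<noteq> 0. x v) = sum x X" if "{v. x v \<noteq> 0} \<subseteq> X"
      by (rule sum.mono_neutral_left[OF assms]) (use that in auto)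
    moreover have "{v. x v \<noteq> 0} \<subseteq> X \<longleftrightarrow> (\<forall>v. v \<notin> X \<longrightarrow> x v = 0)"
      by auto
    moreover have "{v. x v \<noteq> 0} \<noteq> {}" if "sum x X = 1"
      using that by (metis (mono_tags, lifting) empty_Collect_eq sum.neutral zero_neq_one)
    ultimately show ?thesis
      unfolding order_polyhedron_def order_complex_def Complete_Partial_Order.chain_def
      using finite_subset[OF _ assms, of "{v. x v \<noteq> 0}"] by auto
  qed
  then show ?thesis
    unfolding geometric_realization_def euclidean_product_topology by simp
qed

lemma order_polyhedronD:
  assumes "x \<in> order_polyhedron X le"
  shows "0 \<le> x v" "v \<notin> X \<Longrightarrow> x v = 0" "x u \<noteq> 0 \<Longrightarrow> x v \<noteq> 0 \<Longrightarrow> le u v \<or> le v u" "sum x X = 1"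
  using assms by (auto simp: order_polyhedron_def)

lemma order_polyhedron_mono:
  assumes "finite Y" "X \<subseteq> Y"
  shows "order_polyhedron X le \<subseteq> order_polyhedron Y le"
proof
  fix x assume x: "x \<in> order_polyhedron X le"
  have "sum x Y = sum x X"
    by (rule sum.mono_neutral_right) (use assms order_polyhedronD(2)[OF x] in auto)
  then show "x \<in> order_polyhedron Y le"
    using x assms unfolding order_polyhedron_def by auto
qed

text \<open>The union of the two supports is a chain, so both points lie in one simplex and the
  segment between them does too.\<close>

lemma order_polyhedron_segment:
  assumes y: "y \<in> order_polyhedron X le" and z: "z \<in> order_polyhedron X le"
    and supp: "\<And>u v. y u \<noteq> 0 \<Longrightarrow> z v \<noteq> 0 \<Longrightarrow> le u v \<or> le v u" and "0 \<le> t" "t \<le> 1"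
  shows "(\<lambda>v. (1 - t) * y v + t * z v) \<in> order_polyhedron X le"
proof -
  have "(\<Sum>v\<in>X. (1 - t) * y v + t * z v) = 1"
    using order_polyhedronD(4)[OF y] order_polyhedronD(4)[OF z]
    by (simp add: sum.distrib flip: sum_distrib_left)
  moreover have "le u v \<or> le v u"
    if "(1 - t) * y u + t * z u \<noteq> 0" "(1 - t) * y v + t * z v \<noteq> 0" for u v
    using that supp[of u v] supp[of v u] order_polyhedronD(3)[OF y, of u v]
      order_polyhedronD(3)[OF z, of u v] by fastforce
  ultimately show ?thesis
    using y z assms(4,5) unfolding order_polyhedron_def by auto
qed

text \<open>The simplicial map of a vertex map in barycentric coordinates. The sum runs over all of
  \<open>X\<close> instead of the support, so every coordinate is a finite sum of coordinates and
  continuity is immediate.\<close>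

definition push :: "'a set \<Rightarrow> ('a \<Rightarrow> 'b) \<Rightarrow> ('a \<Rightarrow> real) \<Rightarrow> 'b \<Rightarrow> real" where
  "push X g x v = (\<Sum>u\<in>X. if g u = v then x u else 0)"

lemma continuous_on_push: "continuous_on S (push X g)"
proof (rule continuous_on_coordinatewise_then_product)
  fix v
  have "continuous_on S (\<lambda>x. if g u = v then x u else 0)" for u
    by (cases "g u = v") (auto intro: continuous_on_subset[OF continuous_on_product_coordinates])
  then show "continuous_on S (\<lambda>x. push X g x v)"
    unfolding push_def by (intro continuous_on_sum) auto
qed

lemma push_eq_0: "(\<And>u. u \<in> X \<Longrightarrow> g u = v \<Longrightarrow> x u = 0) \<Longrightarrow> push X g x v = 0"
  unfolding push_def by (intro sum.neutral) auto

lemma push_in_order_polyhedron: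
  assumes fin: "finite X" "finite Y" and gY: "\<And>u. u \<in> X \<Longrightarrow> g u \<in> Y"
    and comp: "\<And>u v. u \<in> X \<Longrightarrow> v \<in> X \<Longrightarrow> le u v \<Longrightarrow> le' (g u) (g v)"
    and x: "x \<in> order_polyhedron X le"
  shows "push X g x \<in> order_polyhedron Y le'"
proof -
  note x' = order_polyhedronD[OF x]
  have "push X g x v = 0" if "v \<notin> Y" for v
    by (rule push_eq_0) (use that gY in auto)
  moreover have "le' u v \<or> le' v u" if nz: "push X g x u \<noteq> 0" "push X g x v \<noteq> 0" for u v
  proof -
    obtain a where a: "a \<in> X" "g a = u" "x a \<noteq> 0" using push_eq_0[of X g u x] nz(1) by blast
    obtain b where b: "b \<in> X" "g b = v" "x b \<noteq> 0" using push_eq_0[of X g v x] nz(2) by blast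
    show ?thesis using x'(3)[OF a(3) b(3)] comp a b by blast
  qed
  moreover have "sum (push X g x) Y = 1"
  proof -
    have "sum (push X g x) Y = (\<Sum>u\<in>X. \<Sum>v\<in>Y. if g u = v then x u else 0)"
      unfolding push_def by (rule sum.swap)
    also have "\<dots> = (\<Sum>u\<in>X. x u)"
      by (rule sum.cong) (use fin gY in \<open>auto simp: sum.delta'\<close>)
    finally show ?thesis using x'(4) by simp
  qed
  moreover have "0 \<le> push X g x v" for v
    unfolding push_def using x'(1) by (intro sum_nonneg) auto
  ultimately show ?thesis unfolding order_polyhedron_def by auto
qed

lemma push_push:
  assumes "finite X" "finite Y" "\<And>u. u \<in> X \<Longrightarrow> g u \<in> Y" "\<And>u. u \<in> X \<Longrightarrow> h (g u) = u"
    and "\<And>v. v \<notin> X \<Longrightarrow> x v = 0"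
  shows "push Y h (push X g x) = x"
proof
  fix w
  have "push Y h (push X g x) w = (\<Sum>v\<in>Y. \<Sum>u\<in>X. if g u = v then (if h v = w then x u else 0) else 0)"
    unfolding push_def by (intro sum.cong refl) (simp cong: if_cong)
  also have "\<dots> = (\<Sum>u\<in>X. \<Sum>v\<in>Y. if g u = v then (if h v = w then x u else 0) else 0)"
    by (rule sum.swap)
  also have "\<dots> = (\<Sum>u\<in>X. if u = w then x u else 0)"
    by (intro sum.cong refl) (use assms in \<open>auto simp: sum.delta'\<close>)
  also have "\<dots> = x w" using assms(1,5) by (auto simp: sum.delta)
  finally show "push Y h (push X g x) w = x w" .
qed

lemma push_id:
  assumes "finite X" "x \<in> order_polyhedron X le"
  shows "push X (\<lambda>u. u) x = x"
proof
  fix w show "push X (\<lambda>u. u) x w = x w"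
    using assms(1) order_polyhedronD(2)[OF assms(2), of w] by (auto simp: push_def sum.delta)
qed

lemma order_iso_homotopy_eqv:
  assumes fin: "finite X" and bij: "bij_betw g X Y"
    and iso: "\<And>u v. u \<in> X \<Longrightarrow> v \<in> X \<Longrightarrow> le' (g u) (g v) \<longleftrightarrow> le u v"
  shows "order_polyhedron X le homotopy_eqv order_polyhedron Y le'"
proof -
  let ?h = "inv_into X g"
  have finY: "finite Y" using bij fin bij_betw_finite by blast
  have gY: "g u \<in> Y" if "u \<in> X" for u using bij that by (auto simp: bij_betw_def)
  have hX: "?h v \<in> X" "g (?h v) = v" if "v \<in> Y" for v
    using bij that by (auto simp: bij_betw_def inv_into_into f_inv_into_f)
  have hg: "?h (g u) = u" if "u \<in> X" for u using bij that by (simp add: bij_betw_inv_into_left)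
  have h_iso: "le (?h u) (?h v)" if "u \<in> Y" "v \<in> Y" "le' u v" for u v
    using iso[of "?h u" "?h v"] hX that by simp
  have "homeomorphism (order_polyhedron X le) (order_polyhedron Y le') (push X g) (push Y ?h)"
  proof (rule homeomorphismI)
    show "continuous_on (order_polyhedron X le) (push X g)"
      "continuous_on (order_polyhedron Y le') (push Y ?h)"
      by (rule continuous_on_push)+
    show "push X g ` order_polyhedron X le \<subseteq> order_polyhedron Y le'"
      using push_in_order_polyhedron[OF fin finY, of g le le'] gY iso by blast
    show "push Y ?h ` order_polyhedron Y le' \<subseteq> order_polyhedron X le"
      using push_in_order_polyhedron[OF finY fin, of ?h le' le] hX h_iso by blast
    show "push Y ?h (push X g x) = x" if "x \<in> order_polyhedron X le" for x
      using push_push[OF fin finY gY hg, of x] order_polyhedronD(2)[OF that] by blast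
    show "push X g (push Y ?h y) = y" if "y \<in> order_polyhedron Y le'" for y
      using push_push[OF finY fin hX, of y] order_polyhedronD(2)[OF that] by blast
  qed
  then show ?thesis by (intro homeomorphic_imp_homotopy_eqv) (auto simp: homeomorphic_def)
qed

text \<open>The homotopy is the straight line. Hypothesis \<open>gh\<close> compares
  \<open>g u\<close> with \<open>h v\<close> also for different comparable \<open>u\<close> and
  \<open>v\<close>: the images of a chain under both maps must form one chain.\<close>

lemma homotopic_push:
  assumes fin: "finite X" and gX: "\<And>u. u \<in> X \<Longrightarrow> g u \<in> X" and hX: "\<And>u. u \<in> X \<Longrightarrow> h u \<in> X"
    and g: "\<And>u v. u \<in> X \<Longrightarrow> v \<in> X \<Longrightarrow> le u v \<Longrightarrow> le (g u) (g v)"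
    and h: "\<And>u v. u \<in> X \<Longrightarrow> v \<in> X \<Longrightarrow> le u v \<Longrightarrow> le (h u) (h v)"
    and gh: "\<And>u v. u \<in> X \<Longrightarrow> v \<in> X \<Longrightarrow> le u v \<or> le v u \<Longrightarrow> le (g u) (h v) \<or> le (h v) (g u)"
  shows "homotopic_with_canon (\<lambda>x. True) (order_polyhedron X le) (order_polyhedron X le)
           (push X g) (push X h)"
proof -
  let ?H = "\<lambda>(t, x). (\<lambda>v. (1 - t) * push X g x v + t * push X h x v)"
  have "continuous_on ({0..1::real} \<times> order_polyhedron X le) ?H"
  proof (rule continuous_on_coordinatewise_then_product)
    fix v
    have *: "continuous_on S (\<lambda>p. push X k (snd p) v)"
      for S :: "(real \<times> ('a \<Rightarrow> real)) set" and k :: "'a \<Rightarrow> 'a"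
      by (rule continuous_on_compose2[OF continuous_on_product_then_coordinatewise[OF
              continuous_on_push[of UNIV X k]] continuous_on_snd[OF continuous_on_id]]) simp
    show "continuous_on ({0..1} \<times> order_polyhedron X le) (\<lambda>p. ?H p v)"
      unfolding case_prod_unfold by (intro continuous_intros *)
  qed
  moreover have "?H (t, x) \<in> order_polyhedron X le"
    if "t \<in> {0..1}" "x \<in> order_polyhedron X le" for t x
  proof -
    have "le u v \<or> le v u" if nz: "push X g x u \<noteq> 0" "push X h x v \<noteq> 0" for u v
    proof -
      obtain a where a: "a \<in> X" "g a = u" "x a \<noteq> 0" using push_eq_0[of X g u x] nz(1) by blast
      obtain b where b: "b \<in> X" "h b = v" "x b \<noteq> 0" using push_eq_0[of X h v x] nz(2) by blast
      show ?thesis using order_polyhedronD(3)[OF \<open>x \<in> _\<close> a(3) b(3)] gh[OF a(1) b(1)] a b by blast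
    qed
    then show ?thesis
      using that push_in_order_polyhedron[where g = g and le = le and le' = le, OF fin fin gX g that(2)]
        push_in_order_polyhedron[where g = h and le = le and le' = le, OF fin fin hX h that(2)]
      by (auto intro!: order_polyhedron_segment)
  qed
  ultimately show ?thesis
    unfolding homotopic_with_def
    by (intro exI[of _ ?H]) auto
qed

section \<open>Removing a vertex with contractible link\<close>

lemma continuous_on_snd_coordinate [continuous_intros]:
  "continuous_on S (\<lambda>p. snd p v :: real)"
  by (rule continuous_on_product_then_coordinatewise) (intro continuous_intros)

definition link :: "'a set \<Rightarrow> ('a \<Rightarrow> 'a \<Rightarrow> bool) \<Rightarrow> 'a \<Rightarrow> 'a set" where
  "link X le x = {y \<in> X. y \<noteq> x \<and> (le x y \<or> le y x)}"

text \<open>A point near the apex of the cone over the link is pushed into the link along the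
  contraction; the height above the link serves as the time of the contraction.\<close>
lemma remove_point_homotopy_eqv:
  assumes fin: "finite X" and x: "x \<in> X" and refl: "le x x"
    and contr: "contractible (order_polyhedron (link X le x) le)"
    and ne: "order_polyhedron (link X le x) le \<noteq> {}"
  shows "order_polyhedron X le homotopy_eqv order_polyhedron (X - {x}) le"
proof -
  define L where "L = link X le x"
  let ?P = "order_polyhedron X le" and ?PL = "order_polyhedron L le"
  have LX: "L \<subseteq> X - {x}" by (auto simp: L_def link_def)
  then have finL: "finite L" using fin finite_subset by blast
  have PL: "?PL \<subseteq> order_polyhedron (X - {x}) le" "order_polyhedron (X - {x}) le \<subseteq> ?P"
    using order_polyhedron_mono[of "X - {x}" L le] order_polyhedron_mono[of X "X - {x}" le] fin LX
    by auto
  obtain a H where contH: "continuous_on ({0..1::real} \<times> ?PL) H"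
    and HPL: "H ` ({0..1} \<times> ?PL) \<subseteq> ?PL" and H0: "\<And>l. H (0, l) = l" and H1: "\<And>l. H (1, l) = a"
    using contr unfolding contractible_def homotopic_with_def L_def by force
  have a: "a \<in> ?PL"
  proof -
    obtain l where "l \<in> ?PL" using ne L_def by blast
    then have "H (1, l) \<in> ?PL" using HPL by force
    then show ?thesis using H1 by simp
  qed
  \<comment> \<open>On the polyhedron this is positive exactly on the open star of \<open>x\<close>
    and zero exactly on the link. It lets two continuous maps be glued along closed sets;
    \<open>z x\<close> alone does not separate the regions, being nonnegative everywhere.\<close>
  define \<phi> where "\<phi> z = z x - (\<Sum>v\<in>X - L - {x}. z v)" for z :: "'a \<Rightarrow> real"
  \<comment> \<open>Radial projection from the apex \<open>x\<close> onto the link, applied only for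
    \<open>z x \<le> 1/2\<close>, away from the apex.\<close>
  define base where "base z = (\<lambda>v. (if v = x then 0 else z v) / (1 - z x))" for z :: "'a \<Rightarrow> real"
  define cone where "cone c l = (\<lambda>v. (1 - c) * l v + (if v = x then c else 0))"
    for c :: real and l :: "'a \<Rightarrow> real"
  \<comment> \<open>Until time 1/2 the base moves along the contraction up to parameter
    \<open>2 * z x\<close>; afterwards the height above the link shrinks to 0. The factor 2 makes
    the apex be reached at \<open>z x = 1/2\<close> already: at full height the base is irrelevant,
    and at parameter 1 it is \<open>a\<close>, so the branches agree there.\<close>
  define K where "K = (\<lambda>(s, z). if \<phi> z \<le> 0 then z
      else if z x \<le> 1/2 then cone (2 * z x * min 1 (2 - 2 * s)) (H (2 * z x * min 1 (2 * s), base z))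
      else cone (min 1 (2 - 2 * s)) a)"
  have off_star: "z x = 0" if z: "z \<in> ?P" and "\<phi> z \<le> 0" for z
  proof (rule ccontr)
    assume nz: "z x \<noteq> 0"
    have "z v = 0" if "v \<in> X - L - {x}" for v
      using order_polyhedronD(3)[OF z nz, of v] that by (auto simp: L_def link_def)
    then have "(\<Sum>v\<in>X - L - {x}. z v) = 0" by (simp add: sum.neutral)
    then show False using nz order_polyhedronD(1)[OF z, of x] \<open>\<phi> z \<le> 0\<close> by (simp add: \<phi>_def)
  qed
  have on_star: "z v = 0" if z: "z \<in> ?P" and "0 \<le> \<phi> z" "v \<notin> L" "v \<noteq> x" for z v
  proof (cases "v \<in> X \<and> z x = 0")
    case True
    then have "(\<Sum>v\<in>X - L - {x}. z v) \<le> 0" using \<open>0 \<le> \<phi> z\<close> by (simp add: \<phi>_def)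
    moreover have "z v \<le> (\<Sum>v\<in>X - L - {x}. z v)"
      by (rule member_le_sum) (use True that fin order_polyhedronD(1)[OF z] in auto)
    ultimately show ?thesis using order_polyhedronD(1)[OF z, of v] by linarith
  next
    case False
    then show ?thesis
      using order_polyhedronD(2,3)[OF z, of v] order_polyhedronD(3)[OF z, of x v] that
      by (auto simp: L_def link_def)
  qed
  have base: "base z \<in> ?PL" if z: "z \<in> ?P" and "0 \<le> \<phi> z" "z x \<le> 1/2" for z
  proof -
    have "sum z X = z x + sum z (X - {x})" using fin x by (simp add: sum.remove)
    moreover have "sum z (X - {x}) = sum z L"
      by (rule sum.mono_neutral_right) (use fin LX on_star[OF z \<open>0 \<le> \<phi> z\<close>] in auto)
    ultimately have "sum z L = 1 - z x" using order_polyhedronD(4)[OF z] by simp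
    moreover have "sum (base z) L = sum z L / (1 - z x)"
      unfolding base_def sum_divide_distrib by (rule sum.cong) (use LX in auto)
    ultimately have "sum (base z) L = 1" using that by simp
    then show ?thesis
      using order_polyhedronD[OF z] on_star[OF z \<open>0 \<le> \<phi> z\<close>] that
      by (auto simp: order_polyhedron_def base_def)
  qed
  have base_off: "base z = z" if "z x = 0" for z
    using that by (auto simp: base_def)
  have cone: "cone c l \<in> ?P" if "0 \<le> c" "c \<le> 1" "l \<in> ?PL" for c l
  proof -
    have "(\<lambda>v. if v = x then 1 else 0) \<in> ?P"
      using fin x refl by (auto simp: order_polyhedron_def sum.delta)
    moreover have "l \<in> ?P" using that PL by blast
    moreover have "le u v \<or> le v u" if "l u \<noteq> 0" "(if v = x then 1 else 0::real) \<noteq> 0" for u v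
      using that order_polyhedronD(2)[OF \<open>l \<in> ?PL\<close>, of u] by (auto simp: L_def link_def split: if_splits)
    ultimately have "(\<lambda>v. (1 - c) * l v + c * (if v = x then 1 else 0)) \<in> ?P"
      using that by (intro order_polyhedron_segment) auto
    then show ?thesis by (simp add: cone_def if_distrib cong: if_cong)
  qed
  have cont_\<phi>: "continuous_on S (\<lambda>p. \<phi> (snd p))" for S :: "(real \<times> ('a \<Rightarrow> real)) set"
    unfolding \<phi>_def by (intro continuous_intros)
  have cont_cone: "continuous_on S (\<lambda>p. cone (c p) (l p))"
    if "continuous_on S c" "continuous_on S l"
    for S :: "(real \<times> ('a \<Rightarrow> real)) set" and c l
    unfolding cone_def
  proof (rule continuous_on_coordinatewise_then_product)
    fix v
    show "continuous_on S (\<lambda>p. (1 - c p) * l p v + (if v = x then c p else 0))"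
      using that(1) continuous_on_product_then_coordinatewise[OF that(2)]
      by (cases "v = x") (auto intro!: continuous_intros)
  qed
  let ?D = "{0..1::real} \<times> ?P"
  have contK: "continuous_on ?D K"
    unfolding K_def case_prod_unfold
  proof (rule continuous_on_cases_le[OF _ _ cont_\<phi>])
    let ?S = "{t \<in> ?D. 0 \<le> \<phi> (snd t)}"
    let ?T = "{t \<in> ?S. snd t x \<le> 1/2}"
    show "continuous_on ?S (\<lambda>p. if snd p x \<le> 1/2
        then cone (2 * snd p x * min 1 (2 - 2 * fst p)) (H (2 * snd p x * min 1 (2 * fst p), base (snd p)))
        else cone (min 1 (2 - 2 * fst p)) a)"
    proof (rule continuous_on_cases_le)
      have "continuous_on ?T (\<lambda>p. base (snd p))"
        unfolding base_def
      proof (rule continuous_on_coordinatewise_then_product)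
        fix v
        show "continuous_on ?T (\<lambda>p. (if v = x then 0 else snd p v) / (1 - snd p x))"
          by (cases "v = x") (auto intro!: continuous_intros)
      qed
      then have "continuous_on ?T (\<lambda>p. (2 * snd p x * min 1 (2 * fst p), base (snd p)))"
        by (rule continuous_on_Pair[rotated]) (intro continuous_intros)
      moreover have "(2 * snd p x * min 1 (2 * fst p), base (snd p)) \<in> {0..1} \<times> ?PL" if "p \<in> ?T" for p
      proof -
        have "0 \<le> snd p x" using that order_polyhedronD(1)[of "snd p" X le x] by auto
        then have "0 \<le> 2 * snd p x * min 1 (2 * fst p)" "2 * snd p x * min 1 (2 * fst p) \<le> 1"
          using that mult_le_one[of "2 * snd p x" "min 1 (2 * fst p)"] by auto
        then show ?thesis using that base by auto
      qed
      ultimately have "continuous_on ?T (\<lambda>p. H (2 * snd p x * min 1 (2 * fst p), base (snd p)))"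
        by (intro continuous_on_compose2[OF contH]) auto
      then show "continuous_on ?T (\<lambda>p. cone (2 * snd p x * min 1 (2 - 2 * fst p))
          (H (2 * snd p x * min 1 (2 * fst p), base (snd p))))"
        by (rule cont_cone[rotated]) (intro continuous_intros)
      show "continuous_on {t \<in> ?S. 1/2 \<le> snd t x} (\<lambda>p. cone (min 1 (2 - 2 * fst p)) a)"
        by (intro cont_cone continuous_intros)
      show "continuous_on ?S (\<lambda>p. snd p x)" by (intro continuous_intros)
      show "cone (2 * snd p x * min 1 (2 - 2 * fst p)) (H (2 * snd p x * min 1 (2 * fst p), base (snd p)))
          = cone (min 1 (2 - 2 * fst p)) a" if "p \<in> ?S" "snd p x = 1/2" for p
      proof (cases "fst p \<le> 1/2")
        case True
        then have "min 1 (2 - 2 * fst p) = 1" by simp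
        moreover have "2 * snd p x = 1" using that by simp
        ultimately show ?thesis by (simp only: cone_def mult_1) simp
      next
        case False
        then have "min 1 (2 * fst p) = 1" by simp
        moreover have "2 * snd p x = 1" using that by simp
        ultimately show ?thesis by (simp only: H1 mult_1)
      qed
    qed
    show "continuous_on {t \<in> ?D. \<phi> (snd t) \<le> 0} (\<lambda>p. snd p)" by (intro continuous_intros)
    show "snd p = (if snd p x \<le> 1/2
        then cone (2 * snd p x * min 1 (2 - 2 * fst p)) (H (2 * snd p x * min 1 (2 * fst p), base (snd p)))
        else cone (min 1 (2 - 2 * fst p)) a)" if "p \<in> ?D" "\<phi> (snd p) = 0" for p
      using that off_star[of "snd p"] by (auto simp: cone_def H0 base_off)
  qed
  have KP: "K (s, z) \<in> ?P" if s: "s \<in> {0..1}" and z: "z \<in> ?P" for s z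
  proof -
    have zx: "0 \<le> z x" using order_polyhedronD(1)[OF z] .
    have le1: "2 * z x * min 1 u \<le> 1" "0 \<le> 2 * z x * min 1 u" if "0 \<le> u" "z x \<le> 1/2" for u
      using that zx mult_le_one[of "2 * z x" "min 1 u"] by auto
    have "H (2 * z x * min 1 (2 * s), base z) \<in> ?PL" if "0 < \<phi> z" "z x \<le> 1/2"
    proof -
      have "(2 * z x * min 1 (2 * s), base z) \<in> {0..1} \<times> ?PL"
        using base[OF z] that le1[of "2 * s"] s by auto
      then show ?thesis using HPL by blast
    qed
    then show ?thesis
      unfolding K_def using z s a le1[of "2 - 2 * s"] by (auto intro!: cone)
  qed
  define r where "r z = K (1, z)" for z
  have r_off: "r z = z" if "z \<in> ?P" "z x = 0" for z
  proof -
    have "\<phi> z \<le> 0" using that order_polyhedronD(1)[OF that(1)] by (auto simp: \<phi>_def intro: sum_nonneg)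
    then show ?thesis by (simp add: r_def K_def)
  qed
  have rP: "r z \<in> order_polyhedron (X - {x}) le" if z: "z \<in> ?P" for z
  proof -
    have "r z x = 0"
    proof -
      have "H (2 * z x, base z) x = 0" if "0 < \<phi> z" "z x \<le> 1/2"
      proof -
        have "(2 * z x, base z) \<in> {0..1} \<times> ?PL" using base[OF z] that order_polyhedronD(1)[OF z] by auto
        then have "H (2 * z x, base z) \<in> ?PL" using HPL by blast
        then show ?thesis using order_polyhedronD(2) LX by fastforce
      qed
      moreover have "a x = 0" using order_polyhedronD(2)[OF a] LX by blast
      ultimately show ?thesis
        using off_star[OF z] by (auto simp: r_def K_def cone_def)
    qed
    moreover have "r z \<in> ?P" unfolding r_def by (rule KP) (use z in auto)
    ultimately show ?thesis
      using sum.remove[OF fin x, of "r z"] by (auto simp: order_polyhedron_def)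
  qed
  have K0_supp: "z u \<noteq> 0" if z: "z \<in> ?P" and "K (0, z) u \<noteq> 0" for z u
  proof (cases "\<phi> z \<le> 0")
    case True
    then show ?thesis using that by (simp add: K_def)
  next
    case False
    then have "z x \<noteq> 0"
      using order_polyhedronD(1)[OF z] by (auto simp: \<phi>_def sum_nonneg)
    then show ?thesis
      using that False by (auto simp: K_def cone_def H0 base_def split: if_splits)
  qed
  \<comment> \<open>\<open>K\<close> starts at the stretching of the star and not at the identity.
    Supports only shrink under it (\<open>K0_supp\<close>), so a straight line joins the
    two.\<close>
  have "homotopic_with_canon (\<lambda>x. True) ?P ?P id (\<lambda>z. K (0, z))"
  proof -
    let ?J = "\<lambda>(t, z). (\<lambda>v. (1 - t) * z v + t * K (0, z) v)"
    have "continuous_on ?D (\<lambda>p. K (0, snd p))"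
      by (rule continuous_on_compose2[OF contK]) (auto intro!: continuous_intros)
    then have "continuous_on ?D ?J"
      unfolding case_prod_unfold
      by (intro continuous_on_coordinatewise_then_product continuous_intros)
        (rule continuous_on_product_then_coordinatewise)
    moreover have "?J (t, z) \<in> ?P" if "t \<in> {0..1}" "z \<in> ?P" for t z
      using that KP[of 0 z] K0_supp[of z] order_polyhedronD(3)[of z X le]
      by (auto intro!: order_polyhedron_segment)
    ultimately show ?thesis
      unfolding homotopic_with_def by (intro exI[of _ ?J]) auto
  qed
  moreover have "homotopic_with_canon (\<lambda>x. True) ?P ?P (\<lambda>z. K (0, z)) r"
    unfolding homotopic_with_def
    by (intro exI[of _ K]) (use contK KP in \<open>auto simp: r_def\<close>)
  ultimately have hom: "homotopic_with_canon (\<lambda>x. True) ?P ?P id r"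
    by (rule homotopic_with_trans)
  let ?Q = "order_polyhedron (X - {x}) le"
  have "continuous_on ?P r" using hom homotopic_with_imp_continuous by blast
  moreover have "homotopic_with_canon (\<lambda>x. True) ?Q ?Q (r \<circ> id) id"
    by (rule homotopic_with_id2)
      (use PL(2) r_off order_polyhedronD(2)[of _ "X - {x}" le x] in auto)
  ultimately show ?thesis
    unfolding homotopy_equivalent_space_def
    by (intro exI[of _ r] exI[of _ id])
      (use PL(2) rP hom homotopic_with_sym in \<open>auto simp: homotopic_with_sym\<close>)
qed

section \<open>Fences of monotone maps\<close>

text \<open>Relative to a carrier, because refinement is antisymmetric only between decompositions
  and not between arbitrary families of sets.\<close>

definition porder_on :: "'a set \<Rightarrow> ('a \<Rightarrow> 'a \<Rightarrow> bool) \<Rightarrow> bool" where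
  "porder_on X le \<longleftrightarrow> reflp_on X le \<and> antisymp_on X le \<and> transp_on X le"

lemma porder_onD:
  assumes "porder_on X le"
  shows "x \<in> X \<Longrightarrow> le x x"
    and "x \<in> X \<Longrightarrow> y \<in> X \<Longrightarrow> le x y \<Longrightarrow> le y x \<Longrightarrow> x = y"
    and "x \<in> X \<Longrightarrow> y \<in> X \<Longrightarrow> z \<in> X \<Longrightarrow> le x y \<Longrightarrow> le y z \<Longrightarrow> le x z"
  using assms unfolding porder_on_def
  by (meson reflp_onD, meson antisymp_onD, meson transp_onD)

lemma porder_onI:
  assumes "\<And>x. x \<in> X \<Longrightarrow> le x x"
    and "\<And>x y. x \<in> X \<Longrightarrow> y \<in> X \<Longrightarrow> le x y \<Longrightarrow> le y x \<Longrightarrow> x = y"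
    and "\<And>x y z. x \<in> X \<Longrightarrow> y \<in> X \<Longrightarrow> z \<in> X \<Longrightarrow> le x y \<Longrightarrow> le y z \<Longrightarrow> le x z"
  shows "porder_on X le"
  unfolding porder_on_def
  by (intro conjI reflp_onI antisymp_onI transp_onI) (fact assms)+

lemma porder_on_subset: "porder_on X le \<Longrightarrow> Y \<subseteq> X \<Longrightarrow> porder_on Y le"
  unfolding porder_on_def
  using reflp_on_subset antisymp_on_subset transp_on_subset by blast

lemma porder_on_converse: "porder_on X le \<Longrightarrow> porder_on X (\<lambda>x y. le y x)"
  by (rule porder_onI) (meson porder_onD(1), meson porder_onD(2), meson porder_onD(3))

lemma porder_on_ex_minimal:
  assumes "porder_on X le" "finite X" "U \<subseteq> X" "U \<noteq> {}"
  obtains x where "x \<in> U" "\<And>y. y \<in> U \<Longrightarrow> le y x \<Longrightarrow> y = x"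
proof -
  let ?R = "\<lambda>x y. le x y \<and> x \<noteq> y"
  note U = porder_onD[OF porder_on_subset[OF assms(1,3)]]
  have "asymp_on U ?R" by (rule asymp_onI) (use U(2) in blast)
  moreover have "transp_on U ?R"
  proof (rule transp_onI)
    fix x y z assume xyz: "x \<in> U" "y \<in> U" "z \<in> U" "?R x y" "?R y z"
    have "le x z" by (rule U(3)[of x y z]) (use xyz in simp_all)
    moreover have "x \<noteq> z" using U(2)[of x y] xyz by auto
    ultimately show "?R x z" by simp
  qed
  moreover have "finite U" using assms(2,3) finite_subset by blast
  ultimately obtain x where "x \<in> U" "\<forall>y\<in>U. y \<noteq> x \<longrightarrow> \<not> ?R y x"
    using Finite_Set.bex_min_element[of U ?R] assms(4) by blast
  then show ?thesis using that by blast
qed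

lemma porder_on_ex_maximal:
  assumes "porder_on X le" "finite X" "U \<subseteq> X" "U \<noteq> {}"
  obtains x where "x \<in> U" "\<And>y. y \<in> U \<Longrightarrow> le x y \<Longrightarrow> y = x"
  using porder_on_ex_minimal[OF porder_on_converse[OF assms(1)] assms(2-)] by blast

text \<open>A combinatorial stand-in for a homotopy from the identity. All contractions of links and
  fibres are given in this form, so topology enters them only once, in
  \<open>fence_homotopic\<close>.\<close>

inductive fence :: "'a set \<Rightarrow> ('a \<Rightarrow> 'a \<Rightarrow> bool) \<Rightarrow> ('a \<Rightarrow> 'a) \<Rightarrow> bool" for L le where
  fence_id: "fence L le (\<lambda>x. x)"
| fence_step: "fence L le g \<Longrightarrow> h \<in> L \<rightarrow> L \<Longrightarrow> monotone_on L le le h \<Longrightarrow>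
    (\<forall>x\<in>L. le (g x) (h x)) \<or> (\<forall>x\<in>L. le (h x) (g x)) \<Longrightarrow> fence L le h"

lemma fence_mono: "fence L le g \<Longrightarrow> g \<in> L \<rightarrow> L \<and> monotone_on L le le g"
  by (induction rule: fence.induct) (auto simp: monotone_on_def)

definition fence_contractible :: "'a set \<Rightarrow> ('a \<Rightarrow> 'a \<Rightarrow> bool) \<Rightarrow> bool" where
  "fence_contractible L le \<longleftrightarrow> (\<exists>c\<in>L. fence L le (\<lambda>_. c))"

text \<open>The straight-line homotopy between two comparable monotone maps need not stay inside the
  polyhedron; it does if the maps differ at a single element, so the values are changed one at
  a time, from the top downwards.\<close>
lemma homotopic_push_le:
  assumes fin: "finite L" and po: "porder_on L le"
    and g: "g \<in> L \<rightarrow> L" "monotone_on L le le g" and h: "h \<in> L \<rightarrow> L" "monotone_on L le le h"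
    and gh: "\<And>x. x \<in> L \<Longrightarrow> le (g x) (h x)"
  shows "homotopic_with_canon (\<lambda>x. True) (order_polyhedron L le) (order_polyhedron L le)
           (push L g) (push L h)"
proof -
  let ?hom = "homotopic_with_canon (\<lambda>x. True) (order_polyhedron L le) (order_polyhedron L le)"
  \<comment> \<open>\<open>U\<close> will be an up-set: with \<open>h\<close> on top and
    \<open>g\<close> below, the mixed map is monotone because \<open>g u\<close> lies below
    \<open>g v\<close> and this below \<open>h v\<close>.\<close>
  let ?k = "\<lambda>U x. if x \<in> U then h x else g x"
  note po' = porder_onD[OF po]
  have kL: "?k U x \<in> L" if "x \<in> L" for U x using that g(1) h(1) by auto
  have k_mono: "le (?k U u) (?k U v)"
    if up: "\<And>x y. x \<in> U \<Longrightarrow> y \<in> L \<Longrightarrow> le x y \<Longrightarrow> y \<in> U" and "u \<in> L" "v \<in> L" "le u v" for U u v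
  proof -
    have "le (g u) (g v)" "le (h u) (h v)" using that g(2) h(2) by (auto simp: monotone_on_def)
    moreover have "le (g u) (h v)"
      by (rule po'(3)[of _ "g v"]) (use calculation gh g(1) h(1) that in auto)
    moreover have "u \<in> U \<Longrightarrow> v \<in> U" using up[of u v] that by blast
    ultimately show ?thesis by simp
  qed
  have "?hom (push L g) (push L (?k U))"
    if "U \<subseteq> L" "\<And>x y. x \<in> U \<Longrightarrow> y \<in> L \<Longrightarrow> le x y \<Longrightarrow> y \<in> U" for U
    using finite_subset[OF that(1) fin] that
  proof (induction "card U" arbitrary: U)
    case 0
    then have "U = {}" by simp
    moreover have "push L g \<in> order_polyhedron L le \<rightarrow> order_polyhedron L le"
      using push_in_order_polyhedron[OF fin fin, of g le le] g by (auto simp: monotone_on_def Pi_def)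
    ultimately show ?case
      by (simp add: continuous_on_push)
  next
    case (Suc n)
    then have "U \<noteq> {}" by auto
    then obtain x where x: "x \<in> U" "\<And>y. y \<in> U \<Longrightarrow> le y x \<Longrightarrow> y = x"
      using porder_on_ex_minimal[OF po fin Suc.prems(2)] by blast
    let ?V = "U - {x}"
    have upV: "y' \<in> ?V" if "y \<in> ?V" "y' \<in> L" "le y y'" for y y'
      using that Suc.prems(3)[of y y'] x by auto
    have "?hom (push L g) (push L (?k ?V))"
    proof (rule Suc.hyps(1))
      show "n = card ?V" using Suc.hyps(2) x(1) by simp
      show "finite ?V" "?V \<subseteq> L" using Suc.prems(1,2) by auto
    qed (rule upV)
    moreover have "?hom (push L (?k ?V)) (push L (?k U))"
    proof (rule homotopic_push[OF fin])
      show "?k ?V u \<in> L" "?k U u \<in> L" if "u \<in> L" for u using that kL by blast+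
      show "le (?k ?V u) (?k ?V v)" if "u \<in> L" "v \<in> L" "le u v" for u v
        by (rule k_mono[OF upV that])
      show "le (?k U u) (?k U v)" if "u \<in> L" "v \<in> L" "le u v" for u v
        by (rule k_mono[OF Suc.prems(3) that])
      \<comment> \<open>The two maps differ only at \<open>x\<close>. Unless
        \<open>u = v = x\<close>, the claim is therefore monotonicity of one of them; at
        \<open>x\<close> itself it is \<open>gh\<close>.\<close>
      show "le (?k ?V u) (?k U v) \<or> le (?k U v) (?k ?V u)"
        if uv: "u \<in> L" "v \<in> L" "le u v \<or> le v u" for u v
      proof (cases "v = x")
        case False
        then have "?k U v = ?k ?V v" by simp
        moreover have "le (?k ?V u) (?k ?V v) \<or> le (?k ?V v) (?k ?V u)"
          using k_mono[of ?V u v] k_mono[of ?V v u] uv upV by blast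
        ultimately show ?thesis by (simp only:)
      next
        case v: True
        show ?thesis
        proof (cases "u = x")
          case True
          then show ?thesis using v x(1) gh uv by simp
        next
          case False
          then have "?k ?V u = ?k U u" by simp
          moreover have "le (?k U u) (?k U v) \<or> le (?k U v) (?k U u)"
            using k_mono[of U u v] k_mono[of U v u] uv Suc.prems(3) by blast
          ultimately show ?thesis by (simp only:)
        qed
      qed
    qed
    ultimately show ?case by (rule homotopic_with_trans)
  qed
  from this[of L] have "?hom (push L g) (push L (?k L))" by simp
  moreover have "push L (?k L) = push L h" by (auto simp: push_def fun_eq_iff intro!: sum.cong)
  ultimately show ?thesis by simp
qed

lemma fence_homotopic:
  assumes fin: "finite L" and po: "porder_on L le" and "fence L le g"
  shows "homotopic_with_canon (\<lambda>x. True) (order_polyhedron L le) (order_polyhedron L le)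
           (push L (\<lambda>x. x)) (push L g)"
  using assms(3)
proof (induction rule: fence.induct)
  case fence_id
  show ?case
    using homotopic_push_le[OF fin po, of "\<lambda>x. x" "\<lambda>x. x"] porder_onD(1)[OF po]
    by (auto simp: monotone_on_def)
next
  case (fence_step g h)
  note g = fence_mono[OF fence_step.hyps(1)]
  have "homotopic_with_canon (\<lambda>x. True) (order_polyhedron L le) (order_polyhedron L le)
           (push L g) (push L h)"
    using fence_step.hyps(4)
  proof
    assume "\<forall>x\<in>L. le (g x) (h x)"
    then show ?thesis using homotopic_push_le[OF fin po, of g h] g fence_step.hyps by blast
  next
    assume "\<forall>x\<in>L. le (h x) (g x)"
    then show ?thesis
      using homotopic_push_le[OF fin po, of h g] g fence_step.hyps homotopic_with_symD by blast
  qed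
  then show ?case using fence_step.IH homotopic_with_trans by blast
qed

lemma fence_contractible_imp_contractible:
  assumes fin: "finite L" and po: "porder_on L le" and "fence_contractible L le"
  shows "contractible (order_polyhedron L le)" "order_polyhedron L le \<noteq> {}"
proof -
  let ?P = "order_polyhedron L le"
  obtain c where c: "c \<in> L" "fence L le (\<lambda>_. c)"
    using assms(3) by (auto simp: fence_contractible_def)
  define e where "e = (\<lambda>v. if v = c then 1 else 0 :: real)"
  have "homotopic_with_canon (\<lambda>x. True) ?P ?P id (\<lambda>_. e)"
  proof (rule homotopic_with_eq[OF fence_homotopic[OF fin po c(2)]])
    show "id x = push L (\<lambda>x. x) x" if "x \<in> topspace (top_of_set ?P)" for x
      using push_id[OF fin] that by simp
    show "e = push L (\<lambda>_. c) x" if "x \<in> topspace (top_of_set ?P)" for x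
      using order_polyhedronD(4)[of x L le] that by (auto simp: push_def e_def fun_eq_iff)
  qed simp
  then show "contractible ?P" unfolding contractible_def by blast
  have "e \<in> ?P"
    using c(1) fin porder_onD(1)[OF po c(1)] by (auto simp: order_polyhedron_def e_def)
  then show "?P \<noteq> {}" by blast
qed

text \<open>With \<open>?k y\<close> the larger of \<open>y\<close> and \<open>m\<close>, the fence
  is \<open>y \<le> ?k y \<ge> m\<close>.\<close>

lemma fence_contractible_cone:
  assumes po: "porder_on L le" and m: "m \<in> L" and comp: "\<And>y. y \<in> L \<Longrightarrow> le y m \<or> le m y"
  shows "fence_contractible L le"
proof -
  let ?k = "\<lambda>y. if le m y then y else m"
  note po' = porder_onD[OF po]
  have "monotone_on L le le ?k"
  proof (rule monotone_onI)
    fix y z assume yz: "y \<in> L" "z \<in> L" "le y z"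
    have "le m y \<Longrightarrow> le m z" using po'(3)[OF m yz(1,2)] yz(3) by blast
    then show "le (?k y) (?k z)" using yz(3) po'(1)[OF m] by auto
  qed
  then have "fence L le ?k"
    by (intro fence_step[OF fence_id]) (use m po'(1) comp in auto)
  then have "fence L le (\<lambda>_. m)"
    by (rule fence_step) (use m po'(1) in \<open>auto simp: monotone_on_def\<close>)
  then show ?thesis using m unfolding fence_contractible_def by blast
qed

lemma fence_contractible_image:
  assumes "fence_contractible A le" and po: "porder_on A le" and inj: "inj_on e A"
    and emb: "\<And>x y. x \<in> A \<Longrightarrow> y \<in> A \<Longrightarrow> le' (e x) (e y) \<longleftrightarrow> le x y"
  shows "fence_contractible (e ` A) le'"
proof -
  let ?i = "inv_into A e"
  have "\<exists>g'. fence (e ` A) le' g' \<and> (\<forall>x\<in>A. g' (e x) = e (g x))" if "fence A le g" for g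
    using that
  proof (induction rule: fence.induct)
    case fence_id
    show ?case by (rule exI[of _ "\<lambda>x. x"]) (auto intro: fence.fence_id)
  next
    case (fence_step g h)
    then obtain g' where g': "fence (e ` A) le' g'" "\<forall>x\<in>A. g' (e x) = e (g x)" by blast
    have g: "g x \<in> A" if "x \<in> A" for x using fence_mono[OF fence_step.hyps(1)] that by auto
    have h: "h x \<in> A" if "x \<in> A" for x using fence_step.hyps(2) that by auto
    have "fence (e ` A) le' (\<lambda>y. e (h (?i y)))"
    proof (rule fence.fence_step[OF g'(1)])
      show "(\<lambda>y. e (h (?i y))) \<in> e ` A \<rightarrow> e ` A" using h inj by auto
      show "monotone_on (e ` A) le' le' (\<lambda>y. e (h (?i y)))"
        using fence_step.hyps(3) inj emb h by (auto simp: monotone_on_def)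
      show "(\<forall>y\<in>e ` A. le' (g' y) (e (h (?i y)))) \<or> (\<forall>y\<in>e ` A. le' (e (h (?i y))) (g' y))"
        using fence_step.hyps(4) g'(2) inj emb g h by auto
    qed
    then show ?case by (rule exI[of _ "\<lambda>y. e (h (?i y))", OF conjI]) (use inj in auto)
  qed
  moreover obtain c where c: "c \<in> A" "fence A le (\<lambda>_. c)"
    using assms(1) by (auto simp: fence_contractible_def)
  ultimately obtain g' where g': "fence (e ` A) le' g'" "\<forall>x\<in>A. g' (e x) = e c" by meson
  have "le' (e c) (e c)" using emb c(1) porder_onD(1)[OF po] by simp
  \<comment> \<open>\<open>g'\<close> is known to be constant only on the image of \<open>e\<close>.
    One more step, between maps that agree there, makes it constant as a function.\<close>
  then have "fence (e ` A) le' (\<lambda>_. e c)"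
    by (intro fence_step[OF g'(1)]) (use g'(2) c(1) in \<open>auto simp: monotone_on_def\<close>)
  then show ?thesis using c(1) unfolding fence_contractible_def by blast
qed

text \<open>The link of \<open>x\<close> is the join of what lies below and what lies above, and a
  join is contractible if one factor is. A fence on the lower part extends by the identity on the
  upper part; maps stay monotone since each lower element is below each upper one.\<close>

lemma remove_down:
  assumes fin: "finite X" and po: "porder_on X le" and x: "x \<in> X"
    and contr: "fence_contractible {y \<in> X. le y x \<and> y \<noteq> x} le"
  shows "order_polyhedron X le homotopy_eqv order_polyhedron (X - {x}) le"
proof -
  let ?A = "{y \<in> X. le y x \<and> y \<noteq> x}" and ?L = "link X le x"
  note po' = porder_onD[OF po]
  have poL: "porder_on ?L le" by (rule porder_on_subset[OF po]) (auto simp: link_def)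
  have AL: "?A \<subseteq> ?L" by (auto simp: link_def)
  have above: "le y z" if "y \<in> ?A" "z \<in> ?L - ?A" for y z
    using that po'(3)[of y x z] x by (auto simp: link_def)
  have ext: "fence ?L le (\<lambda>y. if y \<in> ?A then g y else y)" if "fence ?A le g" for g
    using that
  proof (induction rule: fence.induct)
    case fence_id
    show ?case using fence.fence_id[of ?L le] by simp
  next
    case (fence_step g h)
    show ?case
    proof (rule fence.fence_step[OF fence_step.IH])
      show "(\<lambda>y. if y \<in> ?A then h y else y) \<in> ?L \<rightarrow> ?L"
        using fence_step.hyps(2) AL by (auto simp: Pi_iff)
      show "monotone_on ?L le le (\<lambda>y. if y \<in> ?A then h y else y)"
      proof (rule monotone_onI)
        fix y z assume yz: "y \<in> ?L" "z \<in> ?L" "le y z"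
        have hA: "h y \<in> ?A" if "y \<in> ?A" for y using fence_step.hyps(2) that by blast
        show "le (if y \<in> ?A then h y else y) (if z \<in> ?A then h z else z)"
        proof (cases "z \<in> ?A")
          case True
          then have "y \<in> ?A"
            using yz po'(3)[of y z x] po'(2)[of z x] x by (auto simp: link_def)
          then show ?thesis
            using True yz fence_step.hyps(3) unfolding monotone_on_def by simp
        next
          case False
          then show ?thesis using hA[of y] above[of "h y" z] yz by auto
        qed
      qed
      show "(\<forall>y\<in>?L. le (if y \<in> ?A then g y else y) (if y \<in> ?A then h y else y)) \<or>
            (\<forall>y\<in>?L. le (if y \<in> ?A then h y else y) (if y \<in> ?A then g y else y))"
        using fence_step.hyps(4) porder_onD(1)[OF poL] by auto
    qed
  qed
  obtain c where c: "c \<in> ?A" "fence ?A le (\<lambda>_. c)"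
    using contr unfolding fence_contractible_def by blast
  have "fence ?L le (\<lambda>_. c)"
  proof (rule fence_step[OF ext[OF c(2)]])
    show "(\<forall>y\<in>?L. le (if y \<in> ?A then c else y) c) \<or> (\<forall>y\<in>?L. le c (if y \<in> ?A then c else y))"
      using above[OF c(1)] po'(1) c(1) by auto
  qed (use c(1) AL po'(1) in \<open>auto simp: monotone_on_def\<close>)
  then have "fence_contractible ?L le"
    using c(1) AL unfolding fence_contractible_def by blast
  moreover have "finite ?L" using fin by (simp add: link_def)
  ultimately show ?thesis
    using fence_contractible_imp_contractible[OF _ poL]
    by (intro remove_point_homotopy_eqv[where le = le, OF fin x po'(1)[OF x]])
qed

text \<open>\<open>m\<close> is a cone point of the link: it is below everything above
  \<open>x\<close> by hypothesis and above everything below \<open>x\<close> by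
  transitivity.\<close>

lemma remove_up:
  assumes fin: "finite X" and po: "porder_on X le" and x: "x \<in> X"
    and m: "m \<in> X" "m \<noteq> x" "le x m" and least: "\<And>y. y \<in> X \<Longrightarrow> le x y \<Longrightarrow> y \<noteq> x \<Longrightarrow> le m y"
  shows "order_polyhedron X le homotopy_eqv order_polyhedron (X - {x}) le"
proof -
  let ?L = "link X le x"
  note po' = porder_onD[OF po]
  have poL: "porder_on ?L le" by (rule porder_on_subset[OF po]) (auto simp: link_def)
  have "fence_contractible ?L le"
  proof (rule fence_contractible_cone[OF poL])
    show "m \<in> ?L" using m by (simp add: link_def)
    show "le y m \<or> le m y" if "y \<in> ?L" for y
      using that least[of y] po'(3)[of y x m] x m by (auto simp: link_def)
  qed
  moreover have "finite ?L" using fin by (simp add: link_def)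
  ultimately show ?thesis
    using fence_contractible_imp_contractible[OF _ poL]
    by (intro remove_point_homotopy_eqv[where le = le, OF fin x po'(1)[OF x]])
qed

text \<open>Minimal elements of \<open>R\<close> go first. What lies strictly below such an element
  is disjoint from \<open>R\<close>, hence exactly the set that the hypothesis contracts.\<close>

lemma remove_down_set:
  assumes "finite X" "porder_on X le" "R \<subseteq> X"
    and "\<And>r. r \<in> R \<Longrightarrow> fence_contractible {y \<in> X - R. le y r} le"
  shows "order_polyhedron X le homotopy_eqv order_polyhedron (X - R) le"
  using assms
proof (induction "card R" arbitrary: X R)
  case 0
  then have "R = {}" using finite_subset[OF "0.prems"(3,1)] by simp
  then show ?case by (simp add: homotopy_equivalent_space_refl)
next
  case (Suc n)
  then have "R \<noteq> {}" by auto
  then obtain r where r: "r \<in> R" "\<And>y. y \<in> R \<Longrightarrow> le y r \<Longrightarrow> y = r"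
    using porder_on_ex_minimal[OF Suc.prems(2,1,3)] by blast
  have rX: "r \<in> X" using r(1) Suc.prems(3) by blast
  have "{y \<in> X. le y r \<and> y \<noteq> r} = {y \<in> X - R. le y r}" using r by auto
  then have "fence_contractible {y \<in> X. le y r \<and> y \<noteq> r} le"
    using Suc.prems(4)[OF r(1)] by simp
  then have 1: "order_polyhedron X le homotopy_eqv order_polyhedron (X - {r}) le"
    by (rule remove_down[OF Suc.prems(1,2) rX])
  have eq: "X - {r} - (R - {r}) = X - R" using r(1) by auto
  have "order_polyhedron (X - {r}) le homotopy_eqv order_polyhedron (X - {r} - (R - {r})) le"
  proof (rule Suc.hyps(1))
    show "n = card (R - {r})" using Suc.hyps(2) r(1) by simp
    show "porder_on (X - {r}) le" by (rule porder_on_subset[OF Suc.prems(2)]) auto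
    show "fence_contractible {y \<in> X - {r} - (R - {r}). le y r'} le" if "r' \<in> R - {r}" for r'
      unfolding eq using Suc.prems(4)[of r'] that by simp
  qed (use Suc.prems(1,3) in auto)
  from homotopy_eqv_trans[OF 1 this] show ?case unfolding eq .
qed

text \<open>Maximal elements of \<open>R\<close> go first, so that everything strictly above them
  lies outside \<open>R\<close> and is controlled by the hypothesis.\<close>

lemma remove_up_set:
  assumes "finite X" "porder_on X le" "R \<subseteq> X"
    and "\<And>r. r \<in> R \<Longrightarrow> m r \<in> X - R \<and> le r (m r) \<and> (\<forall>y\<in>X - R. le r y \<longrightarrow> le (m r) y)"
  shows "order_polyhedron X le homotopy_eqv order_polyhedron (X - R) le"
  using assms
proof (induction "card R" arbitrary: X R)
  case 0
  then have "R = {}" using finite_subset[OF "0.prems"(3,1)] by simp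
  then show ?case by (simp add: homotopy_equivalent_space_refl)
next
  case (Suc n)
  then have "R \<noteq> {}" by auto
  then obtain r where r: "r \<in> R" "\<And>y. y \<in> R \<Longrightarrow> le r y \<Longrightarrow> y = r"
    using porder_on_ex_maximal[OF Suc.prems(2,1,3)] by blast
  have rX: "r \<in> X" using r(1) Suc.prems(3) by blast
  have m: "m r \<in> X - R" "le r (m r)" "\<forall>y\<in>X - R. le r y \<longrightarrow> le (m r) y"
    using Suc.prems(4)[OF r(1)] by blast+
  have 1: "order_polyhedron X le homotopy_eqv order_polyhedron (X - {r}) le"
  proof (rule remove_up[OF Suc.prems(1,2) rX _ _ m(2)])
    show "m r \<in> X" "m r \<noteq> r" using m(1) r(1) by auto
    show "le (m r) y" if "y \<in> X" "le r y" "y \<noteq> r" for y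
      using m(3) r(2)[of y] that by blast
  qed
  have eq: "X - {r} - (R - {r}) = X - R" using r(1) by auto
  have "order_polyhedron (X - {r}) le homotopy_eqv order_polyhedron (X - {r} - (R - {r})) le"
  proof (rule Suc.hyps(1))
    show "n = card (R - {r})" using Suc.hyps(2) r(1) by simp
    show "porder_on (X - {r}) le" by (rule porder_on_subset[OF Suc.prems(2)]) auto
    show "m r' \<in> X - {r} - (R - {r}) \<and> le r' (m r') \<and>
        (\<forall>y\<in>X - {r} - (R - {r}). le r' y \<longrightarrow> le (m r') y)" if "r' \<in> R - {r}" for r'
      unfolding eq using Suc.prems(4)[of r'] that by simp
  qed (use Suc.prems(1,3) in auto)
  from homotopy_eqv_trans[OF 1 this] show ?case unfolding eq .
qed

section \<open>Iterated suspensions of posets\<close>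

text \<open>The two poles of a level are incomparable; they lie above the poset and above all lower
  levels. Each level is one suspension.\<close>

datatype 'a suspension_node = Base 'a | Apex nat bool

definition suspension :: "nat \<Rightarrow> 'a set \<Rightarrow> 'a suspension_node set" where
  "suspension k P = Base ` P \<union> {Apex i b | i b. i < k}"

fun suspension_le :: "('a \<Rightarrow> 'a \<Rightarrow> bool) \<Rightarrow> 'a suspension_node \<Rightarrow> 'a suspension_node \<Rightarrow> bool" where
  "suspension_le le (Base x) (Base y) = le x y"
| "suspension_le le (Base x) (Apex i b) = True"
| "suspension_le le (Apex i b) (Base x) = False"
| "suspension_le le (Apex i b) (Apex j c) = (i < j \<or> i = j \<and> b = c)"

datatype ('a, 'b) cylinder_node = Low 'a | Mid 'b | Pole nat bool

text \<open>At level 0 the pole \<open>b\<close> is above \<open>a b\<close> but not above the other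
  exceptional element, while higher poles are above everything. Removing level 0 and the target
  leaves the \<open>k\<close>-fold suspension of the source; removing the source leaves the target
  with level 0 as an additional pair of poles.\<close>

fun cylinder_le :: "('a \<Rightarrow> 'a \<Rightarrow> bool) \<Rightarrow> ('b \<Rightarrow> 'b \<Rightarrow> bool) \<Rightarrow> 'a set \<Rightarrow> ('a \<Rightarrow> 'b) \<Rightarrow> (bool \<Rightarrow> 'a) \<Rightarrow>
    ('a, 'b) cylinder_node \<Rightarrow> ('a, 'b) cylinder_node \<Rightarrow> bool" where
  "cylinder_le le le' Q f a (Low p) (Low q) = le p q"
| "cylinder_le le le' Q f a (Low p) (Mid r) = (p \<in> Q \<and> le' (f p) r)"
| "cylinder_le le le' Q f a (Low p) (Pole i b) = (0 < i \<or> p \<in> Q \<or> p = a b)"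
| "cylinder_le le le' Q f a (Mid r) (Low q) = False"
| "cylinder_le le le' Q f a (Mid r) (Mid s) = le' r s"
| "cylinder_le le le' Q f a (Mid r) (Pole i b) = True"
| "cylinder_le le le' Q f a (Pole i b) (Low p) = False"
| "cylinder_le le le' Q f a (Pole i b) (Mid r) = False"
| "cylinder_le le le' Q f a (Pole i b) (Pole j c) = (i < j \<or> i = j \<and> b = c)"

lemma suspension_iso:
  assumes "finite P"
    and bij: "bij_betw g (suspension k P) Y"
    and "\<And>u v. u \<in> suspension k P \<Longrightarrow> v \<in> suspension k P \<Longrightarrow> le' (g u) (g v) \<longleftrightarrow> suspension_le le u v"
  shows "order_polyhedron (suspension k P) (suspension_le le) homotopy_eqv order_polyhedron Y le'"
proof (rule order_iso_homotopy_eqv[OF _ bij])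
  have "{Apex i b :: 'a suspension_node | i b. i < k} = (\<lambda>(i, b). Apex i b) ` ({..<k} \<times> UNIV)" by auto
  then have "finite {Apex i b :: 'a suspension_node | i b. i < k}" by (simp only:) simp
  then show "finite (suspension k P)"
    using assms(1) by (simp add: suspension_def)
qed (fact assms(3))

text \<open>A quotient map with contractible fibres and two sections, each coned off by a new maximal
  element, exhibits the source as a suspension. The comparison takes place in the mapping cylinder,
  with the two suspension points added on top.\<close>
theorem suspension_step:
  fixes leP :: "'a \<Rightarrow> 'a \<Rightarrow> bool" and leR :: "'b \<Rightarrow> 'b \<Rightarrow> bool" and a :: "bool \<Rightarrow> 'a"
  assumes finQ: "finite Q" and finR: "finite R"
    and poP: "porder_on (Q \<union> range a) leP" and poR: "porder_on R leR"
    and a: "\<And>b. a b \<notin> Q" "a True \<noteq> a False"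
      "\<And>b p. p \<in> Q \<union> range a \<Longrightarrow> leP (a b) p \<Longrightarrow> p = a b"
    and f: "f \<in> Q \<rightarrow> R" "monotone_on Q leP leR f"
    and s: "\<And>b. s b \<in> R \<rightarrow> Q" "\<And>b. monotone_on R leR leP (s b)" "\<And>b r. r \<in> R \<Longrightarrow> f (s b r) = r"
    and below: "\<And>b q. q \<in> Q \<Longrightarrow> leP q (a b) \<longleftrightarrow> q \<in> s b ` R"
    and fibre: "\<And>r. r \<in> R \<Longrightarrow> fence_contractible {q \<in> Q. leR (f q) r} leP"
  shows "order_polyhedron (suspension k (Q \<union> range a)) (suspension_le leP) homotopy_eqv
         order_polyhedron (suspension (Suc k) R) (suspension_le leR)"
proof -
  let ?le = "cylinder_le leP leR Q f a"
  let ?P = "Q \<union> range a"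
  define M where "M = Low ` ?P \<union> Mid ` R \<union> {Pole i b | i b. i < Suc k}"
  note P = porder_onD[OF poP] and R = porder_onD[OF poR]
  have fR: "f q \<in> R" if "q \<in> Q" for q using f(1) that by auto
  have fmono: "leR (f p) (f q)" if "p \<in> Q" "q \<in> Q" "leP p q" for p q
    using f(2) that by (simp add: monotone_on_def)
  have sQ: "s b r \<in> Q" if "r \<in> R" for b r using s(1) that by auto
  have smono: "leP (s b r) (s b r')" if "r \<in> R" "r' \<in> R" "leR r r'" for b r r'
    using s(2) that by (simp add: monotone_on_def)
  have into_Q: "p \<in> Q" if "p \<in> ?P" "q \<in> Q" "leP p q" for p q
    using that a(3)[of q] a(1) by auto
  have poles: "{Pole i b | i b. i < Suc k} = (\<lambda>(i, b). Pole i b) ` ({..<Suc k} \<times> UNIV)" by auto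
  have finM: "finite M" unfolding M_def poles using finQ finR by simp
  have poM: "porder_on M ?le"
  proof (rule porder_onI)
    show "?le x x" if "x \<in> M" for x
      using that P(1) R(1) by (auto simp: M_def)
    show "x = y" if xy: "x \<in> M" "y \<in> M" "?le x y" "?le y x" for x y
    proof (cases x)
      case x: (Low p)
      then obtain q where y: "y = Low q" using xy(4) by (cases y) auto
      then have "p \<in> ?P" "q \<in> ?P" using x xy(1,2) by (auto simp: M_def)
      then show ?thesis using P(2)[of p q] x y xy(3,4) by simp
    next
      case x: (Mid r)
      then obtain t where y: "y = Mid t" using xy(3,4) by (cases y) auto
      then have "r \<in> R" "t \<in> R" using x xy(1,2) by (auto simp: M_def)
      then show ?thesis using R(2)[of r t] x y xy(3,4) by simp
    qed (use xy in \<open>cases y; auto\<close>)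
    show "?le x z" if xyz: "x \<in> M" "y \<in> M" "z \<in> M" "?le x y" "?le y z" for x y z
    proof (cases x)
      case x: (Low p)
      then have p: "p \<in> ?P" using xyz(1) by (auto simp: M_def)
      show ?thesis
      proof (cases y)
        case y: (Low q)
        then have q: "q \<in> ?P" "leP p q" using xyz x by (auto simp: M_def)
        show ?thesis
        proof (cases z)
          case z: (Low t)
          then have "t \<in> ?P" "leP q t" using xyz y by (auto simp: M_def)
          then show ?thesis using P(3)[OF p q(1) _ q(2)] x z by simp
        next
          case z: (Mid r)
          then have r: "r \<in> R" "q \<in> Q" "leR (f q) r" using xyz y by (auto simp: M_def)
          have "p \<in> Q" using into_Q[OF p r(2) q(2)] .
          then show ?thesis using R(3)[OF _ _ r(1) fmono r(3)] fR r(2) q(2) x z by simp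
        next
          case z: (Pole i b)
          then consider "0 < i" | "q \<in> Q" | "q = a b" using xyz y by auto
          then show ?thesis
          proof cases
            case 2
            then show ?thesis using into_Q[OF p _ q(2)] x z by simp
          next
            case 3
            have "p = a b" if "p = a c" for c
              using a(3)[of "a b" c] q(2) 3 that by simp
            then have "p \<in> Q \<or> p = a b" using p by blast
            then show ?thesis using x z by auto
          qed (use x z in simp)
        qed
      next
        case y: (Mid r)
        then have "r \<in> R" "p \<in> Q" "leR (f p) r" using xyz x by (auto simp: M_def)
        note r = this
        show ?thesis
        proof (cases z)
          case z: (Mid u)
          then have "u \<in> R" using xyz by (auto simp: M_def)
          then show ?thesis using R(3)[of "f p" r u] fR r x y z xyz(5) by simp
        qed (use xyz x y r in auto)
      next
        case (Pole i b)
        then show ?thesis using xyz x by (cases z) auto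
      qed
    next
      case x: (Mid r)
      show ?thesis
      proof (cases z)
        case (Low p)
        then show ?thesis using xyz x by (cases y) auto
      next
        case z: (Mid u)
        then obtain t where y: "y = Mid t" using xyz x by (cases y) auto
        then have "r \<in> R" "t \<in> R" "u \<in> R" using x z xyz by (auto simp: M_def)
        then show ?thesis using R(3)[of r t u] x y z xyz by simp
      qed (use x in simp)
    next
      case (Pole i b)
      then show ?thesis using xyz by (cases y; cases z) auto
    qed
  qed
  let ?A = "range (Pole 0) :: ('a, 'b) cylinder_node set"
  have 1: "order_polyhedron M ?le homotopy_eqv order_polyhedron (M - ?A) ?le"
  proof (rule remove_down_set[OF finM poM])
    show "?A \<subseteq> M" by (auto simp: M_def)
    fix r :: "('a, 'b) cylinder_node" assume "r \<in> ?A"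
    then obtain b where r: "r = Pole 0 b" by blast
    define L where "L = {y \<in> M - ?A. ?le y r}"
    have L_iff: "y \<in> L \<longleftrightarrow> (\<exists>q\<in>Q. y = Low q) \<or> y = Low (a b) \<or> (\<exists>r\<in>R. y = Mid r)" for y
      by (cases y) (auto simp: L_def r M_def)
    have poL: "porder_on L ?le" by (rule porder_on_subset[OF poM]) (auto simp: L_def)
    \<comment> \<open>The fence from the identity to the constant \<open>a b\<close>: up to
      \<open>f q\<close>, down to the section, up to \<open>a b\<close>. Elements of the section
      \<open>s b\<close> must stay put in the first step, since they lie below \<open>a b\<close>
      and \<open>Mid (f q)\<close> does not.\<close>
    define g1 where "g1 y = (case y of Low q \<Rightarrow> if q \<in> Q - s b ` R then Mid (f q) else Low q | _ \<Rightarrow> y)"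
      for y :: "('a, 'b) cylinder_node"
    define g2 where "g2 y = (case y of Low q \<Rightarrow> if q \<in> Q then Low (s b (f q)) else Low q
        | Mid r \<Rightarrow> Low (s b r) | _ \<Rightarrow> y)" for y :: "('a, 'b) cylinder_node"
    have leQ: "leP q q" if "q \<in> Q" for q using P(1) that by blast
    have LI: "q \<in> Q \<Longrightarrow> Low q \<in> L" "t \<in> R \<Longrightarrow> Mid t \<in> L" "Low (a b) \<in> L" for q t
      by (auto simp: L_iff)
    have LE: "q \<in> Q \<or> q = a b" if "Low q \<in> L" for q
      using that by (auto simp: L_iff)
    have g1L: "g1 \<in> L \<rightarrow> L"
    proof (rule funcsetI)
      fix y assume "y \<in> L"
      then show "g1 y \<in> L" using LE LI(2)[OF fR] by (cases y) (simp_all add: g1_def)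
    qed
    have g2L: "g2 \<in> L \<rightarrow> L"
    proof (rule funcsetI)
      fix y assume y: "y \<in> L"
      then have "t \<in> R" if "y = Mid t" for t using that by (simp add: L_iff)
      then show "g2 y \<in> L"
        using y LI(1)[OF sQ[OF fR]] LI(1)[OF sQ] by (cases y) (simp_all add: g2_def)
    qed
    \<comment> \<open>By \<open>below\<close> the section consists of the elements of
      \<open>Q\<close> under \<open>a b\<close>, so it is a down-set; this makes \<open>g1\<close>
      monotone.\<close>
    have sec: "q \<in> s b ` R" if "p \<in> s b ` R" "q \<in> Q" "leP q p" for p q
    proof -
      have "leP p (a b)" "p \<in> Q" using that(1) below[of p b] sQ by blast+
      then show ?thesis using below[OF that(2)] P(3)[of q p "a b"] that by blast
    qed
    have m1: "monotone_on L ?le ?le g1"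
    proof (rule monotone_onI)
      fix x y assume xy: "x \<in> L" "y \<in> L" "?le x y"
      show "?le (g1 x) (g1 y)"
      proof (cases y)
        case y: (Low q)
        then obtain p where x: "x = Low p" "leP p q" using xy(3) by (cases x) auto
        have p: "p \<in> Q \<or> p = a b" and q: "q \<in> Q \<or> q = a b" using xy(1,2) x y by (auto simp: L_iff)
        show ?thesis
        proof (cases "q \<in> Q")
          case True
          then have "p \<in> Q" using into_Q[of p q] p x(2) by blast
          then show ?thesis
            using True x y sec[of q p] fmono[of p q] by (auto simp: g1_def)
        next
          case False
          then have "p \<in> s b ` R \<or> p = a b" using below[of p b] p q x(2) by blast
          then show ?thesis using False x y a(1) q by (auto simp: g1_def)
        qed
      next
        case (Mid r)
        then show ?thesis using xy a(1) R(1) by (cases x) (auto simp: g1_def L_iff)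
      qed (use xy in \<open>auto simp: L_iff\<close>)
    qed
    have m2: "monotone_on L ?le ?le g2"
    proof (rule monotone_onI)
      fix x y assume xy: "x \<in> L" "y \<in> L" "?le x y"
      show "?le (g2 x) (g2 y)"
      proof (cases y)
        case y: (Low q)
        then obtain p where x: "x = Low p" "leP p q" using xy(3) by (cases x) auto
        have p: "p \<in> Q \<or> p = a b" and q: "q \<in> Q \<or> q = a b" using xy(1,2) x y by (auto simp: L_iff)
        show ?thesis
        proof (cases "q \<in> Q")
          case True
          then have "p \<in> Q" using into_Q[of p q] p x(2) by blast
          then show ?thesis
            using True x y smono[OF fR fR fmono, of p q b] by (simp add: g2_def)
        next
          case False
          then have q: "q = a b" using q by blast
          have "leP (s b (f p)) (a b)" if "p \<in> Q" using below[OF sQ[OF fR[OF that]]] fR[OF that] by blast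
          then show ?thesis using x y a(1) q by (simp add: g2_def)
        qed
      next
        case y: (Mid r)
        then have r: "r \<in> R" using xy(2) by (auto simp: L_iff)
        show ?thesis
        proof (cases x)
          case (Low p)
          then have "p \<in> Q" "leR (f p) r" using xy(3) y by auto
          then show ?thesis using smono[OF fR r, of p b] Low y by (simp add: g2_def)
        next
          case (Mid t)
          then show ?thesis using xy y r smono[of t r b] by (auto simp: g2_def L_iff)
        qed (use xy in \<open>auto simp: L_iff\<close>)
      qed (use xy in \<open>auto simp: L_iff\<close>)
    qed
    have "fence L ?le g1"
    proof (rule fence_step[OF fence_id g1L m1], rule disjI1, rule ballI)
      fix x assume "x \<in> L"
      moreover from this have "?le x x" using porder_onD(1)[OF poL] by blast
      ultimately show "?le x (g1 x)" using R(1)[OF fR] by (cases x) (auto simp: g1_def)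
    qed
    then have "fence L ?le g2"
    proof (rule fence_step[OF _ g2L m2], intro disjI2 ballI)
      fix x assume "x \<in> L"
      then have x: "(\<exists>q\<in>Q. x = Low q) \<or> x = Low (a b) \<or> (\<exists>r\<in>R. x = Mid r)" by (simp add: L_iff)
      have "leP (s b (f q)) q" if "q \<in> s b ` R" for q
        using that s(3) sQ leQ by auto
      then show "?le (g2 x) (g1 x)"
        using x R(1)[OF fR] R(1) fR P(1)[of "a b"] sQ s(3) a(1) by (auto simp: g1_def g2_def)
    qed
    then have "fence L ?le (\<lambda>_. Low (a b))"
    proof (rule fence_step, goal_cases)
      case 1 show ?case by (auto simp: L_iff)
    next
      case 2 show ?case using P(1)[of "a b"] by (auto simp: monotone_on_def)
    next
      case 3
      have "leP (s b r) (a b)" if "r \<in> R" for r using below[OF sQ[OF that]] that by blast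
      then show ?case using fR P(1)[of "a b"] a(1) by (auto simp: L_iff g2_def)
    qed
    moreover have "Low (a b) \<in> L" by (simp add: L_iff)
    ultimately show "fence_contractible {y \<in> M - ?A. ?le y r} ?le"
      unfolding fence_contractible_def L_def by blast
  qed
  have po1: "porder_on (M - ?A) ?le" by (rule porder_on_subset[OF poM]) auto
  have 2: "order_polyhedron (M - ?A) ?le homotopy_eqv order_polyhedron (M - ?A - Mid ` R) ?le"
  proof (rule remove_down_set[OF _ po1])
    show "finite (M - ?A)" using finM by simp
    show "Mid ` R \<subseteq> M - ?A" by (auto simp: M_def)
    fix x :: "('a, 'b) cylinder_node" assume "x \<in> Mid ` R"
    then obtain r where r: "r \<in> R" "x = Mid r" by blast
    \<comment> \<open>Once the level-0 poles and the row \<open>Mid\<close> are set aside, what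
      remains below \<open>Mid r\<close> is the fibre over \<open>r\<close>.\<close>
    have eq: "{y \<in> M - ?A - Mid ` R. ?le y x} = Low ` {q \<in> Q. leR (f q) r}"
      using r(2) by (auto simp: M_def)
    show "fence_contractible {y \<in> M - ?A - Mid ` R. ?le y x} ?le"
      unfolding eq
      by (rule fence_contractible_image[OF fibre[OF r(1)]])
        (auto intro!: porder_on_subset[OF poP] simp: inj_on_def)
  qed
  let ?B = "(Low \<circ> a) ` UNIV :: ('a, 'b) cylinder_node set"
  \<comment> \<open>As \<open>a b\<close> is maximal in the source and lies outside
    \<open>Q\<close>, only poles are above it, and \<open>Pole 0 b\<close> is the least of
    them.\<close>
  have 3: "order_polyhedron M ?le homotopy_eqv order_polyhedron (M - ?B) ?le"
  proof (rule remove_up_set[where m = "\<lambda>x. if x = Low (a True) then Pole 0 True else Pole 0 False", OF finM poM])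
    show "?B \<subseteq> M" by (auto simp: M_def)
    fix x :: "('a, 'b) cylinder_node" assume "x \<in> ?B"
    then obtain b where x: "x = Low (a b)" by auto
    let ?m = "if x = Low (a True) then Pole 0 True else Pole 0 False :: ('a, 'b) cylinder_node"
    have m: "?m = Pole 0 b" using a(2) x by (cases b) auto
    have inj: "a b = a c \<longleftrightarrow> b = c" for c using a(2) by (cases b; cases c) auto
    have "?le (Pole 0 b) y" if y: "y \<in> M - ?B" "?le x y" for y
    proof (cases y)
      case (Low p)
      then have "p \<in> ?P" "leP (a b) p" using y x by (auto simp: M_def)
      then have "p = a b" using a(3) by blast
      then show ?thesis using y Low by auto
    qed (use y x a(1) inj in \<open>auto simp: M_def\<close>)
    then show "?m \<in> M - ?B \<and> ?le x ?m \<and> (\<forall>y\<in>M - ?B. ?le x y \<longrightarrow> ?le ?m y)"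
      unfolding m using x by (auto simp: M_def)
  qed
  have po3: "porder_on (M - ?B) ?le" by (rule porder_on_subset[OF poM]) auto
  \<comment> \<open>The collapse of a mapping cylinder onto its target: \<open>Mid (f q)\<close> is
    the least remaining element above \<open>Low q\<close>.\<close>
  have 4: "order_polyhedron (M - ?B) ?le homotopy_eqv order_polyhedron (M - ?B - Low ` Q) ?le"
  proof (rule remove_up_set[where m = "\<lambda>x. case x of Low q \<Rightarrow> Mid (f q)", OF _ po3])
    show "finite (M - ?B)" using finM by simp
    show "Low ` Q \<subseteq> M - ?B" using a(1) by (auto simp: M_def)
    fix x :: "('a, 'b) cylinder_node" assume "x \<in> Low ` Q"
    then obtain q where q: "q \<in> Q" "x = Low q" by blast
    have "?le (Mid (f q)) y" if y: "y \<in> M - ?B - Low ` Q" "?le x y" for y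
      using y q by (cases y) (auto simp: M_def)
    moreover have "?le x (Mid (f q))" using q R(1)[OF fR] by simp
    ultimately show "(case x of Low q \<Rightarrow> Mid (f q)) \<in> M - ?B - Low ` Q \<and> ?le x (case x of Low q \<Rightarrow> Mid (f q)) \<and>
        (\<forall>y\<in>M - ?B - Low ` Q. ?le x y \<longrightarrow> ?le (case x of Low q \<Rightarrow> Mid (f q)) y)"
      using q fR by (auto simp: M_def)
  qed
  let ?g = "\<lambda>x. case x of Base p \<Rightarrow> Low p | Apex i b \<Rightarrow> Pole (Suc i) b"
  have 5: "order_polyhedron (suspension k ?P) (suspension_le leP) homotopy_eqv
      order_polyhedron (M - ?A - Mid ` R) ?le"
  proof (rule suspension_iso)
    show "finite ?P" using finQ by simp
    show "bij_betw ?g (suspension k ?P) (M - ?A - Mid ` R)"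
    proof (rule bij_betwI[where g = "\<lambda>x. case x of Low p \<Rightarrow> Base p | Pole i b \<Rightarrow> Apex (i - 1) b"])
      show "?g \<in> suspension k ?P \<rightarrow> M - ?A - Mid ` R" by (auto simp: suspension_def M_def)
      show "(\<lambda>x. case x of Low p \<Rightarrow> Base p | Pole i b \<Rightarrow> Apex (i - 1) b)
          \<in> M - ?A - Mid ` R \<rightarrow> suspension k ?P"
        by (force simp: suspension_def M_def)
      show "(case ?g x of Low p \<Rightarrow> Base p | Pole i b \<Rightarrow> Apex (i - 1) b) = x"
        if "x \<in> suspension k ?P" for x by (cases x) auto
      show "?g (case y of Low p \<Rightarrow> Base p | Pole i b \<Rightarrow> Apex (i - 1) b) = y"
        if y: "y \<in> M - ?A - Mid ` R" for y
        using y by (cases y) (force simp: M_def)+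
    qed
    show "?le (?g u) (?g v) \<longleftrightarrow> suspension_le leP u v" for u v
      by (cases u; cases v) auto
  qed
  let ?h = "\<lambda>x. case x of Base p \<Rightarrow> Mid p | Apex i b \<Rightarrow> Pole i b"
  have 6: "order_polyhedron (suspension (Suc k) R) (suspension_le leR) homotopy_eqv
      order_polyhedron (M - ?B - Low ` Q) ?le"
  proof (rule suspension_iso[OF finR])
    show "bij_betw ?h (suspension (Suc k) R) (M - ?B - Low ` Q)"
    proof (rule bij_betwI[where g = "\<lambda>x. case x of Mid p \<Rightarrow> Base p | Pole i b \<Rightarrow> Apex i b"])
      show "?h \<in> suspension (Suc k) R \<rightarrow> M - ?B - Low ` Q" by (auto simp: suspension_def M_def)
      show "(\<lambda>x. case x of Mid p \<Rightarrow> Base p | Pole i b \<Rightarrow> Apex i b)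
          \<in> M - ?B - Low ` Q \<rightarrow> suspension (Suc k) R"
        by (auto simp: suspension_def M_def)
      show "(case ?h x of Mid p \<Rightarrow> Base p | Pole i b \<Rightarrow> Apex i b) = x"
        if "x \<in> suspension (Suc k) R" for x by (cases x) auto
      show "?h (case y of Mid p \<Rightarrow> Base p | Pole i b \<Rightarrow> Apex i b) = y"
        if y: "y \<in> M - ?B - Low ` Q" for y
        using y by (cases y) (auto simp: M_def)
    qed
    show "?le (?h u) (?h v) \<longleftrightarrow> suspension_le leR u v" for u v
      by (cases u; cases v) auto
  qed
  show ?thesis
    using homotopy_eqv_trans[OF homotopy_eqv_trans[OF 5 iffD1[OF homotopy_equivalent_space_sym homotopy_eqv_trans[OF 1 2]]]
        homotopy_eqv_trans[OF homotopy_eqv_trans[OF 3 4] iffD1[OF homotopy_equivalent_space_sym 6]]] .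
qed

text \<open>The iterated suspension of the empty poset is the boundary of the cross-polytope.\<close>
lemma suspension_empty_homotopy_eqv_sphere:
  fixes le :: "'a \<Rightarrow> 'a \<Rightarrow> bool"
  shows "top_of_set (order_polyhedron (suspension k {}) (suspension_le le))
           homotopy_equivalent_space sphere_space (int k - 1)"
proof (cases k)
  case 0
  then have "order_polyhedron (suspension k {}) (suspension_le le) = {}"
    by (auto simp: order_polyhedron_def suspension_def)
  then show ?thesis
    using 0 by (simp add: sphere_space_def homeomorphic_imp_homotopy_equivalent_space
        homeomorphic_space_def homeomorphic_maps_def)
next
  case (Suc n)
  let ?X = "suspension k {} :: 'a suspension_node set"
  let ?P = "order_polyhedron ?X (suspension_le le)"
  define Sph where "Sph = {z :: nat \<Rightarrow> real. (\<Sum>i<k. (z i)\<^sup>2) = 1 \<and> (\<forall>i\<ge>k. z i = 0)}"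
  \<comment> \<open>At most one of two opposite poles carries weight, so their signed difference
    determines both. In these coordinates the polyhedron is the unit sphere of the sum norm
    \<open>A\<close>; \<open>F\<close> and \<open>G\<close> rescale between it and the Euclidean
    unit sphere.\<close>
  define D where "D x i = x (Apex i True) - x (Apex i False)" for x :: "'a suspension_node \<Rightarrow> real" and i
  define N where "N x = sqrt (\<Sum>i<k. (D x i)\<^sup>2)" for x
  define F where "F x = (\<lambda>i. if i < k then D x i / N x else 0)" for x
  define A where "A z = (\<Sum>i<k. \<bar>z i\<bar>)" for z :: "nat \<Rightarrow> real"
  define G where "G z = (\<lambda>v :: 'a suspension_node. case v of Base _ \<Rightarrow> 0
      | Apex i b \<Rightarrow> if i < k then max 0 (if b then z i else - z i) / A z else 0)" for z
  have sumX: "sum h ?X = (\<Sum>i<k. h (Apex i True) + h (Apex i False))"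
    for h :: "'a suspension_node \<Rightarrow> real"
  proof -
    have "?X = (\<lambda>i. Apex i True) ` {..<k} \<union> (\<lambda>i. Apex i False) ` {..<k}"
      by (auto simp: suspension_def)
    moreover have "sum h ((\<lambda>i. Apex i True) ` {..<k} \<union> (\<lambda>i. Apex i False) ` {..<k})
        = sum h ((\<lambda>i. Apex i True) ` {..<k}) + sum h ((\<lambda>i. Apex i False) ` {..<k})"
      by (rule sum.union_disjoint) auto
    ultimately show ?thesis
      by (simp add: sum.distrib sum.reindex inj_on_def)
  qed
  have one_sided: "x (Apex i True) = 0 \<or> x (Apex i False) = 0" if "x \<in> ?P" for x i
    using order_polyhedronD(3)[OF that, of "Apex i True" "Apex i False"] by auto
  have absD: "\<bar>D x i\<bar> = x (Apex i True) + x (Apex i False)" if "x \<in> ?P" for x i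
    using one_sided[OF that, of i] order_polyhedronD(1)[OF that] by (auto simp: D_def)
  have sumD: "A (D x) = 1" if "x \<in> ?P" for x
    using order_polyhedronD(4)[OF that] absD[OF that] by (simp add: A_def sumX)
  have Npos: "0 < N x" if "x \<in> ?P" for x
  proof -
    have "\<exists>i<k. D x i \<noteq> 0"
    proof (rule ccontr)
      assume "\<not> ?thesis"
      then have "A (D x) = 0" by (simp add: A_def)
      then show False using sumD[OF that] by simp
    qed
    then have "0 < (\<Sum>i<k. (D x i)\<^sup>2)" by (auto intro!: sum_pos2)
    then show ?thesis by (simp add: N_def)
  qed
  have Apos: "0 < A z" if "z \<in> Sph" for z
  proof -
    have "\<exists>i<k. z i \<noteq> 0"
    proof (rule ccontr)
      assume "\<not> ?thesis"
      then have "(\<Sum>i<k. (z i)\<^sup>2) = 0" by simp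
      then show False using that by (simp add: Sph_def)
    qed
    then show ?thesis unfolding A_def by (auto intro!: sum_pos2)
  qed
  have FS: "F x \<in> Sph" if "x \<in> ?P" for x
  proof -
    have "(\<Sum>i<k. (F x i)\<^sup>2) = (\<Sum>i<k. (D x i)\<^sup>2) / (N x)\<^sup>2"
      unfolding sum_divide_distrib by (rule sum.cong) (auto simp: F_def power_divide)
    also have "(N x)\<^sup>2 = (\<Sum>i<k. (D x i)\<^sup>2)" by (simp add: N_def sum_nonneg)
    finally show ?thesis using Npos[OF that] by (auto simp: Sph_def F_def N_def)
  qed
  have GP: "G z \<in> ?P" if z: "z \<in> Sph" for z
  proof -
    have "G z (Apex i True) + G z (Apex i False) = \<bar>z i\<bar> / A z" if "i < k" for i
      using that by (auto simp: G_def max_def)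
    then have "sum (G z) ?X = (\<Sum>i<k. \<bar>z i\<bar> / A z)" unfolding sumX by (intro sum.cong) auto
    also have "\<dots> = 1" using Apos[OF z] by (simp add: A_def flip: sum_divide_distrib)
    finally have "sum (G z) ?X = 1" .
    moreover have "suspension_le le u v \<or> suspension_le le v u" if "G z u \<noteq> 0" "G z v \<noteq> 0" for u v
      using that by (cases u; cases v) (auto simp: G_def max_def not_less_iff_gr_or_eq split: if_splits)
    moreover have "0 \<le> G z v" for v
      using Apos[OF z] by (auto simp: G_def split: suspension_node.split)
    moreover have "G z v = 0" if "v \<notin> ?X" for v
      using that by (auto simp: G_def suspension_def split: suspension_node.split)
    ultimately show ?thesis by (auto simp: order_polyhedron_def)
  qed
  have "homeomorphism ?P Sph F G"
  proof (rule homeomorphismI)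
    have contD: "continuous_on ?P (\<lambda>x. D x i)" for i
      unfolding D_def by (intro continuous_intros continuous_on_product_then_coordinatewise continuous_on_id)
    show "continuous_on ?P F"
    proof (rule continuous_on_coordinatewise_then_product)
      fix i
      show "continuous_on ?P (\<lambda>x. F x i)"
      proof (cases "i < k")
        case True
        have "continuous_on ?P (\<lambda>x. D x i / N x)"
          using Npos unfolding N_def by (intro continuous_intros contD) force
        then show ?thesis using True by (simp add: F_def)
      qed (simp add: F_def)
    qed
    show "continuous_on Sph G"
    proof (rule continuous_on_coordinatewise_then_product)
      fix v :: "'a suspension_node"
      have c: "continuous_on Sph (\<lambda>z. z i)" for i
        by (rule continuous_on_product_then_coordinatewise[OF continuous_on_id])
      show "continuous_on Sph (\<lambda>z. G z v)"
      proof (cases "\<exists>i b. v = Apex i b \<and> i < k")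
        case True
        then obtain i b where v: "v = Apex i b" "i < k" by blast
        have "continuous_on Sph (\<lambda>z. max 0 (if b then z i else - z i) / A z)"
          unfolding A_def
          using Apos by (cases b) (auto intro!: continuous_intros c simp: A_def less_imp_neq[THEN not_sym])
        then show ?thesis using v by (simp add: G_def)
      next
        case False
        then have "G z v = 0" for z by (cases v) (auto simp: G_def)
        then show ?thesis by simp
      qed
    qed
    show "F ` ?P \<subseteq> Sph" "G ` Sph \<subseteq> ?P" using FS GP by auto
    show "G (F x) = x" if x: "x \<in> ?P" for x
    proof
      fix v
      show "G (F x) v = x v"
      proof (cases "\<exists>i b. v = Apex i b \<and> i < k")
        case True
        then obtain i b where v: "v = Apex i b" "i < k" by blast
        have "A (F x) = (\<Sum>i<k. \<bar>D x i\<bar> / N x)"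
          unfolding A_def by (rule sum.cong) (use Npos[OF x] in \<open>auto simp: F_def\<close>)
        also have "\<dots> = 1 / N x" using sumD[OF x] by (simp add: A_def flip: sum_divide_distrib)
        finally have "G (F x) v = max 0 (if b then D x i / N x else - (D x i / N x)) * N x"
          using v by (simp add: G_def F_def)
        also have "\<dots> = max 0 (if b then D x i else - D x i)"
          using Npos[OF x] by (auto simp: max_def field_simps zero_le_divide_iff)
        also have "\<dots> = x v"
          using one_sided[OF x, of i] order_polyhedronD(1)[OF x] v by (auto simp: D_def max_def antisym)
        finally show ?thesis .
      next
        case False
        then have "v \<notin> ?X" by (auto simp: suspension_def)
        then show ?thesis using False order_polyhedronD(2)[OF x]
          by (auto simp: G_def split: suspension_node.split)
      qed
    qed
    show "F (G z) = z" if z: "z \<in> Sph" for z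
    proof
      fix i
      have D: "D (G z) i = z i / A z" if "i < k" for i
        using that by (auto simp: D_def G_def max_def)
      have "(\<Sum>i<k. (D (G z) i)\<^sup>2) = (\<Sum>i<k. (z i)\<^sup>2) / (A z)\<^sup>2"
        unfolding sum_divide_distrib by (rule sum.cong) (auto simp: D power_divide)
      then have "N (G z) = 1 / A z"
        using z Apos[OF z] by (simp add: N_def Sph_def real_sqrt_divide)
      then show "F (G z) i = z i" using D[of i] z Apos[OF z] by (auto simp: F_def Sph_def)
    qed
  qed
  then have "?P homotopy_eqv Sph"
    by (intro homeomorphic_imp_homotopy_eqv) (auto simp: homeomorphic_def)
  moreover have "nsphere n = top_of_set Sph"
    unfolding nsphere Sph_def euclidean_product_topology Suc
    by (simp add: lessThan_Suc_atMost Suc_le_eq)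
  ultimately show ?thesis using Suc by (simp add: sphere_space_def)
qed

section \<open>Facets of cyclic polytopes\<close>

text \<open>Gale's evenness criterion. Lower and upper refer to the last coordinate direction: the sign of
  \<open>\<Prod>u\<in>F. v - u\<close> tells on which side of the hyperplane through \<open>F\<close> the vertex \<open>v\<close> lies.\<close>
definition lower_facets :: "nat \<Rightarrow> nat set \<Rightarrow> nat set set" where
  "lower_facets d V = {F. F \<subseteq> V \<and> card F = d \<and> (\<forall>v\<in>V - F. even (card {u \<in> F. v < u}))}"

definition upper_facets :: "nat \<Rightarrow> nat set \<Rightarrow> nat set set" where
  "upper_facets d V = {F. F \<subseteq> V \<and> card F = d \<and> (\<forall>v\<in>V - F. odd (card {u \<in> F. v < u}))}"

definition bdry :: "nat \<Rightarrow> nat set \<Rightarrow> nat set \<Rightarrow> int" where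
  "bdry d V F = of_bool (F \<in> upper_facets d V) - of_bool (F \<in> lower_facets d V)"

text \<open>For \<open>card S = d\<close> this is the affine functional that vanishes on the
  hyperplane through \<open>S\<close>. Being monic, it grows by exactly \<open>s\<close> when a
  point is moved up by \<open>s\<close> (\<open>pform_shift_node_poly\<close>).\<close>

definition node_poly :: "nat set \<Rightarrow> real poly" where
  "node_poly S = (\<Prod>u\<in>S. [:- real u, 1:])"

lemma poly_node_poly: "poly (node_poly S) x = (\<Prod>u\<in>S. x - real u)"
  by (simp add: node_poly_def poly_prod)

lemma poly_node_poly_eq_0: "finite S \<Longrightarrow> poly (node_poly S) (real v) = 0 \<longleftrightarrow> v \<in> S"
  by (auto simp: poly_node_poly)

lemma node_poly_nonzero [simp]: "finite S \<Longrightarrow> node_poly S \<noteq> 0"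
  by (simp add: node_poly_def)

lemma degree_node_poly: "finite S \<Longrightarrow> degree (node_poly S) = card S"
  unfolding node_poly_def by (subst degree_prod_eq_sum_degree) auto

lemma lead_coeff_node_poly: "finite S \<Longrightarrow> coeff (node_poly S) (card S) = 1"
  using degree_node_poly[of S] lead_coeff_prod[of "\<lambda>u. [:- real u, 1:]" S]
  by (simp add: node_poly_def)

lemma poly_node_poly_sgn:
  assumes "finite S" "v \<notin> S"
  shows "0 < (-1) ^ card {u \<in> S. v < u} * poly (node_poly S) (real v)"
  using assms
proof (induction S rule: finite_induct)
  case (insert x S)
  have "{u \<in> insert x S. v < u} = (if v < x then insert x {u \<in> S. v < u} else {u \<in> S. v < u})" by auto
  then have "card {u \<in> insert x S. v < u} = card {u \<in> S. v < u} + (if v < x then 1 else 0)"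
    using insert.hyps by simp
  moreover have "poly (node_poly (insert x S)) (real v) = (real v - real x) * poly (node_poly S) (real v)"
    using insert.hyps by (simp add: poly_node_poly)
  ultimately show ?case
    using insert by (auto simp: zero_less_mult_iff mult_less_0_iff)
qed (simp add: poly_node_poly)

lemma poly_node_poly_pos_iff:
  assumes "finite S" "v \<notin> S"
  shows "0 < poly (node_poly S) (real v) \<longleftrightarrow> even (card {u \<in> S. v < u})"
  using poly_node_poly_sgn[OF assms] by (cases "even (card {u \<in> S. v < u})") auto

lemma poly_node_poly_neg_iff:
  assumes "finite S" "v \<notin> S"
  shows "poly (node_poly S) (real v) < 0 \<longleftrightarrow> odd (card {u \<in> S. v < u})"
  using poly_node_poly_sgn[OF assms] by (cases "even (card {u \<in> S. v < u})") auto

text \<open>Affine functionals on \<open>\<real>\<^sup>d\<close> are the polynomials of degree at most \<open>d\<close>, evaluated on the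
  moment curve.\<close>
definition pform :: "real poly \<Rightarrow> (real, 'd::{finite,linorder}) vec \<Rightarrow> real" where
  "pform p x = coeff p 0 + (\<Sum>j\<in>UNIV. coeff p (card {..j}) * x $ j)"

definition vertical :: "(real, 'd::{finite,linorder}) vec" where
  "vertical = axis (Max UNIV) 1"

lemma bij_betw_card_atMost:
  "bij_betw (\<lambda>j. card {..j}) (UNIV :: 'd::{finite,linorder} set) {1..CARD('d)}"
proof -
  have "inj (\<lambda>j :: 'd. card {..j})"
  proof (rule linorder_injI)
    fix i j :: 'd assume "i < j"
    then have "card {..i} < card {..j}" by (intro psubset_card_mono) auto
    then show "card {..i} \<noteq> card {..j}" by simp
  qed
  moreover have "range (\<lambda>j :: 'd. card {..j}) \<subseteq> {1..CARD('d)}"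
    by (auto simp: Suc_le_eq card_gt_0_iff intro!: card_mono)
  moreover have "range (\<lambda>j :: 'd. card {..j}) = {1..CARD('d)}"
    by (rule card_subset_eq) (use calculation in \<open>auto simp: card_image\<close>)
  ultimately show ?thesis by (simp add: bij_betw_def)
qed

lemma pform_moment_point:
  assumes "degree p \<le> CARD('d)"
  shows "pform p (moment_point v :: (real, 'd::{finite,linorder}) vec) = poly p (real v)"
proof -
  have "(\<Sum>j\<in>(UNIV :: 'd set). coeff p (card {..j}) * real v ^ card {..j})
      = (\<Sum>i\<in>{1..CARD('d)}. coeff p i * real v ^ i)"
    by (rule sum.reindex_bij_betw[OF bij_betw_card_atMost])
  moreover have "poly p (real v) = (\<Sum>i\<le>CARD('d). coeff p i * real v ^ i)"
    unfolding poly_altdef using assms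
    by (intro sum.mono_neutral_left) (auto simp: coeff_eq_0)
  moreover have "{..CARD('d)} = insert 0 {1..CARD('d)}" by auto
  ultimately show ?thesis by (simp add: pform_def moment_point_def)
qed

lemma pform_add_scaleR:
  fixes x y :: "(real, 'd::{finite,linorder}) vec"
  shows "pform p (x + s *\<^sub>R y) = pform p x + s * (pform p y - pform p (0 :: (real, 'd) vec))"
  by (simp add: pform_def algebra_simps sum.distrib sum_distrib_left)

lemma pform_affine_sum:
  assumes "finite A" "sum w A = 1"
  shows "pform p (\<Sum>i\<in>A. w i *\<^sub>R y i) = (\<Sum>i\<in>A. w i * pform p (y i))"
proof -
  have "(\<Sum>i\<in>A. w i * pform p (y i)) = coeff p 0 * sum w A
      + (\<Sum>i\<in>A. \<Sum>j\<in>UNIV. coeff p (card {..j}) * (w i * y i $ j))"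
    by (simp add: pform_def distrib_left sum.distrib sum_distrib_left sum_distrib_right algebra_simps)
  also have "(\<Sum>i\<in>A. \<Sum>j\<in>UNIV. coeff p (card {..j}) * (w i * y i $ j))
      = (\<Sum>j\<in>UNIV. coeff p (card {..j}) * (\<Sum>i\<in>A. w i * y i $ j))"
    by (subst sum.swap) (simp add: sum_distrib_left)
  finally show ?thesis using assms by (simp add: pform_def)
qed

lemma card_atMost_Max: "card {..Max (UNIV :: 'd::{finite,linorder} set)} = CARD('d)"
proof -
  have "{..Max (UNIV :: 'd set)} = UNIV" by auto
  then show ?thesis by simp
qed

lemma pform_vertical:
  "pform p (vertical :: (real, 'd::{finite,linorder}) vec) - pform p (0 :: (real, 'd) vec) = coeff p CARD('d)"
proof -
  have "(\<Sum>j\<in>UNIV. coeff p (card {..j}) * (vertical :: (real, 'd) vec) $ j)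
      = (\<Sum>j\<in>(UNIV :: 'd set). if j = Max UNIV then coeff p CARD('d) else 0)"
    by (rule sum.cong) (auto simp: vertical_def axis_def card_atMost_Max)
  then show ?thesis by (simp add: pform_def)
qed

lemma pform_shift_node_poly:
  assumes "finite S"
  shows "card S = CARD('d) \<Longrightarrow> pform (node_poly S) (x + s *\<^sub>R (vertical :: (real, 'd::{finite,linorder}) vec))
      = pform (node_poly S) x + s"
    and "card S < CARD('d) \<Longrightarrow> pform (node_poly S) (x + s *\<^sub>R (vertical :: (real, 'd::{finite,linorder}) vec))
      = pform (node_poly S) x"
  unfolding pform_add_scaleR pform_vertical
  using lead_coeff_node_poly[OF assms] degree_node_poly[OF assms]
  by (simp_all add: coeff_eq_0)

section \<open>Hulls of points on the moment curve\<close>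

lemma inj_moment_point: "inj (moment_point :: nat \<Rightarrow> (real, 'd::{finite,linorder}) vec)"
proof (rule injI)
  fix u v assume eq: "(moment_point u :: (real, 'd) vec) = moment_point v"
  have deg: "degree [:0, 1 :: real:] \<le> CARD('d)" by (simp add: Suc_le_eq)
  have "poly [:0, 1:] (real u) = poly [:0, 1:] (real v)"
    unfolding pform_moment_point[OF deg, symmetric] eq ..
  then show "u = v" by simp
qed

lemma cyclic_hull_iff:
  assumes "finite V"
  shows "x \<in> (cyclic_hull V :: ((real, 'd::{finite,linorder}) vec) set) \<longleftrightarrow>
    (\<exists>w. (\<forall>v\<in>V. 0 \<le> w v) \<and> sum w V = 1 \<and> x = (\<Sum>v\<in>V. w v *\<^sub>R moment_point v))"
    (is "_ \<longleftrightarrow> ?R")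
proof
  have inj: "inj_on (moment_point :: nat \<Rightarrow> (real, 'd) vec) V" using inj_moment_point inj_on_subset by blast
  assume "x \<in> cyclic_hull V"
  then obtain u where u: "\<forall>y\<in>moment_point ` V. 0 \<le> u y" "sum u (moment_point ` V) = 1"
    "(\<Sum>y\<in>moment_point ` V. u y *\<^sub>R y) = x"
    using convex_hull_finite[of "moment_point ` V :: ((real, 'd) vec) set"] assms
    by (auto simp: cyclic_hull_def)
  then show ?R
    by (intro exI[of _ "\<lambda>v. u (moment_point v)"]) (auto simp: sum.reindex[OF inj])
next
  assume ?R
  then show "x \<in> cyclic_hull V"
    unfolding cyclic_hull_def using assms hull_inc[of _ "moment_point ` V" convex]
    by (auto intro!: convex_sum[OF _ convex_convex_hull])
qed

lemma cyclic_hull_mono: "V \<subseteq> W \<Longrightarrow> cyclic_hull V \<subseteq> cyclic_hull W"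
  unfolding cyclic_hull_def by (intro hull_mono image_mono)

lemma compact_cyclic_hull: "finite V \<Longrightarrow> compact (cyclic_hull V :: ((real, 'd::{finite,linorder}) vec) set)"
  unfolding cyclic_hull_def by (intro compact_convex_hull finite_imp_compact finite_imageI)

lemma convex_cyclic_hull: "convex (cyclic_hull V)"
  unfolding cyclic_hull_def by simp

lemma pform_weights:
  assumes "finite V" "sum w V = 1" "degree p \<le> CARD('d)"
  shows "pform p (\<Sum>v\<in>V. w v *\<^sub>R (moment_point v :: (real, 'd::{finite,linorder}) vec)) = (\<Sum>v\<in>V. w v * poly p (real v))"
  unfolding pform_affine_sum[OF assms(1,2)] pform_moment_point[OF assms(3)] ..

lemma pform_cyclic_hull_eq_0:
  assumes "finite V" "card V \<le> CARD('d)" "x \<in> (cyclic_hull V :: ((real, 'd::{finite,linorder}) vec) set)"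
  shows "pform (node_poly V) x = 0"
proof -
  obtain w where w: "sum w V = 1" "x = (\<Sum>v\<in>V. w v *\<^sub>R moment_point v)"
    using iffD1[OF cyclic_hull_iff[OF assms(1)] assms(3)] by blast
  have deg: "degree (node_poly V) \<le> CARD('d)" using assms(1,2) by (simp add: degree_node_poly)
  have "(\<Sum>v\<in>V. w v * poly (node_poly V) (real v)) = 0"
    by (rule sum.neutral) (simp add: poly_node_poly_eq_0 assms(1))
  then show ?thesis unfolding w(2) pform_weights[OF assms(1) w(1) deg] .
qed

text \<open>The polynomial with roots \<open>T - {t}\<close> isolates the coefficient of
  \<open>t\<close>; the bound on \<open>card T\<close> keeps its degree at most
  \<open>d\<close>.\<close>

lemma moment_relation_trivial:
  assumes T: "finite T" "card T \<le> Suc CARD('d)"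
    and "sum c T = 0" "(\<Sum>v\<in>T. c v *\<^sub>R (moment_point v :: (real, 'd::{finite,linorder}) vec)) = 0" and t: "t \<in> T"
  shows "c t = 0"
proof -
  let ?p = "node_poly (T - {t})"
  have deg: "degree ?p \<le> CARD('d)" using T t by (simp add: degree_node_poly)
  \<comment> \<open>\<open>pform\<close> respects affine combinations only, so a unit weight at
    \<open>t\<close> is added to bring the total weight to one.\<close>
  define w where "w v = c v + (if v = t then 1 else 0)" for v
  have "sum w T = 1" using T t assms(3) by (simp add: w_def sum.distrib)
  moreover have "(\<Sum>v\<in>T. w v *\<^sub>R (moment_point v :: (real, 'd) vec)) = moment_point t"
    using T t assms(4)
    by (simp add: w_def scaleR_add_left sum.distrib if_distrib[of "\<lambda>a. a *\<^sub>R _"] sum.delta cong: if_cong)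
  ultimately have "poly ?p (real t) = (\<Sum>v\<in>T. w v * poly ?p (real v))"
    using pform_weights[OF T(1) _ deg, of w] pform_moment_point[OF deg, of t] by simp
  also have "\<dots> = w t * poly ?p (real t)"
  proof -
    have "(\<Sum>v\<in>T - {t}. w v * poly ?p (real v)) = 0"
      by (rule sum.neutral) (simp add: poly_node_poly_eq_0 T(1))
    then show ?thesis unfolding sum.remove[OF T(1) t] by simp
  qed
  finally have "c t * poly ?p (real t) = 0" by (simp add: w_def algebra_simps)
  then show ?thesis using T(1) by (simp add: poly_node_poly_eq_0)
qed

lemma affine_independent_moment_points:
  assumes T: "finite T" "card T \<le> Suc CARD('d)"
  shows "\<not> affine_dependent (moment_point ` T :: ((real, 'd::{finite,linorder}) vec) set)"
proof
  assume "affine_dependent (moment_point ` T :: ((real, 'd) vec) set)"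
  then obtain U where U: "sum U (moment_point ` T :: ((real, 'd) vec) set) = 0"
    "\<exists>v\<in>(moment_point ` T :: ((real, 'd) vec) set). U v \<noteq> 0"
    "(\<Sum>v\<in>(moment_point ` T :: ((real, 'd) vec) set). U v *\<^sub>R v) = 0"
    using affine_dependent_explicit_finite[of "moment_point ` T :: ((real, 'd) vec) set"] T by auto
  have inj: "inj_on (moment_point :: nat \<Rightarrow> (real, 'd) vec) T" using inj_moment_point inj_on_subset by blast
  have "U (moment_point t) = 0" if "t \<in> T" for t
    by (rule moment_relation_trivial[OF T U(1,3)[unfolded sum.reindex[OF inj] o_def] that])
  then show False using U(2) by auto
qed

text \<open>Barycentric coordinates of the point \<open>vertical\<close> minus those of the origin;
  the \<open>d + 1\<close> points span the space affinely.\<close>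

lemma vertical_direction:
  assumes T: "finite T" "card T = Suc CARD('d)"
  obtains c where "sum c T = 0" "(\<Sum>v\<in>T. c v *\<^sub>R moment_point v) = (vertical :: (real, 'd::{finite,linorder}) vec)"
proof -
  have inj: "inj_on (moment_point :: nat \<Rightarrow> (real, 'd) vec) T" using inj_moment_point inj_on_subset by blast
  have "affine hull (moment_point ` T :: ((real, 'd) vec) set) = UNIV"
    by (rule affine_independent_span_eq[OF affine_independent_moment_points])
      (use T inj in \<open>simp_all add: card_image\<close>)
  then have *: "\<exists>u. sum u T = 1 \<and> (\<Sum>v\<in>T. u v *\<^sub>R moment_point v) = y" for y :: "(real, 'd) vec"
  proof -
    have "y \<in> affine hull (moment_point ` T :: ((real, 'd) vec) set)"
      using \<open>affine hull _ = UNIV\<close> by simp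
    then obtain u where "sum u (moment_point ` T :: ((real, 'd) vec) set) = 1"
      "(\<Sum>v\<in>(moment_point ` T :: ((real, 'd) vec) set). u v *\<^sub>R v) = y"
      using affine_hull_finite[of "moment_point ` T :: ((real, 'd) vec) set"] T by auto
    then show ?thesis
      by (intro exI[of _ "\<lambda>v. u (moment_point v)"]) (simp add: sum.reindex[OF inj])
  qed
  obtain a where a: "sum a T = 1" "(\<Sum>v\<in>T. a v *\<^sub>R moment_point v) = (0 :: (real, 'd) vec)" using * by blast
  obtain b where b: "sum b T = 1" "(\<Sum>v\<in>T. b v *\<^sub>R moment_point v) = (vertical :: (real, 'd) vec)" using * by blast
  show thesis
    by (rule that[of "\<lambda>v. b v - a v"]) (use a b in \<open>simp_all add: sum_subtractf scaleR_diff_left\<close>)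
qed

text \<open>For \<open>card S = d\<close> the point avoids the hyperplane through \<open>S\<close>.
  For smaller \<open>S\<close> the zero set of the functional is a union of vertical lines, so the
  whole vertical line through the point avoids the hull of \<open>S\<close>.\<close>

definition generic :: "nat \<Rightarrow> (real, 'd::{finite,linorder}) vec \<Rightarrow> bool" where
  "generic n x \<longleftrightarrow> (\<forall>S\<subseteq>{1..n}. card S \<le> CARD('d) \<longrightarrow> pform (node_poly S) x \<noteq> 0)"

definition hits :: "nat set \<Rightarrow> (real, 'd::{finite,linorder}) vec \<Rightarrow> bool" where
  "hits F x \<longleftrightarrow> (\<exists>s>0. x + s *\<^sub>R vertical \<in> cyclic_hull F)"

lemma genericD:
  fixes x :: "(real, 'd::{finite,linorder}) vec"
  assumes "generic n x" "S \<subseteq> {1..n}" "card S \<le> CARD('d)"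
  shows "pform (node_poly S) x \<noteq> 0"
  using assms by (auto simp: generic_def)

lemma generic_shift_card:
  fixes x :: "(real, 'd::{finite,linorder}) vec"
  assumes "generic n x" "S \<subseteq> {1..n}" "card S < CARD('d)"
  shows "x + s *\<^sub>R vertical \<notin> cyclic_hull S"
proof
  have fin: "finite S" using assms(2) finite_subset by blast
  assume "x + s *\<^sub>R vertical \<in> cyclic_hull S"
  then have "pform (node_poly S) (x + s *\<^sub>R vertical) = 0"
    by (intro pform_cyclic_hull_eq_0[OF fin]) (use assms(3) in simp_all)
  then show False
    using genericD[OF assms(1,2)] assms(3) pform_shift_node_poly(2)[OF fin assms(3)] by simp
qed

lemma cyclic_hull_caratheodory:
  assumes "finite V" "x \<in> (cyclic_hull V :: ((real, 'd::{finite,linorder}) vec) set)"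
  obtains S w where "S \<subseteq> V" "card S \<le> Suc CARD('d)" "\<And>v. v \<in> S \<Longrightarrow> 0 < w v" "sum w S = (1::real)"
    "x = (\<Sum>v\<in>S. w v *\<^sub>R moment_point v)"
proof -
  obtain A where A: "finite A" "A \<subseteq> moment_point ` V" "card A \<le> DIM((real, 'd) vec) + 1"
    "x \<in> convex hull A"
    using assms(2) unfolding cyclic_hull_def caratheodory[of "moment_point ` V"] by blast
  obtain T where T: "T \<subseteq> V" "A = moment_point ` T" using A(2) by (auto simp: subset_image_iff)
  have finT: "finite T" using T(1) assms(1) finite_subset by blast
  have "inj_on (moment_point :: nat \<Rightarrow> (real, 'd) vec) T"
    using inj_moment_point inj_on_subset by blast
  then have "card T = card A" unfolding T(2) by (simp add: card_image)
  then have cT: "card T \<le> Suc CARD('d)" using A(3) by simp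
  obtain w where w: "\<forall>v\<in>T. 0 \<le> w v" "sum w T = 1" "x = (\<Sum>v\<in>T. w v *\<^sub>R moment_point v)"
    using A(4) cyclic_hull_iff[OF finT, of x] T(2) unfolding cyclic_hull_def by blast
  let ?S = "{v \<in> T. 0 < w v}"
  have z: "w v = 0" if "v \<in> T - ?S" for v using w(1) that by force
  show thesis
  proof (rule that[of ?S w])
    show "?S \<subseteq> V" using T(1) by blast
    show "card ?S \<le> Suc CARD('d)" using card_mono[OF finT, of ?S] cT by auto
    have "sum w ?S = sum w T" by (rule sum.mono_neutral_left) (use finT z in auto)
    then show "sum w ?S = 1" using w(2) by simp
    have "(\<Sum>v\<in>?S. w v *\<^sub>R moment_point v) = (\<Sum>v\<in>T. w v *\<^sub>R (moment_point v :: (real, 'd) vec))"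
      by (rule sum.mono_neutral_left) (use finT z in auto)
    then show "x = (\<Sum>v\<in>?S. w v *\<^sub>R moment_point v)" using w(3) by simp
  qed simp
qed

text \<open>A point in the relative interior of a \<open>(d-1)\<close>-simplex can be moved up into the hull of the
  simplex and any point above its hyperplane.\<close>
lemma push_vertically:
  fixes \<sigma> :: real
  assumes F: "finite F" "card F = CARD('d)" "v \<notin> F"
    and w: "\<And>u. u \<in> F \<Longrightarrow> 0 < w u" "0 \<le> w v" "0 < w v \<or> 0 < \<sigma> * poly (node_poly F) (real v)"
      "sum w (insert v F) = 1"
  obtains \<epsilon> where "0 < \<epsilon>" "(\<Sum>u\<in>insert v F. w u *\<^sub>R moment_point u) + (\<epsilon> * \<sigma>) *\<^sub>R vertical
      \<in> (cyclic_hull (insert v F) :: ((real, 'd::{finite,linorder}) vec) set)"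
proof -
  let ?T = "insert v F"
  have T: "finite ?T" "card ?T = Suc CARD('d)" using F by auto
  obtain c where c: "sum c ?T = 0" "(\<Sum>u\<in>?T. c u *\<^sub>R moment_point u) = (vertical :: (real, 'd) vec)"
    using vertical_direction[OF T] .
  have sum1: "(\<Sum>u\<in>?T. w u + t * c u) = 1" for t
    unfolding sum.distrib sum_distrib_left[symmetric] using w(4) c(1) by simp
  have pt: "(\<Sum>u\<in>?T. (w u + t * c u) *\<^sub>R moment_point u)
      = (\<Sum>u\<in>?T. w u *\<^sub>R moment_point u) + t *\<^sub>R (vertical :: (real, 'd) vec)" for t
    unfolding c(2)[symmetric] scaleR_add_left sum.distrib scaleR_sum_right by simp
  \<comment> \<open>A unit step upwards raises the functional of \<open>F\<close> by one, and only
    \<open>v\<close> contributes to its value. This fixes the sign of \<open>c v\<close>, hence the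
    direction in which \<open>v\<close> gains weight.\<close>
  have cv: "c v * poly (node_poly F) (real v) = 1"
  proof -
    have deg: "degree (node_poly F) \<le> CARD('d)" using F by (simp add: degree_node_poly)
    have val: "pform (node_poly F) (\<Sum>u\<in>?T. (w u + t * c u) *\<^sub>R (moment_point u :: (real, 'd) vec))
        = (w v + t * c v) * poly (node_poly F) (real v)" for t
    proof -
      have "(\<Sum>u\<in>F. (w u + t * c u) * poly (node_poly F) (real u)) = 0"
        by (rule sum.neutral) (simp add: poly_node_poly_eq_0 F(1))
      then show ?thesis unfolding pform_weights[OF T(1) sum1 deg] using F by simp
    qed
    have "pform (node_poly F) (\<Sum>u\<in>?T. (w u + 1 * c u) *\<^sub>R (moment_point u :: (real, 'd) vec))
        = pform (node_poly F) (\<Sum>u\<in>?T. (w u + 0 * c u) *\<^sub>R (moment_point u :: (real, 'd) vec)) + 1"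
      unfolding pt using pform_shift_node_poly(1)[OF F(1,2), of _ 1] by simp
    then show ?thesis unfolding val by (simp add: algebra_simps)
  qed
  have ev: "\<forall>\<^sub>F \<epsilon> in at_right 0. 0 \<le> w u + \<epsilon> * \<sigma> * c u" if "u \<in> ?T" for u
  proof (cases "0 < w u")
    case True
    have "((\<lambda>\<epsilon>. w u + \<epsilon> * \<sigma> * c u) \<longlongrightarrow> w u + 0 * \<sigma> * c u) (at_right 0)"
      by (intro tendsto_intros)
    then have "\<forall>\<^sub>F \<epsilon> in at_right 0. 0 < w u + \<epsilon> * \<sigma> * c u"
      using True by (intro order_tendstoD(1)) auto
    then show ?thesis by (rule eventually_mono) simp
  next
    case False
    then have u: "u = v" "w v = 0" using w(1,2) that by auto
    let ?q = "poly (node_poly F) (real v)"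
    have "0 < \<sigma> * ?q" using w(3) u(2) by simp
    moreover have "\<sigma> * ?q = \<sigma> * ?q * (c v * ?q)" by (simp only: cv mult_1_right)
    moreover have "\<sigma> * ?q * (c v * ?q) = (\<sigma> * c v) * (?q * ?q)" by (simp only: mult_ac)
    ultimately have "0 < (\<sigma> * c v) * (?q * ?q)" by linarith
    then have "0 \<le> \<sigma> * c v"
      using zero_less_mult_iff[of "\<sigma> * c v" "?q * ?q"] zero_le_square[of ?q] by linarith
    then show ?thesis
      unfolding u eventually_at_right_field by (intro exI[of _ 1]) (auto simp: mult.assoc)
  qed
  have "\<forall>\<^sub>F \<epsilon> in at_right (0::real). 0 < \<epsilon> \<and> (\<forall>u\<in>?T. 0 \<le> w u + \<epsilon> * \<sigma> * c u)"
    by (intro eventually_conj eventually_at_right_less eventually_ball_finite[OF T(1)]) (use ev in blast)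
  then obtain \<epsilon> where \<epsilon>: "0 < \<epsilon>" "\<forall>u\<in>?T. 0 \<le> w u + \<epsilon> * \<sigma> * c u"
    using eventually_happens[OF _] trivial_limit_at_right_real by blast
  show thesis
  proof (rule that[OF \<epsilon>(1)])
    show "(\<Sum>u\<in>?T. w u *\<^sub>R moment_point u) + (\<epsilon> * \<sigma>) *\<^sub>R vertical
      \<in> (cyclic_hull ?T :: ((real, 'd::{finite,linorder}) vec) set)"
      unfolding cyclic_hull_iff[OF T(1)] pt[symmetric]
      by (intro exI[of _ "\<lambda>u. w u + \<epsilon> * \<sigma> * c u"]) (use \<epsilon>(2) sum1[of "\<epsilon> * \<sigma>"] in auto)
  qed
qed

text \<open>The sign \<open>\<sigma>\<close> lets the upper and the lower end of a vertical line be
  treated by one argument.\<close>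

definition signed_facets :: "real \<Rightarrow> nat \<Rightarrow> nat set \<Rightarrow> nat set set" where
  "signed_facets \<sigma> d V = {F. F \<subseteq> V \<and> card F = d \<and> (\<forall>v\<in>V - F. \<sigma> * poly (node_poly F) (real v) < 0)}"

lemma signed_facets:
  assumes "finite V"
  shows "signed_facets 1 d V = upper_facets d V" "signed_facets (- 1) d V = lower_facets d V"
proof -
  have "finite F" if "F \<subseteq> V" for F using that assms finite_subset by blast
  then show "signed_facets 1 d V = upper_facets d V" "signed_facets (- 1) d V = lower_facets d V"
    unfolding signed_facets_def upper_facets_def lower_facets_def
    using poly_node_poly_neg_iff poly_node_poly_pos_iff by (auto; blast)+
qed

text \<open>By genericity the Caratheodory support \<open>S\<close> of the extreme point has at
  least \<open>d\<close> elements. If it had \<open>d + 1\<close>, or if a vertex of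
  \<open>V\<close> lay on the \<open>\<sigma>\<close> side of its hyperplane,
  \<open>push_vertically\<close> would move the point further in direction
  \<open>\<sigma>\<close>.\<close>

lemma extreme_point_in_signed_facet:
  fixes x :: "(real, 'd::{finite,linorder}) vec"
  assumes V: "V \<subseteq> {1..n}" "card V \<ge> CARD('d) + 1" and x: "generic n x" and \<sigma>: "\<sigma> = 1 \<or> \<sigma> = -1"
    and y: "x + s *\<^sub>R vertical \<in> cyclic_hull V"
    and extreme: "\<And>t. x + t *\<^sub>R vertical \<in> cyclic_hull V \<Longrightarrow> \<sigma> * t \<le> \<sigma> * s"
  obtains F where "F \<in> signed_facets \<sigma> CARD('d) V" "x + s *\<^sub>R vertical \<in> cyclic_hull F"
proof -
  have finV: "finite V" using V(1) finite_subset by blast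
  obtain S w where S: "S \<subseteq> V" "card S \<le> Suc CARD('d)" "\<And>v. v \<in> S \<Longrightarrow> 0 < w v" "sum w S = (1::real)"
    "x + s *\<^sub>R vertical = (\<Sum>v\<in>S. w v *\<^sub>R moment_point v)"
    using cyclic_hull_caratheodory[OF finV y] by metis
  have finS: "finite S" using S(1) finV finite_subset by blast
  have inS: "x + s *\<^sub>R vertical \<in> cyclic_hull S"
    unfolding S(5) cyclic_hull_iff[OF finS]
    by (intro exI[of _ w]) (use S(3,4) in \<open>auto simp: less_imp_le\<close>)
  have "S \<subseteq> {1..n}" using S(1) V(1) by blast
  then have "\<not> card S < CARD('d)" using generic_shift_card[OF x] inS by blast
  have no_push: False
    if F: "finite F" "card F = CARD('d)" "v \<notin> F" "insert v F \<subseteq> V"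
      and w': "\<And>u. u \<in> F \<Longrightarrow> 0 < w' u" "0 \<le> w' v" "0 < w' v \<or> 0 < \<sigma> * poly (node_poly F) (real v)"
      "sum w' (insert v F) = 1" "x + s *\<^sub>R vertical = (\<Sum>u\<in>insert v F. w' u *\<^sub>R moment_point u)"
    for F v w'
  proof -
    obtain \<epsilon> where \<epsilon>: "0 < \<epsilon>" "(\<Sum>u\<in>insert v F. w' u *\<^sub>R moment_point u) + (\<epsilon> * \<sigma>) *\<^sub>R vertical
      \<in> (cyclic_hull (insert v F) :: ((real, 'd) vec) set)"
      using push_vertically[OF F(1-3) w'(1-4)] by metis
    then have "x + (s + \<epsilon> * \<sigma>) *\<^sub>R vertical \<in> cyclic_hull V"
      using cyclic_hull_mono[OF F(4)] unfolding w'(5)[symmetric] by (auto simp: scaleR_add_left add.assoc)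
    then have "\<sigma> * (s + \<epsilon> * \<sigma>) \<le> \<sigma> * s" by (rule extreme)
    then show False using \<epsilon>(1) \<sigma> by auto
  qed
  have "card S = CARD('d)"
  proof (rule ccontr)
    assume "card S \<noteq> CARD('d)"
    then have cS: "card S = Suc CARD('d)" using S(2) \<open>\<not> card S < CARD('d)\<close> by simp
    then obtain v where v: "v \<in> S" by fastforce
    then have eq: "insert v (S - {v}) = S" by blast
    show False
      by (rule no_push[of "S - {v}" v w]) (use finS cS v S eq in \<open>auto simp: less_imp_le\<close>)
  qed
  moreover have "\<sigma> * poly (node_poly S) (real v) < 0" if v: "v \<in> V - S" for v
  proof (rule ccontr)
    assume "\<not> ?thesis"
    moreover have "poly (node_poly S) (real v) \<noteq> 0" using v finS by (simp add: poly_node_poly_eq_0)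
    ultimately have pos: "0 < \<sigma> * poly (node_poly S) (real v)" using \<sigma> by auto
    define w' where "w' = w(v := 0)"
    have agree: "w' u = w u" if "u \<in> S" for u using v that by (auto simp: w'_def)
    show False
    proof (rule no_push[of S v w'])
      show "sum w' (insert v S) = 1" using finS v S(4) agree by (simp add: w'_def cong: sum.cong)
      show "x + s *\<^sub>R vertical = (\<Sum>u\<in>insert v S. w' u *\<^sub>R moment_point u)"
        using finS v S(5) agree by (simp add: w'_def cong: sum.cong)
    qed (use finS v S(1,3) agree pos \<open>card S = CARD('d)\<close> in \<open>auto simp: w'_def\<close>)
  qed
  ultimately have "S \<in> signed_facets \<sigma> CARD('d) V" using S(1) by (simp add: signed_facets_def)
  then show thesis using that inS by blast
qed

text \<open>All of \<open>V\<close>, hence the other facet, lies on one side of the hyperplane of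
  each facet; used both ways this equates the heights. At equal height all weight sits on common
  vertices, and by genericity these are at least \<open>d\<close>.\<close>

lemma signed_facet_unique:
  fixes x :: "(real, 'd::{finite,linorder}) vec"
  assumes V: "V \<subseteq> {1..n}" and x: "generic n x" and \<sigma>: "\<sigma> = 1 \<or> \<sigma> = -1"
    and F: "F \<in> signed_facets \<sigma> CARD('d) V" "x + s *\<^sub>R vertical \<in> cyclic_hull F"
    and F': "F' \<in> signed_facets \<sigma> CARD('d) V" "x + s' *\<^sub>R vertical \<in> cyclic_hull F'"
  shows "s = s'" "F = F'"
proof -
  have fin: "finite F" "finite F'" and c: "card F = CARD('d)" "card F' = CARD('d)"
    using V F(1) F'(1) finite_subset[OF _ finite_atLeastAtMost[of 1 n]] by (auto simp: signed_facets_def)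
  have key: "\<sigma> * (t' - t) \<le> 0 \<and> (t = t' \<longrightarrow> G' \<subseteq> G)"
    if G: "G \<in> signed_facets \<sigma> CARD('d) V" "x + t *\<^sub>R vertical \<in> cyclic_hull G"
    and G': "G' \<in> signed_facets \<sigma> CARD('d) V" "x + t' *\<^sub>R vertical \<in> cyclic_hull G'" for G G' t t'
  proof -
    have fin: "finite G" "finite G'" and c: "card G = CARD('d)" "card G' = CARD('d)"
      and sub: "G \<subseteq> V" "G' \<subseteq> V"
      using V G(1) G'(1) finite_subset[OF _ finite_atLeastAtMost[of 1 n]] by (auto simp: signed_facets_def)
    have "pform (node_poly G) (x + t *\<^sub>R vertical) = 0"
      using pform_cyclic_hull_eq_0[OF fin(1) _ G(2)] c by simp
    then have h: "pform (node_poly G) (x + t' *\<^sub>R vertical) = t' - t"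
      unfolding pform_shift_node_poly(1)[OF fin(1) c(1)] by simp
    obtain w where w: "\<forall>v\<in>G'. 0 \<le> w v" "sum w G' = 1" "x + t' *\<^sub>R vertical = (\<Sum>v\<in>G'. w v *\<^sub>R moment_point v)"
      using iffD1[OF cyclic_hull_iff[OF fin(2)] G'(2)] by blast
    have "degree (node_poly G) \<le> CARD('d)" using fin(1) c by (simp add: degree_node_poly)
    then have h2: "t' - t = (\<Sum>v\<in>G'. w v * poly (node_poly G) (real v))"
      unfolding h[symmetric] w(3) using pform_weights[OF fin(2) w(2)] by blast
    have neg: "\<sigma> * (w v * poly (node_poly G) (real v)) \<le> 0" if "v \<in> G'" for v
    proof (cases "v \<in> G")
      case True
      then have "poly (node_poly G) (real v) = 0" using fin(1) by (simp add: poly_node_poly_eq_0)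
      then show ?thesis by simp
    next
      case False
      then have "\<sigma> * poly (node_poly G) (real v) < 0"
        using G(1) sub that by (auto simp: signed_facets_def)
      moreover have "0 \<le> w v" using w(1) that by blast
      ultimately show ?thesis
        using mult_nonneg_nonpos[of "w v" "\<sigma> * poly (node_poly G) (real v)"] by (simp add: mult.left_commute)
    qed
    have e: "\<sigma> * (t' - t) = (\<Sum>v\<in>G'. \<sigma> * (w v * poly (node_poly G) (real v)))"
      unfolding h2 by (rule sum_distrib_left)
    have 1: "\<sigma> * (t' - t) \<le> 0" unfolding e using neg by (intro sum_nonpos) auto
    have "G' \<subseteq> G" if "t = t'"
    proof (rule ccontr)
      assume "\<not> G' \<subseteq> G"
      then have "G \<inter> G' \<subset> G'" by blast
      then have "card (G \<inter> G') < CARD('d)" using psubset_card_mono[OF fin(2)] c(2) by simp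
      have z: "w v = 0" if "v \<in> G' - G" for v
      proof -
        have "(\<Sum>v\<in>G'. - (\<sigma> * (w v * poly (node_poly G) (real v)))) = 0"
          using e \<open>t = t'\<close> by (simp add: sum_negf)
        then have "\<forall>v\<in>G'. - (\<sigma> * (w v * poly (node_poly G) (real v))) = 0"
          using sum_nonneg_eq_0_iff[OF fin(2), of "\<lambda>v. - (\<sigma> * (w v * poly (node_poly G) (real v)))"] neg by simp
        then show ?thesis using that \<sigma> fin(1) by (auto simp: poly_node_poly_eq_0)
      qed
      have finI: "finite (G \<inter> G')" using fin by blast
      have "x + t' *\<^sub>R vertical \<in> cyclic_hull (G \<inter> G')"
        unfolding cyclic_hull_iff[OF finI]
      proof (intro exI[of _ w] conjI)
        show "\<forall>v\<in>G \<inter> G'. 0 \<le> w v" using w(1) by blast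
        have "sum w (G \<inter> G') = sum w G'" by (rule sum.mono_neutral_left) (use fin z in auto)
        then show "sum w (G \<inter> G') = 1" using w(2) by simp
        have "(\<Sum>v\<in>G \<inter> G'. w v *\<^sub>R moment_point v) = (\<Sum>v\<in>G'. w v *\<^sub>R (moment_point v :: (real, 'd) vec))"
          by (rule sum.mono_neutral_left) (use fin z in auto)
        then show "x + t' *\<^sub>R vertical = (\<Sum>v\<in>G \<inter> G'. w v *\<^sub>R moment_point v)" using w(3) by simp
      qed
      moreover have "G \<inter> G' \<subseteq> {1..n}" using sub V by blast
      ultimately show False using generic_shift_card[OF x] \<open>card (G \<inter> G') < CARD('d)\<close> by blast
    qed
    then show ?thesis using 1 by blast
  qed
  show s: "s = s'" using key[OF F F'] key[OF F' F] \<sigma> by auto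
  show "F = F'" using key[OF F F'] key[OF F' F] s by blast
qed

lemma vertical_nonzero: "(vertical :: (real, 'd::{finite,linorder}) vec) \<noteq> 0"
  by (simp add: vertical_def axis_eq_0_iff)

text \<open>If the vertical line meets the hull, it does so in an interval from \<open>a\<close> to
  \<open>b\<close>, whose ends lie in exactly one lower and one upper facet. The ray above
  \<open>x\<close> hits the upper one if \<open>0 < b\<close> and the lower one if
  \<open>0 < a\<close>; the difference is one exactly for \<open>a < 0 < b\<close>.\<close>

lemma indicator_eq_sum_facets:
  fixes x :: "(real, 'd::{finite,linorder}) vec"
  assumes V: "V \<subseteq> {1..n}" "card V \<ge> CARD('d) + 1" and x: "generic n x"
  shows "(of_bool (x \<in> cyclic_hull V) :: int) =
    (\<Sum>F\<in>upper_facets CARD('d) V. of_bool (hits F x)) - (\<Sum>F\<in>lower_facets CARD('d) V. of_bool (hits F x))"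
proof -
  let ?e = "vertical :: (real, 'd) vec"
  have finV: "finite V" using V(1) finite_subset by blast
  have sub: "F \<subseteq> V" "finite F" "card F = CARD('d)" if "F \<in> signed_facets \<sigma> CARD('d) V" for F \<sigma>
    using that finV finite_subset by (auto simp: signed_facets_def)
  have fins: "finite (signed_facets \<sigma> CARD('d) V)" for \<sigma>
    by (rule finite_subset[of _ "Pow V"]) (use finV sub(1) in auto)
  define J where "J = {s. x + s *\<^sub>R ?e \<in> cyclic_hull V}"
  show ?thesis
  proof (cases "J = {}")
    case True
    then have "\<not> hits F x" if "F \<in> signed_facets \<sigma> CARD('d) V" for F \<sigma>
      using cyclic_hull_mono[OF sub(1)[OF that]] by (auto simp: hits_def J_def)
    moreover have "x \<notin> cyclic_hull V" using True by (auto simp: J_def dest: spec[of _ 0])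
    ultimately show ?thesis
      unfolding signed_facets[OF finV, symmetric] by (simp add: sum.neutral)
  next
    case False
    have "compact J"
    proof -
      have "closed J"
      proof -
        have "J = (\<lambda>s. x + s *\<^sub>R ?e) -` cyclic_hull V" by (auto simp: J_def)
        moreover have "closed ((\<lambda>s. x + s *\<^sub>R ?e) -` cyclic_hull V)"
          by (intro closed_vimage compact_imp_closed compact_cyclic_hull finV continuous_intros)
        ultimately show ?thesis by simp
      qed
      moreover have "bounded J"
      proof -
        obtain B where B: "\<And>y. y \<in> (cyclic_hull V :: ((real, 'd) vec) set) \<Longrightarrow> norm y \<le> B"
          using compact_imp_bounded[OF compact_cyclic_hull[OF finV]] unfolding bounded_iff by blast
        have "\<bar>s\<bar> \<le> (B + norm x) / norm ?e" if "s \<in> J" for s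
        proof -
          have "\<bar>s\<bar> * norm ?e = norm (x + s *\<^sub>R ?e - x)" by simp
          also have "\<dots> \<le> norm (x + s *\<^sub>R ?e) + norm x" by (rule norm_triangle_ineq4)
          also have "\<dots> \<le> B + norm x" using B that by (simp add: J_def)
          finally show ?thesis using vertical_nonzero[where 'd = 'd] by (simp add: field_simps)
        qed
        then show ?thesis unfolding bounded_iff by (auto simp: real_norm_def)
      qed
      ultimately show ?thesis by (simp add: compact_eq_bounded_closed)
    qed
    obtain b where b: "b \<in> J" "\<And>s. s \<in> J \<Longrightarrow> s \<le> b"
      using compact_attains_sup[OF \<open>compact J\<close> False] by blast
    obtain a where a: "a \<in> J" "\<And>s. s \<in> J \<Longrightarrow> a \<le> s"
      using compact_attains_inf[OF \<open>compact J\<close> False] by blast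
    have count: "(\<Sum>F\<in>signed_facets \<sigma> CARD('d) V. of_bool (hits F x)) = (of_bool (0 < c) :: int) \<and> c \<noteq> 0"
      if c: "c \<in> J" "\<And>s. s \<in> J \<Longrightarrow> \<sigma> * s \<le> \<sigma> * c" and \<sigma>: "\<sigma> = 1 \<or> \<sigma> = -1" for c \<sigma>
    proof -
      obtain F where F: "F \<in> signed_facets \<sigma> CARD('d) V" "x + c *\<^sub>R ?e \<in> cyclic_hull F"
        by (rule extreme_point_in_signed_facet[OF V x \<sigma>, of c]) (use c in \<open>auto simp: J_def\<close>)
      have hitsF: "hits G x \<longleftrightarrow> G = F \<and> 0 < c" if G: "G \<in> signed_facets \<sigma> CARD('d) V" for G
      proof
        assume "hits G x"
        then obtain s where s: "0 < s" "x + s *\<^sub>R ?e \<in> cyclic_hull G" by (auto simp: hits_def)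
        then show "G = F \<and> 0 < c" using signed_facet_unique[OF V(1) x \<sigma> G s(2) F] by simp
      qed (use F in \<open>auto simp: hits_def\<close>)
      have "(\<Sum>G\<in>signed_facets \<sigma> CARD('d) V. of_bool (hits G x))
          = (\<Sum>G\<in>signed_facets \<sigma> CARD('d) V. if G = F then of_bool (0 < c) else 0 :: int)"
        by (rule sum.cong) (auto simp: hitsF)
      also have "\<dots> = of_bool (0 < c)" using F(1) fins by simp
      finally have 1: "(\<Sum>G\<in>signed_facets \<sigma> CARD('d) V. of_bool (hits G x)) = (of_bool (0 < c) :: int)" .
      \<comment> \<open>Genericity keeps \<open>x\<close> off the facet itself, so \<open>a\<close>
        and \<open>b\<close> are nonzero and strict inequalities suffice.\<close>
      have "pform (node_poly F) (x + c *\<^sub>R ?e) = 0"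
        by (intro pform_cyclic_hull_eq_0) (use sub[OF F(1)] F(2) in auto)
      moreover have "pform (node_poly F) x \<noteq> 0"
        by (rule genericD[OF x]) (use sub[OF F(1)] V(1) in auto)
      ultimately have "c \<noteq> 0" by auto
      then show ?thesis using 1 by blast
    qed
    have 1: "(\<Sum>F\<in>upper_facets CARD('d) V. of_bool (hits F x)) = (of_bool (0 < b) :: int)" "b \<noteq> 0"
      using count[of b 1] b signed_facets[OF finV] by auto
    have 2: "(\<Sum>F\<in>lower_facets CARD('d) V. of_bool (hits F x)) = (of_bool (0 < a) :: int)" "a \<noteq> 0"
      using count[of a "- 1"] a signed_facets[OF finV] by auto
    have "x \<in> cyclic_hull V \<longleftrightarrow> a < 0 \<and> 0 < b"
    proof
      assume "x \<in> cyclic_hull V"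
      then have "0 \<in> J" by (simp add: J_def)
      then show "a < 0 \<and> 0 < b" using a(2)[of 0] b(2)[of 0] 1(2) 2(2) by auto
    next
      assume ab: "a < 0 \<and> 0 < b"
      let ?t = "b / (b - a)"
      have "?t *\<^sub>R (x + a *\<^sub>R ?e) + (1 - ?t) *\<^sub>R (x + b *\<^sub>R ?e) \<in> cyclic_hull V"
        by (rule convexD[OF convex_cyclic_hull]) (use a(1) b(1) ab in \<open>auto simp: J_def\<close>)
      moreover have "?t *\<^sub>R (x + a *\<^sub>R ?e) + (1 - ?t) *\<^sub>R (x + b *\<^sub>R ?e)
          = x + (?t * a + (1 - ?t) * b) *\<^sub>R ?e"
        by (simp add: algebra_simps)
      moreover have "?t * a + (1 - ?t) * b = 0" using ab by (simp add: field_simps)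
      ultimately show "x \<in> cyclic_hull V" by simp
    qed
    moreover have "a \<le> b" using a(2) b(1) by blast
    ultimately show ?thesis unfolding 1(1) 2(1) using 1(2) 2(2) by auto
  qed
qed

abbreviation ridges :: "nat \<Rightarrow> nat \<Rightarrow> nat set set" where
  "ridges d n \<equiv> {F. F \<subseteq> {1..n} \<and> card F = d}"

lemma finite_ridges: "finite (ridges d n)"
  by (rule finite_subset[of _ "Pow {1..n}"]) auto

corollary indicator_eq_sum_bdry:
  fixes x :: "(real, 'd::{finite,linorder}) vec"
  assumes V: "V \<subseteq> {1..n}" "card V \<ge> CARD('d) + 1" and x: "generic n x"
  shows "(of_bool (x \<in> cyclic_hull V) :: int) =
    (\<Sum>F\<in>ridges CARD('d) n. bdry CARD('d) V F * of_bool (hits F x))"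
proof -
  have *: "(\<Sum>F\<in>A. of_bool (hits F x)) = (\<Sum>F\<in>ridges CARD('d) n. of_bool (F \<in> A) * (of_bool (hits F x) :: int))"
    if "A \<subseteq> ridges CARD('d) n" for A
  proof -
    have "(\<Sum>F\<in>A. of_bool (hits F x) :: int) = (\<Sum>F\<in>A. of_bool (F \<in> A) * of_bool (hits F x))" by simp
    also have "\<dots> = (\<Sum>F\<in>ridges CARD('d) n. of_bool (F \<in> A) * of_bool (hits F x))"
      by (rule sum.mono_neutral_left) (use that finite_ridges in auto)
    finally show ?thesis .
  qed
  have "upper_facets CARD('d) V \<subseteq> ridges CARD('d) n" "lower_facets CARD('d) V \<subseteq> ridges CARD('d) n"
    using V(1) by (auto simp: upper_facets_def lower_facets_def)
  then show ?thesis
    unfolding indicator_eq_sum_facets[OF V x]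
    by (simp only: * bdry_def left_diff_distrib sum_subtractf)
qed

text \<open>Cross the simplex \<open>F\<close> vertically at a point in general position.\<close>
lemma hits_independent:
  fixes c :: "nat set \<Rightarrow> int"
  assumes vanish: "\<And>x :: (real, 'd::{finite,linorder}) vec. generic n x \<Longrightarrow>
      (\<Sum>F\<in>ridges CARD('d) n. c F * of_bool (hits F x)) = 0"
    and F: "F \<in> ridges CARD('d) n"
  shows "c F = 0"
proof -
  let ?e = "vertical :: (real, 'd) vec"
  have finF: "finite F" and cF: "card F = CARD('d)" using F finite_subset by auto
  have F0: "F \<noteq> {}" using cF by auto
  define SS where "SS = {S. S \<subseteq> {1..n} \<and> card S \<le> CARD('d) \<and> S \<noteq> F}"
  have finSS: "finite SS" by (rule finite_subset[of _ "Pow {1..n}"]) (auto simp: SS_def)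
  have finS: "finite S" if "S \<in> SS" for S using that finite_subset by (auto simp: SS_def)
  \<comment> \<open>With weights proportional to \<open>\<theta> ^ u\<close> on \<open>F\<close>,
    each other functional becomes a polynomial in \<open>\<theta>\<close>. It is nonzero because
    \<open>F\<close> has a vertex outside \<open>S\<close>, so all but finitely many
    \<open>\<theta>\<close> give a point \<open>y\<close> in general position inside
    \<open>F\<close>.\<close>
  define q where "q S = (\<Sum>u\<in>F. monom (poly (node_poly S) (real u)) u)" for S
  have qv: "poly (q S) \<theta> = (\<Sum>u\<in>F. \<theta> ^ u * poly (node_poly S) (real u))" for S \<theta>
    by (simp add: q_def poly_sum poly_monom mult.commute)
  have q0: "q S \<noteq> 0" if S: "S \<in> SS" for S
  proof
    assume "q S = 0"
    have "\<not> F \<subseteq> S"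
    proof
      assume "F \<subseteq> S"
      then have "F = S" using card_seteq[OF finS[OF S]] S cF by (auto simp: SS_def)
      then show False using S by (simp add: SS_def)
    qed
    then obtain u where u: "u \<in> F" "u \<notin> S" by blast
    have "coeff (q S) u = poly (node_poly S) (real u)"
      using finF u(1) by (simp add: q_def coeff_sum)
    then show False using \<open>q S = 0\<close> u(2) finS[OF S] by (simp add: poly_node_poly_eq_0)
  qed
  have "finite (\<Union>S\<in>SS. {\<theta>. poly (q S) \<theta> = 0})"
    using finSS q0 poly_roots_finite by blast
  then have "\<not> {0<..<1} \<subseteq> (\<Union>S\<in>SS. {\<theta>. poly (q S) \<theta> = 0})"
    using infinite_super[OF _ infinite_Ioo[of 0 "1::real"]] by auto
  then obtain \<theta> where \<theta>': "\<theta> \<in> {0<..<1}" "\<theta> \<notin> (\<Union>S\<in>SS. {\<theta>. poly (q S) \<theta> = 0})" by blast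
  have \<theta>: "0 < \<theta>" "\<And>S. S \<in> SS \<Longrightarrow> poly (q S) \<theta> \<noteq> 0"
    using \<theta>' by auto
  define Z where "Z = (\<Sum>u\<in>F. \<theta> ^ u)"
  have Z: "0 < Z" unfolding Z_def using \<theta>(1) finF F0 by (intro sum_pos) auto
  define y where "y = (\<Sum>u\<in>F. (\<theta> ^ u / Z) *\<^sub>R (moment_point u :: (real, 'd) vec))"
  have w1: "(\<Sum>u\<in>F. \<theta> ^ u / Z) = 1" using Z by (simp add: Z_def flip: sum_divide_distrib)
  have yF: "y \<in> cyclic_hull F"
    unfolding cyclic_hull_iff[OF finF] y_def
    by (intro exI[of _ "\<lambda>u. \<theta> ^ u / Z"]) (use w1 Z \<theta>(1) in auto)
  have ySS: "pform (node_poly S) y \<noteq> 0" if S: "S \<in> SS" for S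
  proof -
    have deg: "degree (node_poly S) \<le> CARD('d)" using S finS[OF S] by (simp add: degree_node_poly SS_def)
    have "pform (node_poly S) y = poly (q S) \<theta> / Z"
      unfolding y_def pform_weights[OF finF w1 deg] qv by (simp add: sum_divide_distrib)
    then show ?thesis using \<theta>(2)[OF S] Z by simp
  qed
  \<comment> \<open>Within vertical distance \<open>\<delta>\<close> of \<open>y\<close> no
    functional of a set other than \<open>F\<close> vanishes. Between the heights
    \<open>- \<delta> / 2\<close> and \<open>\<delta> / 2\<close> only the hit of \<open>F\<close>
    is lost.\<close>
  define \<delta> where "\<delta> = Min (insert 1 ((\<lambda>S. \<bar>pform (node_poly S) y\<bar>) ` SS))"
  have \<delta>: "0 < \<delta>" "\<And>S. S \<in> SS \<Longrightarrow> \<delta> \<le> \<bar>pform (node_poly S) y\<bar>"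
    using finSS ySS by (auto simp: \<delta>_def)
  have shift: "pform (node_poly S) (y + t *\<^sub>R ?e) = pform (node_poly S) y + (if card S = CARD('d) then t else 0)"
    if "finite S" "card S \<le> CARD('d)" for S t
    using pform_shift_node_poly[OF that(1), of y t] that(2) by auto
  have yF0: "pform (node_poly F) y = 0" using pform_cyclic_hull_eq_0[OF finF _ yF] cF by simp
  have gen: "generic n (y + t *\<^sub>R ?e)" if "0 < \<bar>t\<bar>" "\<bar>t\<bar> < \<delta>" for t
    unfolding generic_def
  proof (intro allI impI)
    fix S assume S: "S \<subseteq> {1..n}" "card S \<le> CARD('d)"
    then have fS: "finite S" using finite_subset by blast
    show "pform (node_poly S) (y + t *\<^sub>R ?e) \<noteq> 0"
    proof (cases "S = F")
      case True
      then show ?thesis using shift[OF fS S(2)] yF0 cF that by simp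
    next
      case False
      then have "\<delta> \<le> \<bar>pform (node_poly S) y\<bar>" using \<delta>(2) S by (simp add: SS_def)
      then show ?thesis unfolding shift[OF fS S(2)] using that by auto
    qed
  qed
  \<comment> \<open>The vertical line through \<open>y\<close> crosses the hyperplane of
    \<open>G\<close> only at height \<open>- pform (node_poly G) y\<close>.\<close>
  have hits_t: "hits G (y + t *\<^sub>R ?e) \<longleftrightarrow>
      y + (- pform (node_poly G) y) *\<^sub>R ?e \<in> cyclic_hull G \<and> 0 < - pform (node_poly G) y - t"
    if G: "G \<in> ridges CARD('d) n" for G t
  proof
    have fG: "finite G" and cG: "card G = CARD('d)" using G finite_subset by auto
    assume "hits G (y + t *\<^sub>R ?e)"
    then obtain s where s: "0 < s" "y + t *\<^sub>R ?e + s *\<^sub>R ?e \<in> cyclic_hull G" by (auto simp: hits_def)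
    then have in': "y + (t + s) *\<^sub>R ?e \<in> cyclic_hull G" by (simp add: scaleR_add_left add.assoc)
    then have "pform (node_poly G) (y + (t + s) *\<^sub>R ?e) = 0"
      using pform_cyclic_hull_eq_0[OF fG _ in'] cG by simp
    then have "t + s = - pform (node_poly G) y" using shift[OF fG] cG by simp
    then show "y + (- pform (node_poly G) y) *\<^sub>R ?e \<in> cyclic_hull G \<and> 0 < - pform (node_poly G) y - t"
      using in' s(1) by auto
  next
    assume h: "y + (- pform (node_poly G) y) *\<^sub>R ?e \<in> cyclic_hull G \<and> 0 < - pform (node_poly G) y - t"
    have "y + t *\<^sub>R ?e + (- pform (node_poly G) y - t) *\<^sub>R ?e = y + (- pform (node_poly G) y) *\<^sub>R ?e"
      by (simp add: algebra_simps)
    then show "hits G (y + t *\<^sub>R ?e)" unfolding hits_def using h by metis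
  qed
  let ?t = "\<delta> / 2"
  have diff: "c G * of_bool (hits G (y + (- ?t) *\<^sub>R ?e)) - c G * of_bool (hits G (y + ?t *\<^sub>R ?e))
      = (if G = F then c F else 0)" if G: "G \<in> ridges CARD('d) n" for G
  proof (cases "G = F")
    case True
    then show ?thesis unfolding hits_t[OF G] using yF yF0 \<delta>(1) by simp
  next
    case False
    then have "\<delta> \<le> \<bar>pform (node_poly G) y\<bar>" using \<delta>(2) G by (simp add: SS_def)
    then have "0 < - pform (node_poly G) y - ?t \<longleftrightarrow> 0 < - pform (node_poly G) y - (- ?t)"
      using \<delta>(1) by auto
    then show ?thesis unfolding hits_t[OF G] using False by simp
  qed
  have "0 = (\<Sum>G\<in>ridges CARD('d) n. c G * of_bool (hits G (y + (- ?t) *\<^sub>R ?e)))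
      - (\<Sum>G\<in>ridges CARD('d) n. c G * of_bool (hits G (y + ?t *\<^sub>R ?e)))"
    using vanish[OF gen[of ?t]] vanish[OF gen[of "- ?t"]] \<delta>(1) by simp
  also have "\<dots> = (\<Sum>G\<in>ridges CARD('d) n. if G = F then c F else 0)"
    unfolding sum_subtractf[symmetric] by (rule sum.cong) (use diff in auto)
  also have "\<dots> = c F" using finite_ridges F by simp
  finally show ?thesis by simp
qed

section \<open>Decompositions as signed sums of facets\<close>

text \<open>A vertical line leaves and enters the cells alternately, so the condition on the signed facets
  says that almost every line meets the cells exactly as it meets the whole polytope.\<close>
definition subdivisions :: "nat \<Rightarrow> nat \<Rightarrow> nat set set set" where
  "subdivisions d n = {\<delta>. (\<forall>V\<in>\<delta>. V \<subseteq> {1..n} \<and> d + 1 \<le> card V) \<and>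
     (\<forall>F. (\<Sum>V\<in>\<delta>. bdry d V F) = bdry d {1..n} F)}"

lemma bdry_eq_0: "\<not> (F \<subseteq> V \<and> card F = d) \<Longrightarrow> bdry d V F = 0"
  by (auto simp: bdry_def upper_facets_def lower_facets_def)

lemma cells_finite: "\<forall>V\<in>\<delta>. V \<subseteq> {1..n} \<Longrightarrow> finite (\<delta> :: nat set set)"
  by (rule finite_subset[of _ "Pow {1..n}"]) auto

text \<open>Converse to reading polynomials as functionals. Together with the root bound it says
  that a hyperplane meets the moment curve in at most \<open>d\<close> points.\<close>

lemma linear_functional_pform:
  fixes a :: "(real, 'd::{finite,linorder}) vec"
  assumes "a \<noteq> 0"
  obtains q where "q \<noteq> 0" "degree q \<le> CARD('d)" "\<And>y :: (real, 'd) vec. pform q y = a \<bullet> y - b"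
proof -
  define q where "q = (\<Sum>j\<in>UNIV. monom (a $ j) (card {..j})) + [:- b:]"
  have cp: "card {..j} \<noteq> 0" for j :: 'd by (auto simp: card_eq_0_iff)
  have inj: "card {..i} = card {..j} \<longleftrightarrow> i = j" for i j :: 'd
    using bij_betw_card_atMost[where 'd = 'd] by (auto simp: bij_betw_def inj_on_def)
  have cq: "coeff q (card {..j}) = a $ j" for j
    using cp[of j] by (simp add: q_def coeff_sum inj coeff_pCons split: nat.split)
  have c0: "coeff q 0 = - b"
    by (simp add: q_def coeff_sum cp)
  obtain j where "a $ j \<noteq> 0" using assms by (auto simp: vec_eq_iff)
  then have "q \<noteq> 0" using cq[of j] by auto
  moreover have "degree q \<le> CARD('d)"
    unfolding q_def
  proof (intro degree_add_le degree_sum_le)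
    show "degree (monom (a $ j) (card {..j})) \<le> CARD('d)" for j
      using card_mono[of "UNIV :: 'd set" "{..j}"] degree_monom_le[of "a $ j" "card {..j}"] by simp
  qed auto
  moreover have "pform q y = a \<bullet> y - b" for y :: "(real, 'd) vec"
    by (simp add: pform_def cq c0 inner_vec_def)
  ultimately show thesis using that by blast
qed

lemma card_real_roots_le:
  assumes "q \<noteq> 0" "degree q \<le> d" "\<And>v. v \<in> S \<Longrightarrow> poly q (real v) = 0"
  shows "card (S :: nat set) \<le> d"
proof -
  have "card (real ` S) \<le> card {x. poly q x = 0}"
    using assms poly_roots_finite[OF assms(1)] by (intro card_mono) auto
  then have "card S \<le> card {x. poly q x = 0}" by (simp add: card_image)
  also have "\<dots> \<le> degree q" by (rule card_poly_roots_bound[OF assms(1)])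
  finally show ?thesis using assms(2) by simp
qed

text \<open>A supporting hyperplane at \<open>x\<close> is a polynomial that is nonnegative on
  \<open>V\<close> and vanishes on the support of \<open>x\<close>. The support then has at most
  \<open>d\<close> elements, against genericity.\<close>

lemma generic_in_rel_interior:
  fixes x :: "(real, 'd::{finite,linorder}) vec"
  assumes V: "V \<subseteq> {1..n}" and x: "generic n x" "x \<in> cyclic_hull V"
  shows "x \<in> rel_interior (cyclic_hull V)"
proof (rule ccontr)
  have finV: "finite V" using V finite_subset by blast
  assume "x \<notin> rel_interior (cyclic_hull V)"
  then obtain a where a: "a \<noteq> 0" "\<And>y. y \<in> cyclic_hull V \<Longrightarrow> a \<bullet> x \<le> a \<bullet> y"
    by (rule supporting_hyperplane_rel_boundary[OF convex_cyclic_hull x(2)]) (rule that; assumption)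
  obtain q where q: "q \<noteq> 0" "degree q \<le> CARD('d)" "\<And>y :: (real, 'd) vec. pform q y = a \<bullet> y - a \<bullet> x"
    using linear_functional_pform[OF a(1)] by blast
  obtain S w where S: "S \<subseteq> V" "\<And>v. v \<in> S \<Longrightarrow> 0 < w v" "sum w S = (1::real)"
    "x = (\<Sum>v\<in>S. w v *\<^sub>R moment_point v)"
    using cyclic_hull_caratheodory[OF finV x(2)] by metis
  have finS: "finite S" using S(1) finV finite_subset by blast
  have nonneg: "0 \<le> poly q (real v)" if "v \<in> V" for v
  proof -
    have "(moment_point v :: (real, 'd) vec) \<in> cyclic_hull V"
      unfolding cyclic_hull_def using that by (intro hull_inc) auto
    then show ?thesis using a(2) q(3) pform_moment_point[OF q(2), of v] by (metis diff_ge_0_iff_ge)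
  qed
  have "0 = pform q x" using q(3) by simp
  also have "\<dots> = (\<Sum>v\<in>S. w v * poly q (real v))"
    unfolding S(4) by (rule pform_weights[OF finS S(3) q(2)])
  finally have sum0: "(\<Sum>v\<in>S. w v * poly q (real v)) = 0" by simp
  have "0 \<le> w v * poly q (real v)" if "v \<in> S" for v
    using S(1) S(2)[OF that] nonneg[of v] that by (simp add: subset_iff)
  then have "\<forall>v\<in>S. w v * poly q (real v) = 0"
    using sum_nonneg_eq_0_iff[OF finS, of "\<lambda>v. w v * poly q (real v)"] sum0 by simp
  then have "card S \<le> CARD('d)"
    by (intro card_real_roots_le[OF q(1,2)]) (use S(2) in force)
  moreover have "x \<in> cyclic_hull S"
    unfolding cyclic_hull_iff[OF finS] by (intro exI[of _ w]) (use S(2-4) in \<open>auto simp: less_imp_le\<close>)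
  ultimately have "pform (node_poly S) x = 0" using pform_cyclic_hull_eq_0[OF finS] by blast
  then show False using genericD[OF x(1)] S(1) V \<open>card S \<le> CARD('d)\<close> by blast
qed

section \<open>Density of generic points\<close>

lemma closed_pform_eq_0: "closed {x :: (real, 'd::{finite,linorder}) vec. pform p x = 0}"
  unfolding pform_def by (intro closed_Collect_eq continuous_intros)

lemma interior_pform_eq_0:
  assumes "p \<noteq> 0" "degree p \<le> CARD('d)"
  shows "interior {x :: (real, 'd::{finite,linorder}) vec. pform p x = 0} = {}"
proof -
  define a :: "(real, 'd) vec" where "a = (\<chi> j. coeff p (card {..j}))"
  have eq: "pform p x = 0 \<longleftrightarrow> a \<bullet> x = - coeff p 0" for x
    by (auto simp: pform_def a_def inner_vec_def)
  show ?thesis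
  proof (cases "a = 0")
    case False
    then show ?thesis unfolding eq by (rule interior_hyperplane)
  next
    case True
    have "coeff p i = 0" if i: "0 < i" for i
    proof (cases "i \<le> CARD('d)")
      case True
      then obtain j :: 'd where "i = card {..j}"
        using bij_betw_imp_surj_on[OF bij_betw_card_atMost[where 'd = 'd]] i
        by (metis (no_types, lifting) One_nat_def Suc_leI atLeastAtMost_iff imageE)
      then show ?thesis using \<open>a = 0\<close> by (auto simp: a_def vec_eq_iff)
    qed (use assms(2) in \<open>simp add: coeff_eq_0\<close>)
    then have "coeff p 0 \<noteq> 0" using assms(1) by (metis gr0I leading_coeff_0_iff)
    then show ?thesis unfolding eq using True by simp
  qed
qed

lemma generic_dense:
  assumes "open U" "U \<noteq> {}"
  obtains x :: "(real, 'd::{finite,linorder}) vec" where "x \<in> U" "generic n x"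
proof -
  have *: "interior (\<Union>p\<in>A. {x :: (real, 'd) vec. pform p x = 0}) = {}
      \<and> closed (\<Union>p\<in>A. {x :: (real, 'd) vec. pform p x = 0})"
    if "finite A" "\<And>p. p \<in> A \<Longrightarrow> p \<noteq> 0 \<and> degree p \<le> CARD('d)" for A
    using that
  proof (induction A rule: finite_induct)
    case (insert p A)
    then have IH: "interior (\<Union>p\<in>A. {x :: (real, 'd) vec. pform p x = 0}) = {}"
        "closed (\<Union>p\<in>A. {x :: (real, 'd) vec. pform p x = 0})"
      by auto
    have "interior ({x :: (real, 'd) vec. pform p x = 0} \<union> (\<Union>p\<in>A. {x. pform p x = 0})) = {}"
      using interior_closed_Un_empty_interior[OF closed_pform_eq_0[of p] IH(1)] interior_pform_eq_0[where 'd = 'd, of p] insert.prems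
      by simp
    then show ?case using IH(2) closed_pform_eq_0[where 'd = 'd, of p] by auto
  qed simp
  define A where "A = node_poly ` {S. S \<subseteq> {1..n} \<and> card S \<le> CARD('d)}"
  have "finite {S. S \<subseteq> {1..n} \<and> card S \<le> CARD('d)}"
    by (rule finite_subset[of _ "Pow {1..n}"]) auto
  then have "finite A" by (simp add: A_def)
  moreover have "p \<noteq> 0 \<and> degree p \<le> CARD('d)" if "p \<in> A" for p
    using that finite_subset[OF _ finite_atLeastAtMost[of 1 n]] by (auto simp: A_def degree_node_poly)
  ultimately have "interior (\<Union>p\<in>A. {x :: (real, 'd) vec. pform p x = 0}) = {}" using * by blast
  then have "\<not> U \<subseteq> (\<Union>p\<in>A. {x :: (real, 'd) vec. pform p x = 0})"
    using interior_maximal[OF _ assms(1)] assms(2) by blast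
  then obtain x where "x \<in> U" "\<forall>p\<in>A. pform p x \<noteq> 0" by blast
  then show thesis using that by (auto simp: A_def generic_def)
qed

lemma interior_cyclic_hull_nonempty:
  assumes "V \<subseteq> {1..n}" "CARD('d) + 1 \<le> card V"
  shows "interior (cyclic_hull V :: ((real, 'd::{finite,linorder}) vec) set) \<noteq> {}"
proof
  assume "interior (cyclic_hull V :: ((real, 'd) vec) set) = {}"
  then obtain a b where a: "a \<noteq> 0" "(cyclic_hull V :: ((real, 'd) vec) set) \<subseteq> {x. a \<bullet> x = b}"
    using empty_interior_subset_hyperplane[OF convex_cyclic_hull] by blast
  obtain q where q: "q \<noteq> 0" "degree q \<le> CARD('d)" "\<And>y :: (real, 'd) vec. pform q y = a \<bullet> y - b"
    using linear_functional_pform[OF a(1)] by blast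
  have "poly q (real v) = 0" if "v \<in> V" for v
  proof -
    have "(moment_point v :: (real, 'd) vec) \<in> cyclic_hull V"
      unfolding cyclic_hull_def using that by (intro hull_inc) auto
    then show ?thesis using a(2) q(3)[of "moment_point v"] pform_moment_point[OF q(2), of v] by auto
  qed
  then have "card V \<le> CARD('d)" by (rule card_real_roots_le[OF q(1,2)])
  then show False using assms(2) by simp
qed

text \<open>Each generic point of the polytope lies in exactly one cell: a second one would put it
  into a proper face, which misses the relative interior. This equality of indicators becomes an
  equality of signed facets by \<open>hits_independent\<close>.\<close>

lemma polytopal_decomposition_imp_subdivision:
  assumes n: "CARD('d) + 1 \<le> n" and \<delta>: "polytopal_decomposition TYPE('d::{finite,linorder}) n \<delta>"
  shows "\<delta> \<in> subdivisions CARD('d) n"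
proof -
  have cells: "V \<subseteq> {1..n}" "CARD('d) + 1 \<le> card V" if "V \<in> \<delta>" for V
    using \<delta> that by (auto simp: polytopal_decomposition_def)
  have fin: "finite \<delta>" using cells(1) cells_finite by blast
  have union: "(\<Union>V\<in>\<delta>. cyclic_hull V) = (cyclic_hull {1..n} :: ((real, 'd) vec) set)"
    using \<delta> by (simp add: polytopal_decomposition_def)
  have count: "(\<Sum>V\<in>\<delta>. of_bool (x \<in> cyclic_hull V) :: int) = of_bool (x \<in> cyclic_hull {1..n})"
    if x: "generic n x" for x :: "(real, 'd) vec"
  proof (cases "x \<in> cyclic_hull {1..n}")
    case True
    then obtain V where V: "V \<in> \<delta>" "x \<in> cyclic_hull V" using union by blast
    have "x \<notin> cyclic_hull W" if W: "W \<in> \<delta>" "W \<noteq> V" for W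
    proof
      assume xW: "x \<in> cyclic_hull W"
      let ?F = "(cyclic_hull V :: ((real, 'd) vec) set) \<inter> cyclic_hull W"
      have "proper_face_of ?F (cyclic_hull V)"
        using \<delta> V(1) W unfolding polytopal_decomposition_def Let_def by blast
      then have "?F \<inter> rel_interior (cyclic_hull V) = {}"
        unfolding proper_face_of_def by (intro face_of_disjoint_rel_interior) auto
      then show False using generic_in_rel_interior[OF cells(1)[OF V(1)] x V(2)] V(2) xW by blast
    qed
    then have "(\<Sum>W\<in>\<delta>. of_bool (x \<in> cyclic_hull W) :: int) = (\<Sum>W\<in>\<delta>. if W = V then 1 else 0)"
      by (intro sum.cong) (use V in auto)
    then show ?thesis using True V(1) fin by simp
  next
    case False
    then have "x \<notin> cyclic_hull V" if "V \<in> \<delta>" for V using union that by blast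
    then have "(\<Sum>W\<in>\<delta>. of_bool (x \<in> cyclic_hull W) :: int) = 0" by (intro sum.neutral) auto
    then show ?thesis using False by simp
  qed
  have "(\<Sum>V\<in>\<delta>. bdry CARD('d) V F) - bdry CARD('d) {1..n} F = 0" for F
  proof (cases "F \<in> ridges CARD('d) n")
    case True
    show ?thesis
    proof (rule hits_independent[where 'd = 'd and n = n, OF _ True])
      fix x :: "(real, 'd) vec" assume x: "generic n x"
      have "(\<Sum>F\<in>ridges CARD('d) n. ((\<Sum>V\<in>\<delta>. bdry CARD('d) V F) - bdry CARD('d) {1..n} F) * of_bool (hits F x))
        = (\<Sum>F\<in>ridges CARD('d) n. \<Sum>V\<in>\<delta>. bdry CARD('d) V F * of_bool (hits F x))
          - (\<Sum>F\<in>ridges CARD('d) n. bdry CARD('d) {1..n} F * of_bool (hits F x))"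
        by (simp only: left_diff_distrib sum_subtractf sum_distrib_right)
      also have "\<dots> = (\<Sum>V\<in>\<delta>. of_bool (x \<in> cyclic_hull V)) - of_bool (x \<in> cyclic_hull {1..n})"
        using indicator_eq_sum_bdry[OF _ _ x] cells n by (subst sum.swap) simp
      finally show "(\<Sum>F\<in>ridges CARD('d) n. ((\<Sum>V\<in>\<delta>. bdry CARD('d) V F) - bdry CARD('d) {1..n} F)
          * of_bool (hits F x)) = 0"
        using count[OF x] by simp
    qed
  next
    case False
    then have "bdry CARD('d) V F = 0" if "V \<subseteq> {1..n}" for V
      by (intro bdry_eq_0) (use that in auto)
    then show ?thesis using cells(1) by (simp add: sum.neutral)
  qed
  then show ?thesis using cells by (auto simp: subdivisions_def)
qed

text \<open>Read from facets to indicators, the signed sum counts the cells that contain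
  \<open>x\<close>.\<close>

lemma subdivision_generic_cells:
  fixes x :: "(real, 'd::{finite,linorder}) vec"
  assumes n: "CARD('d) + 1 \<le> n" and \<delta>: "\<delta> \<in> subdivisions CARD('d) n" and x: "generic n x"
  shows "x \<in> cyclic_hull {1..n} \<Longrightarrow> \<exists>V\<in>\<delta>. x \<in> cyclic_hull V"
    and "V \<in> \<delta> \<Longrightarrow> W \<in> \<delta> \<Longrightarrow> x \<in> cyclic_hull V \<Longrightarrow> x \<in> cyclic_hull W \<Longrightarrow> V = W"
proof -
  have cells: "V \<subseteq> {1..n}" "CARD('d) + 1 \<le> card V" if "V \<in> \<delta>" for V
    using \<delta> that by (auto simp: subdivisions_def)
  have fin: "finite \<delta>" using cells(1) cells_finite by blast
  have "(\<Sum>V\<in>\<delta>. of_bool (x \<in> cyclic_hull V) :: int)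
      = (\<Sum>F\<in>ridges CARD('d) n. \<Sum>V\<in>\<delta>. bdry CARD('d) V F * of_bool (hits F x))"
    using indicator_eq_sum_bdry[OF _ _ x] cells by (subst sum.swap) simp
  also have "\<dots> = (\<Sum>F\<in>ridges CARD('d) n. bdry CARD('d) {1..n} F * of_bool (hits F x))"
    unfolding sum_distrib_right[symmetric] using \<delta> by (simp add: subdivisions_def)
  also have "\<dots> = of_bool (x \<in> cyclic_hull {1..n})"
    using indicator_eq_sum_bdry[of "{1..n}", OF _ _ x] n by simp
  finally have count: "(\<Sum>V\<in>\<delta>. of_bool (x \<in> cyclic_hull V) :: int) = of_bool (x \<in> cyclic_hull {1..n})" .
  show "\<exists>V\<in>\<delta>. x \<in> cyclic_hull V" if "x \<in> cyclic_hull {1..n}"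
  proof (rule ccontr)
    assume "\<not> ?thesis"
    then have "(\<Sum>V\<in>\<delta>. of_bool (x \<in> cyclic_hull V) :: int) = 0" by (intro sum.neutral) auto
    then show False using count that by simp
  qed
  show "V = W" if VW: "V \<in> \<delta>" "W \<in> \<delta>" "x \<in> cyclic_hull V" "x \<in> cyclic_hull W"
  proof (rule ccontr)
    assume "V \<noteq> W"
    have "(\<Sum>U\<in>{V, W}. of_bool (x \<in> cyclic_hull U) :: int) \<le> (\<Sum>U\<in>\<delta>. of_bool (x \<in> cyclic_hull U))"
      by (rule sum_mono2[OF fin]) (use VW in auto)
    moreover have "(\<Sum>U\<in>{V, W}. of_bool (x \<in> cyclic_hull U) :: int) = 2" using VW \<open>V \<noteq> W\<close> by simp
    ultimately have "2 \<le> (of_bool (x \<in> cyclic_hull {1..n}) :: int)" using count by linarith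
    then show False by (cases "x \<in> cyclic_hull {1..n}") auto
  qed
qed

text \<open>The union of the cells is closed and contains the generic points, which are dense in the
  polytope.\<close>

lemma subdivision_covers:
  assumes n: "CARD('d) + 1 \<le> n" and \<delta>: "\<delta> \<in> subdivisions CARD('d) n"
  shows "(\<Union>V\<in>\<delta>. cyclic_hull V) = (cyclic_hull {1..n} :: ((real, 'd::{finite,linorder}) vec) set)"
proof
  have cells: "V \<subseteq> {1..n}" if "V \<in> \<delta>" for V using \<delta> that by (auto simp: subdivisions_def)
  then show "(\<Union>V\<in>\<delta>. cyclic_hull V) \<subseteq> (cyclic_hull {1..n} :: ((real, 'd) vec) set)"
    using cyclic_hull_mono by blast
  have fin: "finite \<delta>" using cells cells_finite by blast
  let ?U = "\<Union>V\<in>\<delta>. (cyclic_hull V :: ((real, 'd) vec) set)"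
  let ?C = "cyclic_hull {1..n} :: ((real, 'd) vec) set"
  have "finite V" if "V \<in> \<delta>" for V using cells[OF that] finite_subset by blast
  then have closed: "closed ?U" using fin by (intro closed_UN) (auto intro: compact_imp_closed compact_cyclic_hull)
  have "interior ?C - ?U = {}"
  proof (rule ccontr)
    assume ne: "interior ?C - ?U \<noteq> {}"
    have "open (interior ?C - ?U)" using closed by (intro open_Diff) auto
    then obtain x :: "(real, 'd) vec" where "x \<in> interior ?C - ?U" "generic n x"
      using generic_dense[OF _ ne] by blast
    then show False using subdivision_generic_cells(1)[OF n \<delta>, of x] interior_subset[of ?C] by blast
  qed
  then have "closure (interior ?C) \<subseteq> ?U" using closed by (intro closure_minimal) auto
  moreover have "closure (interior ?C) = closure ?C"
    by (rule convex_closure_interior[OF convex_cyclic_hull interior_cyclic_hull_nonempty[of _ n]]) (use n in auto)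
  moreover have "?C \<subseteq> closure ?C" by (rule closure_subset)
  ultimately show "?C \<subseteq> ?U" by blast
qed

text \<open>No generic point lies in both cells, so their interiors are disjoint and a hyperplane
  separates them. It is given as a functional and as a polynomial, for use with faces and with signs
  of vertices.\<close>

lemma subdivision_separation:
  assumes n: "CARD('d) + 1 \<le> n" and \<delta>: "\<delta> \<in> subdivisions CARD('d) n"
    and VW: "V \<in> \<delta>" "W \<in> \<delta>" "V \<noteq> W"
  obtains a :: "(real, 'd::{finite,linorder}) vec" and b q where
    "q \<noteq> 0" "degree q \<le> CARD('d)" "\<And>y :: (real, 'd) vec. pform q y = a \<bullet> y - b"
    "\<And>y. y \<in> cyclic_hull V \<Longrightarrow> a \<bullet> y \<le> b" "\<And>y. y \<in> cyclic_hull W \<Longrightarrow> b \<le> a \<bullet> y"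
    "\<And>v. v \<in> V \<Longrightarrow> poly q (real v) \<le> 0" "\<And>w. w \<in> W \<Longrightarrow> 0 \<le> poly q (real w)"
proof -
  let ?S = "cyclic_hull V :: ((real, 'd) vec) set" and ?T = "cyclic_hull W :: ((real, 'd) vec) set"
  have cells: "V \<subseteq> {1..n}" "CARD('d) + 1 \<le> card V" if "V \<in> \<delta>" for V
    using \<delta> that by (auto simp: subdivisions_def)
  have int: "interior ?S \<noteq> {}" "interior ?T \<noteq> {}"
    using interior_cyclic_hull_nonempty cells VW(1,2) by blast+
  have "interior ?S \<inter> interior ?T = {}"
  proof (rule ccontr)
    assume ne: "\<not> ?thesis"
    have "open (interior ?S \<inter> interior ?T)" by (intro open_Int open_interior)
    then obtain x where "x \<in> interior ?S \<inter> interior ?T" "generic n x"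
      using generic_dense[OF _ ne] by blast
    then have "V = W"
      using subdivision_generic_cells(2)[OF n \<delta>, of x V W] VW(1,2) interior_subset[of ?S] interior_subset[of ?T]
      by blast
    then show False using VW(3) by blast
  qed
  then obtain a b where ab: "a \<noteq> 0" "\<forall>x\<in>interior ?S. a \<bullet> x \<le> b" "\<forall>x\<in>interior ?T. b \<le> a \<bullet> x"
    using separating_hyperplane_sets[OF convex_interior[OF convex_cyclic_hull] convex_interior[OF convex_cyclic_hull] int]
    by blast
  have S: "a \<bullet> y \<le> b" if "y \<in> ?S" for y
  proof -
    have "closure (interior ?S) \<subseteq> {x. a \<bullet> x \<le> b}"
      by (rule closure_minimal) (use ab(2) in \<open>auto intro: closed_halfspace_le\<close>)
    then show ?thesis
      using that closure_subset[of ?S] convex_closure_interior[OF convex_cyclic_hull int(1)] by auto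
  qed
  have T: "b \<le> a \<bullet> y" if "y \<in> ?T" for y
  proof -
    have "closure (interior ?T) \<subseteq> {x. a \<bullet> x \<ge> b}"
      by (rule closure_minimal) (use ab(3) in \<open>auto intro: closed_halfspace_ge\<close>)
    then show ?thesis
      using that closure_subset[of ?T] convex_closure_interior[OF convex_cyclic_hull int(2)] by auto
  qed
  obtain q where q: "q \<noteq> 0" "degree q \<le> CARD('d)" "\<And>y :: (real, 'd) vec. pform q y = a \<bullet> y - b"
    using linear_functional_pform[OF ab(1)] by blast
  have val: "poly q (real v) = a \<bullet> moment_point v - b" for v
    using q(3)[of "moment_point v"] pform_moment_point[OF q(2), of v] by simp
  have in_hull: "(moment_point v :: (real, 'd) vec) \<in> cyclic_hull U" if "v \<in> U" for v U
    unfolding cyclic_hull_def using that by (intro hull_inc) auto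
  show thesis
    by (rule that[OF q S T]) (use S T val in_hull in auto)
qed

text \<open>At most \<open>d\<close> vertices of the two cells lie on a separating hyperplane, and
  these are affinely independent. Inside the hyperplane the cells are therefore faces of one
  simplex, where the hulls of two vertex sets meet in the hull of the common vertices. The face is
  proper since a cell has more than \<open>d\<close> vertices.\<close>

lemma subdivision_face_to_face:
  assumes n: "CARD('d) + 1 \<le> n" and \<delta>: "\<delta> \<in> subdivisions CARD('d) n"
    and VW: "V \<in> \<delta>" "W \<in> \<delta>" "V \<noteq> W"
  shows "proper_face_of (cyclic_hull V \<inter> cyclic_hull W :: ((real, 'd::{finite,linorder}) vec) set) (cyclic_hull V)"
    and "proper_face_of (cyclic_hull V \<inter> cyclic_hull W :: ((real, 'd) vec) set) (cyclic_hull W)"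
proof -
  have cells: "V \<subseteq> {1..n}" "CARD('d) + 1 \<le> card V" if "V \<in> \<delta>" for V
    using \<delta> that by (auto simp: subdivisions_def)
  have fin: "finite V" "finite W" using cells VW(1,2) finite_subset by blast+
  obtain a :: "(real, 'd) vec" and b q where
    q: "q \<noteq> 0" "degree q \<le> CARD('d)" "\<And>y :: (real, 'd) vec. pform q y = a \<bullet> y - b"
    and S: "\<And>y. y \<in> cyclic_hull V \<Longrightarrow> a \<bullet> y \<le> b" and T: "\<And>y. y \<in> cyclic_hull W \<Longrightarrow> b \<le> a \<bullet> y"
    and qV: "\<And>v. v \<in> V \<Longrightarrow> poly q (real v) \<le> 0" and qW: "\<And>w. w \<in> W \<Longrightarrow> 0 \<le> poly q (real w)"
    using subdivision_separation[where 'd = 'd, OF n \<delta> VW] by metis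
  define Z where "Z U = {v \<in> U. poly q (real v) = 0}" for U
  have onZ: "cyclic_hull U \<inter> {x. a \<bullet> x = b} = (cyclic_hull (Z U) :: ((real, 'd) vec) set)"
    if U: "finite U" "(\<forall>v\<in>U. poly q (real v) \<le> 0) \<or> (\<forall>v\<in>U. 0 \<le> poly q (real v))" for U
  proof
    have finZ: "finite (Z U)" using U(1) by (simp add: Z_def)
    show "cyclic_hull U \<inter> {x. a \<bullet> x = b} \<subseteq> (cyclic_hull (Z U) :: ((real, 'd) vec) set)"
    proof
      fix x :: "(real, 'd) vec" assume x: "x \<in> cyclic_hull U \<inter> {x. a \<bullet> x = b}"
      then obtain w where w: "\<forall>v\<in>U. 0 \<le> w v" "sum w U = 1" "x = (\<Sum>v\<in>U. w v *\<^sub>R moment_point v)"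
        using iffD1[OF cyclic_hull_iff[OF U(1)], of x] by blast
      have sum0: "(\<Sum>v\<in>U. w v * poly q (real v)) = 0"
        using pform_weights[OF U(1) w(2) q(2)] q(3)[of x] x w(3) by simp
      have "\<forall>v\<in>U. w v * poly q (real v) = 0"
      proof (rule disjE[OF U(2)])
        assume pos: "\<forall>v\<in>U. 0 \<le> poly q (real v)"
        have "0 \<le> w v * poly q (real v)" if "v \<in> U" for v using w(1) pos that by simp
        then show ?thesis using sum_nonneg_eq_0_iff[OF U(1), of "\<lambda>v. w v * poly q (real v)"] sum0 by blast
      next
        assume neg: "\<forall>v\<in>U. poly q (real v) \<le> 0"
        have "0 \<le> - (w v * poly q (real v))" if "v \<in> U" for v
          using mult_nonneg_nonpos[of "w v" "poly q (real v)"] w(1) neg that by simp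
        moreover have "(\<Sum>v\<in>U. - (w v * poly q (real v))) = 0" using sum0 by (simp add: sum_negf)
        ultimately have "\<forall>v\<in>U. - (w v * poly q (real v)) = 0"
          using sum_nonneg_eq_0_iff[OF U(1), of "\<lambda>v. - (w v * poly q (real v))"] by blast
        then show ?thesis by simp
      qed
      then have z: "w v = 0" if "v \<in> U - Z U" for v using that by (auto simp: Z_def)
      have "sum w (Z U) = sum w U" by (rule sum.mono_neutral_left) (use U(1) z in \<open>auto simp: Z_def\<close>)
      moreover have "(\<Sum>v\<in>Z U. w v *\<^sub>R (moment_point v :: (real, 'd) vec)) = (\<Sum>v\<in>U. w v *\<^sub>R moment_point v)"
        by (rule sum.mono_neutral_left) (use U(1) z in \<open>auto simp: Z_def\<close>)
      ultimately show "x \<in> cyclic_hull (Z U)"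
        unfolding cyclic_hull_iff[OF finZ] by (intro exI[of _ w]) (use w in \<open>auto simp: Z_def\<close>)
    qed
    show "(cyclic_hull (Z U) :: ((real, 'd) vec) set) \<subseteq> cyclic_hull U \<inter> {x. a \<bullet> x = b}"
    proof
      fix x :: "(real, 'd) vec" assume x: "x \<in> cyclic_hull (Z U)"
      then obtain w where w: "sum w (Z U) = 1" "x = (\<Sum>v\<in>Z U. w v *\<^sub>R moment_point v)"
        using iffD1[OF cyclic_hull_iff[OF finZ] x] by blast
      have "pform q x = 0"
        unfolding w(2) pform_weights[OF finZ w(1) q(2)] by (rule sum.neutral) (simp add: Z_def)
      moreover have "x \<in> cyclic_hull U" using x cyclic_hull_mono[of "Z U" U] by (auto simp: Z_def)
      ultimately show "x \<in> cyclic_hull U \<inter> {x. a \<bullet> x = b}" using q(3) by simp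
    qed
  qed
  have cardZ: "card (Z V \<union> Z W) \<le> CARD('d)"
    by (rule card_real_roots_le[OF q(1,2)]) (auto simp: Z_def)
  have finZ: "finite (Z V \<union> Z W)" using fin by (simp add: Z_def)
  have indep: "\<not> affine_dependent (moment_point ` (Z V \<union> Z W) :: ((real, 'd) vec) set)"
    by (rule affine_independent_moment_points[OF finZ]) (use cardZ in simp)
  have inter: "cyclic_hull V \<inter> cyclic_hull W = (cyclic_hull (Z V) \<inter> cyclic_hull (Z W) :: ((real, 'd) vec) set)"
    using onZ[OF fin(1)] onZ[OF fin(2)] qV qW S T by (fastforce intro: antisym)
  also have "\<dots> = convex hull (moment_point ` Z V \<inter> moment_point ` Z W)"
    unfolding cyclic_hull_def
    by (rule convex_hull_Int[symmetric]) (use indep in \<open>simp add: image_Un\<close>)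
  finally have eq: "cyclic_hull V \<inter> cyclic_hull W
      = convex hull (moment_point ` Z V \<inter> moment_point ` Z W :: ((real, 'd) vec) set)" .
  have face: "(cyclic_hull V \<inter> cyclic_hull W :: ((real, 'd) vec) set) face_of cyclic_hull (Z U)"
    if "U = V \<or> U = W" for U
  proof -
    have "\<not> affine_dependent (moment_point ` Z U :: ((real, 'd) vec) set)"
      by (rule affine_independent_subset[OF indep]) (use that in auto)
    then show ?thesis
      unfolding eq cyclic_hull_def[of "Z U"]
      by (subst face_of_convex_hull_affine_independent) (use that in auto)
  qed
  have faceV: "cyclic_hull (Z V) face_of (cyclic_hull V :: ((real, 'd) vec) set)"
  proof -
    have "cyclic_hull V \<inter> {x. a \<bullet> x = b} face_of cyclic_hull V"
      by (rule face_of_Int_supporting_hyperplane_le[OF convex_cyclic_hull S])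
    then show ?thesis using onZ[OF fin(1)] qV by simp
  qed
  have faceW: "cyclic_hull (Z W) face_of (cyclic_hull W :: ((real, 'd) vec) set)"
  proof -
    have "cyclic_hull W \<inter> {x. a \<bullet> x = b} face_of cyclic_hull W"
      by (rule face_of_Int_supporting_hyperplane_ge[OF convex_cyclic_hull T])
    then show ?thesis using onZ[OF fin(2)] qW by simp
  qed
  have ne: "cyclic_hull V \<inter> cyclic_hull W \<noteq> (cyclic_hull U :: ((real, 'd) vec) set)"
    if U: "U = V \<or> U = W" for U
  proof
    assume eqU: "cyclic_hull V \<inter> cyclic_hull W = (cyclic_hull U :: ((real, 'd) vec) set)"
    have "poly q (real v) = 0" if "v \<in> U" for v
    proof -
      have "(moment_point v :: (real, 'd) vec) \<in> cyclic_hull U"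
        unfolding cyclic_hull_def using that by (intro hull_inc) auto
      then have "a \<bullet> moment_point v = b" using eqU S T by (metis IntD1 IntD2 antisym)
      then show ?thesis using q(3)[of "moment_point v"] pform_moment_point[OF q(2), of v] by simp
    qed
    then have "card U \<le> CARD('d)" by (rule card_real_roots_le[OF q(1,2)])
    then show False using cells(2)[OF VW(1)] cells(2)[OF VW(2)] U by auto
  qed
  show "proper_face_of (cyclic_hull V \<inter> cyclic_hull W :: ((real, 'd) vec) set) (cyclic_hull V)"
    unfolding proper_face_of_def using face_of_trans[OF face faceV] ne by blast
  show "proper_face_of (cyclic_hull V \<inter> cyclic_hull W :: ((real, 'd) vec) set) (cyclic_hull W)"
    unfolding proper_face_of_def using face_of_trans[OF face faceW] ne by blast
qed

theorem polytopal_decomposition_iff_subdivision: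
  assumes n: "CARD('d) + 1 \<le> n"
  shows "polytopal_decomposition TYPE('d::{finite,linorder}) n \<delta> \<longleftrightarrow> \<delta> \<in> subdivisions CARD('d) n"
proof
  assume \<delta>: "\<delta> \<in> subdivisions CARD('d) n"
  have "V \<subseteq> {1..n} \<and> CARD('d) + 1 \<le> card V" if "V \<in> \<delta>" for V
    using \<delta> that by (auto simp: subdivisions_def)
  then show "polytopal_decomposition TYPE('d) n \<delta>"
    unfolding polytopal_decomposition_def Let_def
    using subdivision_face_to_face[where 'd = 'd, OF n \<delta>] subdivision_covers[where 'd = 'd, OF n \<delta>] by blast
qed (rule polytopal_decomposition_imp_subdivision[OF n])

text \<open>A common ridge lies on opposite sides of the two cells: the separating hyperplane meets the
  moment curve exactly in the ridge.\<close>
lemma subdivision_common_facet: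
  assumes n: "CARD('d::{finite,linorder}) + 1 \<le> n" and \<delta>: "\<delta> \<in> subdivisions CARD('d) n"
    and VW: "V \<in> \<delta>" "W \<in> \<delta>" "V \<noteq> W" and F: "F \<subseteq> V" "F \<subseteq> W" "card F = CARD('d)"
  shows "F \<in> upper_facets CARD('d) V \<and> F \<in> lower_facets CARD('d) W \<or>
         F \<in> lower_facets CARD('d) V \<and> F \<in> upper_facets CARD('d) W"
proof -
  have cells: "V \<subseteq> {1..n}" "CARD('d) + 1 \<le> card V" if "V \<in> \<delta>" for V
    using \<delta> that by (auto simp: subdivisions_def)
  have finF: "finite F" using F(3) by (metis card.infinite zero_less_card_finite less_irrefl)
  have fin: "finite V" "finite W" using cells VW(1,2) finite_subset by blast+
  obtain a :: "(real, 'd) vec" and b q where q: "q \<noteq> 0" "degree q \<le> CARD('d)"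
    and qV: "\<And>v. v \<in> V \<Longrightarrow> poly q (real v) \<le> 0" and qW: "\<And>w. w \<in> W \<Longrightarrow> 0 \<le> poly q (real w)"
    using subdivision_separation[where 'd = 'd, OF n \<delta> VW] by metis
  have zero: "poly q (real v) = 0" if "v \<in> F" for v using qV[of v] qW[of v] F that by force
  define c where "c = coeff q CARD('d)"
  \<comment> \<open>Subtracting the leading term leaves degree below \<open>d\<close> but the
    \<open>d\<close> roots \<open>F\<close>, so \<open>r = 0\<close> and \<open>q\<close> is a
    multiple of \<open>node_poly F\<close>.\<close>
  define r where "r = q - smult c (node_poly F)"
  have "r = 0"
  proof (rule ccontr)
    assume "r \<noteq> 0"
    have "degree r \<le> CARD('d)"
      unfolding r_def by (intro degree_diff_le) (use q(2) finF F(3) in \<open>auto simp: degree_node_poly\<close>)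
    moreover have "coeff r CARD('d) = 0"
      using lead_coeff_node_poly[OF finF] F(3) by (simp add: r_def c_def)
    ultimately have "degree r \<le> CARD('d) - 1"
      using \<open>r \<noteq> 0\<close> leading_coeff_neq_0[of r] by (cases "degree r = CARD('d)") auto
    then have "card F \<le> CARD('d) - 1"
      by (intro card_real_roots_le[OF \<open>r \<noteq> 0\<close>]) (use zero finF in \<open>auto simp: r_def poly_node_poly_eq_0\<close>)
    then show False using F(3) zero_less_card_finite[where 'a = 'd] by linarith
  qed
  then have q_eq: "poly q x = c * poly (node_poly F) x" for x by (simp add: r_def)
  have "c \<noteq> 0" using q(1) \<open>r = 0\<close> by (auto simp: r_def)
  have nz: "poly (node_poly F) (real v) \<noteq> 0" if "v \<notin> F" for v
    using that finF by (simp add: poly_node_poly_eq_0)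
  have sgnV: "c * poly (node_poly F) (real v) < 0" if "v \<in> V - F" for v
    using qV[of v] q_eq[of "real v"] nz[of v] \<open>c \<noteq> 0\<close> that by (simp add: order_less_le)
  have sgnW: "0 < c * poly (node_poly F) (real v)" if "v \<in> W - F" for v
    using qW[of v] q_eq[of "real v"] nz[of v] \<open>c \<noteq> 0\<close> that by (simp add: order_less_le)
  show ?thesis
  proof (cases "0 < c")
    case True
    then have "F \<in> signed_facets 1 CARD('d) V" "F \<in> signed_facets (- 1) CARD('d) W"
      using sgnV sgnW F by (auto simp: signed_facets_def mult_less_0_iff zero_less_mult_iff)
    then show ?thesis using signed_facets[OF fin(1)] signed_facets[OF fin(2)] by simp
  next
    case False
    then have "F \<in> signed_facets (- 1) CARD('d) V" "F \<in> signed_facets 1 CARD('d) W"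
      using sgnV sgnW F by (auto simp: signed_facets_def mult_less_0_iff zero_less_mult_iff)
    then show ?thesis using signed_facets[OF fin(1)] signed_facets[OF fin(2)] by simp
  qed
qed

text \<open>A generic point of \<open>W\<close> lies in one cell of the finer subdivision. The
  coarse cell around that cell contains the point as well and is therefore \<open>W\<close>.\<close>

lemma subdivision_refinement_sum:
  assumes n: "CARD('d::{finite,linorder}) + 1 \<le> n"
    and \<delta>: "\<delta> \<in> subdivisions CARD('d) n" and \<delta>': "\<delta>' \<in> subdivisions CARD('d) n"
    and le: "refinement_of \<delta> \<delta>'" and W: "W \<in> \<delta>'"
  shows "(\<Sum>X\<in>{X\<in>\<delta>. X \<subseteq> W}. bdry CARD('d) X F) = bdry CARD('d) W F"
proof -
  let ?A = "{X\<in>\<delta>. X \<subseteq> W}"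
  have cells: "V \<subseteq> {1..n}" "CARD('d) + 1 \<le> card V" if "V \<in> \<delta> \<union> \<delta>'" for V
    using \<delta> \<delta>' that by (auto simp: subdivisions_def)
  have finA: "finite ?A" using cells_finite[of \<delta> n] cells by auto
  have count: "(\<Sum>X\<in>?A. of_bool (x \<in> cyclic_hull X) :: int) = of_bool (x \<in> cyclic_hull W)"
    if x: "generic n x" for x :: "(real, 'd) vec"
  proof (cases "x \<in> cyclic_hull W")
    case True
    then have "x \<in> cyclic_hull {1..n}" using cyclic_hull_mono[of W "{1..n}"] cells W by blast
    then obtain X where X: "X \<in> \<delta>" "x \<in> cyclic_hull X" using subdivision_generic_cells(1)[OF n \<delta> x] by blast
    obtain W' where W': "W' \<in> \<delta>'" "X \<subseteq> W'" using le X(1) by (auto simp: refinement_of_def)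
    have "x \<in> cyclic_hull W'" using X(2) cyclic_hull_mono[OF W'(2)] by blast
    then have "W' = W" using subdivision_generic_cells(2)[OF n \<delta>' x W'(1) W _ True] by blast
    then have XA: "X \<in> ?A" using X W' by blast
    have "(\<Sum>Y\<in>?A. of_bool (x \<in> cyclic_hull Y) :: int) = (\<Sum>Y\<in>?A. if Y = X then 1 else 0)"
    proof (rule sum.cong)
      fix Y assume "Y \<in> ?A"
      then have "x \<in> cyclic_hull Y \<longleftrightarrow> Y = X"
        using subdivision_generic_cells(2)[OF n \<delta> x, of Y X] X by blast
      then show "of_bool (x \<in> cyclic_hull Y) = (if Y = X then 1 else 0 :: int)" by simp
    qed simp
    then show ?thesis using True XA finA by simp
  next
    case False
    then have "x \<notin> cyclic_hull X" if "X \<in> ?A" for X using cyclic_hull_mono[of X W] that by blast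
    then have "(\<Sum>X\<in>?A. of_bool (x \<in> cyclic_hull X) :: int) = 0" by (intro sum.neutral) auto
    then show ?thesis using False by simp
  qed
  have "(\<Sum>X\<in>?A. bdry CARD('d) X F) - bdry CARD('d) W F = 0"
  proof (cases "F \<in> ridges CARD('d) n")
    case True
    show ?thesis
    proof (rule hits_independent[where 'd = 'd and n = n, OF _ True])
      fix x :: "(real, 'd) vec" assume x: "generic n x"
      have "(\<Sum>F\<in>ridges CARD('d) n. ((\<Sum>V\<in>?A. bdry CARD('d) V F) - bdry CARD('d) W F) * of_bool (hits F x))
        = (\<Sum>F\<in>ridges CARD('d) n. \<Sum>V\<in>?A. bdry CARD('d) V F * of_bool (hits F x))
          - (\<Sum>F\<in>ridges CARD('d) n. bdry CARD('d) W F * of_bool (hits F x))"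
        by (simp only: left_diff_distrib sum_subtractf sum_distrib_right)
      also have "\<dots> = (\<Sum>V\<in>?A. of_bool (x \<in> cyclic_hull V)) - of_bool (x \<in> cyclic_hull W)"
        using indicator_eq_sum_bdry[OF _ _ x] cells W by (subst sum.swap) simp
      finally show "(\<Sum>F\<in>ridges CARD('d) n. ((\<Sum>V\<in>?A. bdry CARD('d) V F) - bdry CARD('d) W F)
          * of_bool (hits F x)) = 0"
        using count[OF x] by simp
    qed
  next
    case False
    have "bdry CARD('d) V F = 0" if "V \<subseteq> {1..n}" for V
      by (rule bdry_eq_0) (use False that in auto)
    then show ?thesis using cells W by (simp add: sum.neutral)
  qed
  then show ?thesis by simp
qed

definition num_above :: "nat set \<Rightarrow> nat \<Rightarrow> nat" where
  "num_above F v = card {u \<in> F. v < u}"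

definition parity_facets :: "bool \<Rightarrow> nat \<Rightarrow> nat set \<Rightarrow> nat set set" where
  "parity_facets e d V = {F. F \<subseteq> V \<and> card F = d \<and> (\<forall>v\<in>V - F. even (num_above F v) = e)}"

lemma lower_facets_parity: "lower_facets d V = parity_facets True d V"
  and upper_facets_parity: "upper_facets d V = parity_facets False d V"
  by (auto simp: lower_facets_def upper_facets_def parity_facets_def num_above_def)

lemma upper_lower_disjoint:
  assumes "finite V" "d < card V"
  shows "upper_facets d V \<inter> lower_facets d V = {}"
proof -
  have False if "F \<in> upper_facets d V" "F \<in> lower_facets d V" for F
  proof -
    have "F \<subseteq> V" "card F = d" using that by (auto simp: upper_facets_def)
    then obtain v where "v \<in> V - F" using assms by (metis Diff_eq_empty_iff card_mono ex_in_conv finite_subset leD)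
    then show False using that by (auto simp: upper_facets_def lower_facets_def)
  qed
  then show ?thesis by blast
qed

text \<open>For \<open>V = F\<close> both parity conditions hold vacuously and the two terms cancel.
  Cells that become degenerate under the slide thus drop out of all signed sums.\<close>

lemma bdry_card_le:
  assumes "finite V" "card V \<le> d"
  shows "bdry d V F = 0"
proof (cases "F \<subseteq> V \<and> card F = d")
  case True
  then have "F = V" using assms card_seteq by metis
  then show ?thesis using True by (simp add: bdry_def upper_facets_def lower_facets_def)
qed (simp add: bdry_eq_0)

section \<open>The boundary of a cell is a cycle\<close>

text \<open>The condition on \<open>u\<close> says that \<open>s\<close> is true before
  \<open>u\<close> and false after it. If there is such a \<open>u\<close>, the possible ones are
  the last true and the first false element; their signs cancel unless one of the two is
  missing.\<close>

lemma alternating_sum_telescope: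
  fixes s :: "'a::linorder \<Rightarrow> bool"
  assumes "finite T"
  shows "(\<Sum>u\<in>T. (if s u then 1 else -1) * of_bool ((\<forall>v\<in>T. v < u \<longrightarrow> s v) \<and> (\<forall>v\<in>T. u < v \<longrightarrow> \<not> s v)))
    = (of_bool (\<forall>v\<in>T. s v) - of_bool (\<forall>v\<in>T. \<not> s v) :: int)"
  using assms
proof (induction T rule: finite_linorder_max_induct)
  case (insert b T)
  let ?P = "\<lambda>T u. (\<forall>v\<in>T. v < u \<longrightarrow> s v) \<and> (\<forall>v\<in>T. u < v \<longrightarrow> \<not> s v)"
  have "b \<notin> T" using insert.hyps by blast
  have "(\<Sum>u\<in>T. (if s u then 1 else -1) * of_bool (?P (insert b T) u))
      = (\<Sum>u\<in>T. (if s u then 1 else -1) * of_bool (?P T u) * of_bool (\<not> s b) :: int)"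
    using insert.hyps(2) by (intro sum.cong) (auto dest: less_asym)
  also have "\<dots> = (of_bool (\<forall>v\<in>T. s v) - of_bool (\<forall>v\<in>T. \<not> s v)) * of_bool (\<not> s b)"
    unfolding sum_distrib_right[symmetric] insert.IH ..
  finally have IH': "(\<Sum>u\<in>T. (if s u then 1 else -1) * of_bool (?P (insert b T) u))
      = (of_bool (\<forall>v\<in>T. s v) - of_bool (\<forall>v\<in>T. \<not> s v)) * (of_bool (\<not> s b) :: int)" .
  have "(\<Sum>u\<in>insert b T. (if s u then 1 else -1) * of_bool (?P (insert b T) u))
      = (if s b then 1 else -1) * of_bool (?P (insert b T) b)
        + (of_bool (\<forall>v\<in>T. s v) - of_bool (\<forall>v\<in>T. \<not> s v)) * (of_bool (\<not> s b) :: int)"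
    unfolding sum.insert[OF insert.hyps(1) \<open>b \<notin> T\<close>] IH' ..
  moreover have "?P (insert b T) b \<longleftrightarrow> (\<forall>v\<in>T. s v)" using insert.hyps(2) by (auto dest: less_asym)
  ultimately show ?case by auto
qed simp

text \<open>Adding \<open>u\<close> to \<open>H\<close> flips the parity at all smaller vertices, so
  \<open>insert u H\<close> is a facet exactly if the parity pattern of \<open>H\<close> switches at
  \<open>u\<close>. Upper and lower facets need opposite switches, and the two telescoping sums are
  negatives of each other.\<close>

lemma bdry_cycle:
  assumes V: "finite V" and H: "Suc (card H) = d" "finite H"
  shows "(\<Sum>u\<in>V - H. (-1) ^ num_above H u * bdry d V (insert u H)) = 0"
proof (cases "H \<subseteq> V")
  case True
  define T where "T = V - H"
  have finT: "finite T" using V by (simp add: T_def)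
  let ?s = "\<lambda>u. even (num_above H u)"
  have ab: "num_above (insert u H) v = num_above H v + (if v < u then 1 else 0)" if "u \<in> T" for u v
  proof -
    have "{w \<in> insert u H. v < w} = (if v < u then insert u {w \<in> H. v < w} else {w \<in> H. v < w})" by auto
    then show ?thesis using that H(2) by (simp add: num_above_def T_def)
  qed
  have mem: "insert u H \<in> parity_facets e d V \<longleftrightarrow>
      (\<forall>v\<in>T. v < u \<longrightarrow> ?s v \<noteq> e) \<and> (\<forall>v\<in>T. u < v \<longrightarrow> ?s v = e)" if u: "u \<in> T" for u e
  proof -
    have "V - insert u H = T - {u}" by (auto simp: T_def)
    moreover have "insert u H \<subseteq> V" "card (insert u H) = d" using True u H by (auto simp: T_def)
    ultimately have "insert u H \<in> parity_facets e d V \<longleftrightarrow> (\<forall>v\<in>T - {u}. even (num_above (insert u H) v) = e)"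
      by (simp add: parity_facets_def)
    also have "\<dots> \<longleftrightarrow> (\<forall>v\<in>T - {u}. (v < u \<longrightarrow> ?s v \<noteq> e) \<and> (u < v \<longrightarrow> ?s v = e))"
      using ab[OF u] by (intro ball_cong) auto
    finally show ?thesis by blast
  qed
  have "(\<Sum>u\<in>T. (-1) ^ num_above H u * bdry d V (insert u H))
      = (\<Sum>u\<in>T. (if ?s u then 1 else -1) * of_bool ((\<forall>v\<in>T. v < u \<longrightarrow> ?s v) \<and> (\<forall>v\<in>T. u < v \<longrightarrow> \<not> ?s v)))
      + (\<Sum>u\<in>T. (if \<not> ?s u then 1 else -1) * of_bool ((\<forall>v\<in>T. v < u \<longrightarrow> \<not> ?s v) \<and> (\<forall>v\<in>T. u < v \<longrightarrow> \<not> \<not> ?s v)) :: int)"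
    unfolding sum.distrib[symmetric]
    by (rule sum.cong) (auto simp: bdry_def upper_facets_parity lower_facets_parity mem)
  also have "\<dots> = 0"
    unfolding alternating_sum_telescope[OF finT, of ?s] alternating_sum_telescope[OF finT, of "\<lambda>u. \<not> ?s u"]
    by simp
  finally show ?thesis by (simp add: T_def)
next
  case False
  then have "bdry d V (insert u H) = 0" for u by (intro bdry_eq_0) auto
  then show ?thesis by simp
qed

section \<open>Sliding the last vertex onto its predecessor\<close>

definition slide :: "nat \<Rightarrow> nat set \<Rightarrow> nat set" where
  "slide m V = (if Suc m \<in> V then insert m (V - {Suc m}) else V)"

definition lift :: "nat \<Rightarrow> nat set \<Rightarrow> nat set" where
  "lift m X = insert (Suc m) (X - {m})"

text \<open>Gale's condition with \<open>m\<close> and \<open>m + 1\<close> left out of account: the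
  part that the slide does not touch. The parity lemmas below add what it demands of these two
  vertices.\<close>

definition core_facet :: "bool \<Rightarrow> nat \<Rightarrow> nat \<Rightarrow> nat set \<Rightarrow> nat set \<Rightarrow> bool" where
  "core_facet e d m V G \<longleftrightarrow> G - {m} \<subseteq> V \<and> card G = d \<and> (\<forall>v\<in>V - G - {m, Suc m}. even (num_above G v) = e)"

lemma slide_id: "X \<subseteq> {1..m} \<Longrightarrow> slide m X = X"
  by (auto simp: slide_def)

lemma slide_insert: "X \<subseteq> {1..m} \<Longrightarrow> m \<in> X \<Longrightarrow> slide m (insert (Suc m) X) = X"
  by (auto simp: slide_def)

lemma slide_lift: "X \<subseteq> {1..m} \<Longrightarrow> m \<in> X \<Longrightarrow> slide m (lift m X) = X"
  by (auto simp: slide_def lift_def)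

lemma slide_subset: "V \<subseteq> {1..Suc m} \<Longrightarrow> 1 \<le> m \<Longrightarrow> slide m V \<subseteq> {1..m}"
  by (auto simp: slide_def le_Suc_eq)

lemma num_above_eq_0:
  assumes "G \<subseteq> {1..m}" "m \<le> v"
  shows "num_above G v = 0"
proof -
  have "{u \<in> G. v < u} = {}" using assms by auto
  then show ?thesis by (simp only: num_above_def card.empty)
qed

lemma num_above_lift:
  assumes "G \<subseteq> {1..m}" "m \<in> G" "v < m"
  shows "num_above (lift m G) v = num_above G v"
proof -
  have fin: "finite {u \<in> G. v < u}" using assms(1) finite_subset[OF _ finite_atLeastAtMost[of 1 m]] by auto
  have "{u \<in> lift m G. v < u} = insert (Suc m) ({u \<in> G. v < u} - {m})" using assms by (auto simp: lift_def)
  moreover have "Suc m \<notin> {u \<in> G. v < u} - {m}" "m \<in> {u \<in> G. v < u}" using assms by auto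
  ultimately show ?thesis
    using fin card_Suc_Diff1[of "{u \<in> G. v < u}" m] unfolding num_above_def by simp
qed

context
  fixes m :: nat and V G :: "nat set"
  assumes V: "V \<subseteq> {1..Suc m}" and G: "G \<subseteq> {1..m}"
begin

lemma Suc_notin_G: "Suc m \<notin> G" using G by auto

lemma V_diff: "v \<in> V \<Longrightarrow> v \<noteq> m \<Longrightarrow> v \<noteq> Suc m \<Longrightarrow> v < m" using V by fastforce

lemma parity_facet_without:
  assumes "m \<notin> G"
  shows "G \<in> parity_facets e d V \<longleftrightarrow> core_facet e d m V G \<and> (m \<in> V \<or> Suc m \<in> V \<longrightarrow> e)"
proof -
  have miss: "V - G = (V - G - {m, Suc m}) \<union> (V \<inter> {m, Suc m})" using assms Suc_notin_G by auto
  have "(\<forall>v\<in>V \<inter> {m, Suc m}. even (num_above G v) = e) \<longleftrightarrow> (m \<in> V \<or> Suc m \<in> V \<longrightarrow> e)"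
    using num_above_eq_0[OF G, of m] num_above_eq_0[OF G, of "Suc m"]
    by (cases "m \<in> V"; cases "Suc m \<in> V") auto
  moreover have "G - {m} = G" using assms by auto
  ultimately show ?thesis
    unfolding parity_facets_def core_facet_def mem_Collect_eq by (subst miss) (auto simp: ball_Un)
qed

lemma parity_facet_with:
  assumes "m \<in> G"
  shows "G \<in> parity_facets e d V \<longleftrightarrow> m \<in> V \<and> (Suc m \<in> V \<longrightarrow> e) \<and> core_facet e d m V G"
proof -
  have miss: "V - G = (V - G - {m, Suc m}) \<union> (V \<inter> {Suc m})" using assms Suc_notin_G by auto
  have "(\<forall>v\<in>V \<inter> {Suc m}. even (num_above G v) = e) \<longleftrightarrow> (Suc m \<in> V \<longrightarrow> e)"
    using num_above_eq_0[OF G, of "Suc m"] by auto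
  moreover have "G \<subseteq> V \<longleftrightarrow> m \<in> V \<and> G - {m} \<subseteq> V" using assms by auto
  ultimately show ?thesis
    unfolding parity_facets_def core_facet_def mem_Collect_eq by (subst miss) (auto simp: ball_Un)
qed

lemma parity_facet_lift:
  assumes "m \<in> G"
  shows "lift m G \<in> parity_facets e d V \<longleftrightarrow> Suc m \<in> V \<and> (m \<in> V \<longrightarrow> \<not> e) \<and> core_facet e d m V G"
proof -
  have finG: "finite G" using G finite_subset by blast
  have card: "card (lift m G) = card G"
    using finG assms Suc_notin_G card_Suc_Diff1[OF finG assms] by (simp add: lift_def)
  have "{u \<in> lift m G. m < u} = {Suc m}" using G by (auto simp: lift_def)
  then have abm: "num_above (lift m G) m = 1" by (simp add: num_above_def)
  have ab: "num_above (lift m G) v = num_above G v" if "v \<in> V - G - {m, Suc m}" for v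
    using num_above_lift[OF G assms, of v] V_diff[of v] that by blast
  have sub: "lift m G \<subseteq> V \<longleftrightarrow> Suc m \<in> V \<and> G - {m} \<subseteq> V" by (auto simp: lift_def)
  have miss: "V - lift m G = (V - G - {m, Suc m}) \<union> (V \<inter> {m})"
    using Suc_notin_G assms by (auto simp: lift_def)
  have "(\<forall>v\<in>V - G - {m, Suc m}. even (num_above (lift m G) v) = e)
      \<longleftrightarrow> (\<forall>v\<in>V - G - {m, Suc m}. even (num_above G v) = e)"
    using ab by (intro ball_cong) auto
  moreover have "(\<forall>v\<in>V \<inter> {m}. even (num_above (lift m G) v) = e) \<longleftrightarrow> (m \<in> V \<longrightarrow> \<not> e)"
    using abm by auto
  ultimately show ?thesis
    unfolding parity_facets_def core_facet_def mem_Collect_eq card sub miss ball_Un by auto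
qed

lemma core_facet_slide: "core_facet e d m (slide m V) G \<longleftrightarrow> core_facet e d m V G"
  using Suc_notin_G by (auto simp: core_facet_def slide_def)

end

text \<open>If \<open>V\<close> has both vertices, its facets through \<open>m\<close> alone are
  lower and those through \<open>m + 1\<close> alone are upper; otherwise only one kind occurs. So
  each facet of the slid cell through \<open>m\<close> comes from exactly one of the two
  terms.\<close>

lemma bdry_slide:
  assumes V: "V \<subseteq> {1..Suc m}" and m: "1 \<le> m" and G: "G \<subseteq> {1..m}"
  shows "bdry d (slide m V) G = bdry d V G + (if m \<in> G then bdry d V (lift m G) else 0)"
proof -
  have sV: "slide m V \<subseteq> {1..Suc m}" using slide_subset[OF V m] by auto
  have [simp]: "m \<in> slide m V \<longleftrightarrow> m \<in> V \<or> Suc m \<in> V" "Suc m \<notin> slide m V" by (auto simp: slide_def)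
  show ?thesis
    unfolding bdry_def upper_facets_parity lower_facets_parity
    by (cases "m \<in> G")
      (auto simp: parity_facet_without[OF V G] parity_facet_without[OF sV G] parity_facet_with[OF V G]
        parity_facet_with[OF sV G] parity_facet_lift[OF V G] core_facet_slide[OF V G])
qed

lemma slide_all: "1 \<le> m \<Longrightarrow> slide m {1..Suc m} = {1..m}"
  by (auto simp: slide_def le_Suc_eq)

text \<open>Over \<open>H = G - {m + 1}\<close> only \<open>u = m + 1\<close> restores both ends of
  the edge, so nothing can cancel \<open>E G\<close>.\<close>

lemma cycle_supported_on_edge_eq_0:
  fixes E :: "nat set \<Rightarrow> int"
  assumes supp: "\<And>G. E G \<noteq> 0 \<Longrightarrow> G \<subseteq> {1..Suc m} \<and> card G = d \<and> m \<in> G \<and> Suc m \<in> G"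
    and cycle: "\<And>H. finite H \<Longrightarrow> Suc (card H) = d \<Longrightarrow>
      (\<Sum>u\<in>{1..Suc m} - H. (-1) ^ num_above H u * E (insert u H)) = 0"
  shows "E G = 0"
proof (rule ccontr)
  assume nz: "E G \<noteq> 0"
  note G = supp[OF nz]
  have finG: "finite G" using G finite_subset by auto
  let ?H = "G - {Suc m}"
  have "Suc (card ?H) = d" using G finG card_Suc_Diff1[of G "Suc m"] by simp
  then have "(\<Sum>u\<in>{1..Suc m} - ?H. (-1) ^ num_above ?H u * E (insert u ?H)) = 0"
    using cycle[of ?H] finG by simp
  moreover have "E (insert u ?H) = 0" if "u \<in> {1..Suc m} - ?H - {Suc m}" for u
    using supp[of "insert u ?H"] that by auto
  then have "(\<Sum>u\<in>{1..Suc m} - ?H. (-1) ^ num_above ?H u * E (insert u ?H))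
      = (\<Sum>u\<in>{Suc m}. (-1) ^ num_above ?H u * E (insert u ?H))"
    by (intro sum.mono_neutral_right) auto
  ultimately have "E (insert (Suc m) ?H) = 0" by simp
  then show False using nz G by (simp add: insert_absorb)
qed

text \<open>The bound on the cardinality discards cells that collapse onto a ridge;
  \<open>walls\<close> recovers them.\<close>

definition slide_cells :: "nat \<Rightarrow> nat \<Rightarrow> nat set set \<Rightarrow> nat set set" where
  "slide_cells d m \<delta> = slide m ` {V \<in> \<delta>. d + 1 \<le> card (slide m V)}"

text \<open>On a cell of the slide that contains \<open>m\<close>, the default 2 means that
  \<open>lift m X\<close> belongs to the decomposition.\<close>

definition label :: "nat \<Rightarrow> nat set set \<Rightarrow> nat set \<Rightarrow> nat" where
  "label m \<delta> X = (if X \<in> \<delta> then 0 else if insert (Suc m) X \<in> \<delta> then 1 else 2)"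

definition relabel :: "nat \<Rightarrow> (nat set \<Rightarrow> nat) \<Rightarrow> nat set \<Rightarrow> nat set" where
  "relabel m l X = (if m \<notin> X \<or> l X = 0 then X else if l X = 1 then insert (Suc m) X else lift m X)"

text \<open>The ridges at which a gap opens when the slide is undone: the cell below
  \<open>F\<close> stays at \<open>m\<close>, the cell above it moves to \<open>m + 1\<close>, and
  the simplex on \<open>F\<close> and \<open>m + 1\<close> fills the gap. On the boundary of the
  polytope the missing neighbour counts as having the required label.\<close>

definition walls :: "nat \<Rightarrow> nat \<Rightarrow> nat set set \<Rightarrow> (nat set \<Rightarrow> nat) \<Rightarrow> nat set set" where
  "walls d m r l = {F. F \<subseteq> {1..m} \<and> card F = d \<and> m \<in> F \<and>
     (F \<in> lower_facets d {1..m} \<or> (\<exists>X\<in>r. F \<in> upper_facets d X \<and> l X = 0)) \<and>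
     (F \<in> upper_facets d {1..m} \<or> (\<exists>X\<in>r. F \<in> lower_facets d X \<and> l X = 2))}"

definition unslide :: "nat \<Rightarrow> nat \<Rightarrow> nat set set \<Rightarrow> (nat set \<Rightarrow> nat) \<Rightarrow> nat set set" where
  "unslide d m r l = relabel m l ` r \<union> insert (Suc m) ` walls d m r l"

text \<open>The labels of the cells around the vertex \<open>m\<close> say which of the vertices \<open>m\<close> (0), \<open>m + 1\<close> (2)
  or both (1) the cell has before the slide.\<close>
definition valid_labels :: "nat \<Rightarrow> nat \<Rightarrow> nat set set \<Rightarrow> (nat set \<Rightarrow> nat) \<Rightarrow> bool" where
  "valid_labels d m r l \<longleftrightarrow> (\<forall>X\<in>r. m \<in> X \<longrightarrow> l X \<in> {0, 1, 2}) \<and>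
     (\<forall>X\<in>r. \<forall>Y\<in>r. \<forall>F. m \<in> F \<longrightarrow> F \<in> upper_facets d X \<longrightarrow> F \<in> lower_facets d Y \<longrightarrow> l X = 0 \<or> l Y = 2)"

text \<open>The geometric input, separated from the rest: from here on \<open>d\<close> is a number
  and not the size of a type, and all arguments are about facets and signs.\<close>

locale cyclic_subdivisions =
  fixes d :: nat
  assumes d_pos: "1 \<le> d"
    and common_facet: "d + 1 \<le> n \<Longrightarrow> \<delta> \<in> subdivisions d n \<Longrightarrow> V \<in> \<delta> \<Longrightarrow> W \<in> \<delta> \<Longrightarrow> V \<noteq> W \<Longrightarrow>
      F \<subseteq> V \<Longrightarrow> F \<subseteq> W \<Longrightarrow> card F = d \<Longrightarrow>
      F \<in> upper_facets d V \<and> F \<in> lower_facets d W \<or> F \<in> lower_facets d V \<and> F \<in> upper_facets d W"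
    and refinement_sum: "d + 1 \<le> n \<Longrightarrow> \<delta> \<in> subdivisions d n \<Longrightarrow> \<delta>' \<in> subdivisions d n \<Longrightarrow>
      refinement_of \<delta> \<delta>' \<Longrightarrow> W \<in> \<delta>' \<Longrightarrow> (\<Sum>X\<in>{X\<in>\<delta>. X \<subseteq> W}. bdry d X F) = bdry d W F"
begin

lemma cellD:
  assumes "\<delta> \<in> subdivisions d n" "V \<in> \<delta>"
  shows "V \<subseteq> {1..n}" "d + 1 \<le> card V" "finite V"
  using assms finite_subset[of V "{1..n}"] by (auto simp: subdivisions_def)

lemma finite_subdivision: "\<delta> \<in> subdivisions d n \<Longrightarrow> finite \<delta>"
  by (rule cells_finite[of _ n]) (auto simp: subdivisions_def)

lemma facets_disjoint:
  assumes "\<delta> \<in> subdivisions d n" "V \<in> \<delta>" "F \<in> upper_facets d V" "F \<in> lower_facets d V"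
  shows False
  using upper_lower_disjoint[of V d] cellD[OF assms(1,2)] assms(3,4) by auto

lemma upper_facet_unique:
  assumes n: "d + 1 \<le> n" and "\<delta> \<in> subdivisions d n" "V \<in> \<delta>" "W \<in> \<delta>"
    and F: "F \<in> upper_facets d V" "F \<in> upper_facets d W"
  shows "V = W"
proof (rule ccontr)
  assume "V \<noteq> W"
  moreover have "F \<subseteq> V" "F \<subseteq> W" "card F = d" using F by (auto simp: upper_facets_def)
  ultimately show False
    using common_facet[OF assms(1-4)] facets_disjoint[OF assms(2)] assms(3,4) F by blast
qed

lemma lower_facet_unique:
  assumes n: "d + 1 \<le> n" and "\<delta> \<in> subdivisions d n" "V \<in> \<delta>" "W \<in> \<delta>"
    and F: "F \<in> lower_facets d V" "F \<in> lower_facets d W"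
  shows "V = W"
proof (rule ccontr)
  assume "V \<noteq> W"
  moreover have "F \<subseteq> V" "F \<subseteq> W" "card F = d" using F by (auto simp: lower_facets_def)
  ultimately show False
    using common_facet[OF assms(1-4)] facets_disjoint[OF assms(2)] assms(3,4) F by blast
qed

text \<open>A ridge inside \<open>Y\<close> has distinct cells on opposite sides, but a further
  vertex of \<open>Y\<close> belongs to both.\<close>

lemma cells_share_little:
  assumes n: "d + 1 \<le> n" and \<delta>: "\<delta> \<in> subdivisions d n" "V \<in> \<delta>" "W \<in> \<delta>" and Y: "Y \<subseteq> V" "Y \<subseteq> W" "d + 1 \<le> card Y"
  shows "V = W"
proof (rule ccontr)
  assume "V \<noteq> W"
  obtain F where F: "F \<subseteq> Y" "card F = d" using Y(3) by (metis Suc_eq_plus1 Suc_leD obtain_subset_with_card_n)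
  have "finite Y" using Y(3) card.infinite by fastforce
  then have "\<not> Y \<subseteq> F" using F Y(3) card_mono[of F Y] finite_subset[OF F(1)] by auto
  then obtain y where y: "y \<in> Y" "y \<notin> F" by blast
  have "F \<in> upper_facets d V \<and> F \<in> lower_facets d W \<or> F \<in> lower_facets d V \<and> F \<in> upper_facets d W"
    using common_facet[OF n \<delta> \<open>V \<noteq> W\<close>] F Y by blast
  moreover have "y \<in> V - F" "y \<in> W - F" using y Y by auto
  ultimately show False unfolding upper_facets_def lower_facets_def by blast
qed

lemma sum_at_most_one:
  assumes "finite A" "\<And>x y. x \<in> A \<Longrightarrow> y \<in> A \<Longrightarrow> P x \<Longrightarrow> P y \<Longrightarrow> x = y"
  shows "(\<Sum>x\<in>A. of_bool (P x) :: int) = of_bool (\<exists>x\<in>A. P x)"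
proof (cases "\<exists>x\<in>A. P x")
  case True
  then obtain a where a: "a \<in> A" "P a" by blast
  have "(\<Sum>x\<in>A. of_bool (P x) :: int) = (\<Sum>x\<in>A. if x = a then 1 else 0)"
    by (rule sum.cong) (use a assms(2) in auto)
  then show ?thesis using True a assms(1) by simp
qed (simp add: sum.neutral)

lemma facet_balance:
  assumes n: "d + 1 \<le> n" and \<delta>: "\<delta> \<in> subdivisions d n"
  shows "(of_bool (\<exists>X\<in>\<delta>. F \<in> upper_facets d X) - of_bool (\<exists>X\<in>\<delta>. F \<in> lower_facets d X) :: int)
    = bdry d {1..n} F"
proof -
  note fin = finite_subdivision[OF \<delta>]
  have "bdry d {1..n} F = (\<Sum>V\<in>\<delta>. bdry d V F)" using \<delta> by (simp add: subdivisions_def)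
  also have "\<dots> = (\<Sum>V\<in>\<delta>. of_bool (F \<in> upper_facets d V)) - (\<Sum>V\<in>\<delta>. of_bool (F \<in> lower_facets d V))"
    unfolding bdry_def by (rule sum_subtractf)
  also have "(\<Sum>V\<in>\<delta>. of_bool (F \<in> upper_facets d V) :: int) = of_bool (\<exists>X\<in>\<delta>. F \<in> upper_facets d X)"
    by (rule sum_at_most_one[OF fin]) (rule upper_facet_unique[OF n \<delta>])
  also have "(\<Sum>V\<in>\<delta>. of_bool (F \<in> lower_facets d V) :: int) = of_bool (\<exists>X\<in>\<delta>. F \<in> lower_facets d X)"
    by (rule sum_at_most_one[OF fin]) (rule lower_facet_unique[OF n \<delta>])
  finally show ?thesis by simp
qed

lemma trivial_in_subdivisions: "d + 1 \<le> n \<Longrightarrow> {{1..n}} \<in> subdivisions d n"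
  by (simp add: subdivisions_def)

text \<open>Two different cells with the same slide share a ridge avoiding \<open>m\<close> and
  \<open>m + 1\<close>. Each has a vertex beyond the whole ridge, so the ridge is an upper facet of
  neither, whereas it must be one of exactly one of them.\<close>

lemma slide_inj:
  assumes m: "d + 1 \<le> m" and \<delta>: "\<delta> \<in> subdivisions d (Suc m)" "V \<in> \<delta>" "W \<in> \<delta>"
    and eq: "slide m V = slide m W" and c: "d + 1 \<le> card (slide m V)"
  shows "V = W"
proof (rule ccontr)
  assume ne: "V \<noteq> W"
  let ?X = "slide m V - {m}"
  have V: "V \<subseteq> {1..Suc m}" "W \<subseteq> {1..Suc m}" using cellD(1)[OF \<delta>(1)] \<delta>(2,3) by blast+
  have X: "?X \<subseteq> V" "?X \<subseteq> W" "?X \<subseteq> {1..m} - {m}"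
    using eq slide_subset[OF V(1)] m V by (auto simp: slide_def split: if_splits)
  have in': "m \<in> V \<or> Suc m \<in> V" "m \<in> W \<or> Suc m \<in> W"
    using eq ne by (auto simp: slide_def split: if_splits)
  have "d \<le> card ?X" using c by (cases "m \<in> slide m V") simp_all
  then obtain F where F: "F \<subseteq> ?X" "card F = d" by (metis obtain_subset_with_card_n)
  have na: "num_above F m = 0" "num_above F (Suc m) = 0"
    using num_above_eq_0[of F m m] num_above_eq_0[of F m "Suc m"] F X(3) by auto
  have "m \<notin> F" "Suc m \<notin> F" using F X(3) by auto
  then have "\<exists>v\<in>U - F. even (card {u \<in> F. v < u})" if "m \<in> U \<or> Suc m \<in> U" for U
    using that na by (auto simp: num_above_def intro: bexI[of _ m] bexI[of _ "Suc m"])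
  then have "F \<notin> upper_facets d V" "F \<notin> upper_facets d W"
    using in' by (auto simp: upper_facets_def)
  then show False using common_facet[OF _ \<delta> ne, of F] m F X by auto
qed

lemma sum_slide_cells:
  assumes m: "d + 1 \<le> m" and cells: "\<And>V. V \<in> \<delta> \<Longrightarrow> V \<subseteq> {1..Suc m}"
    and inj: "\<And>V W. V \<in> \<delta> \<Longrightarrow> W \<in> \<delta> \<Longrightarrow> slide m V = slide m W \<Longrightarrow> d + 1 \<le> card (slide m V) \<Longrightarrow> V = W"
  shows "(\<Sum>X\<in>slide_cells d m \<delta>. bdry d X G) = (\<Sum>V\<in>\<delta>. bdry d (slide m V) G)"
proof -
  have fin: "finite \<delta>" using cells_finite[of \<delta> "Suc m"] cells by blast
  have "(\<Sum>X\<in>slide_cells d m \<delta>. bdry d X G) = (\<Sum>V\<in>{V \<in> \<delta>. d + 1 \<le> card (slide m V)}. bdry d (slide m V) G)"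
    unfolding slide_cells_def by (rule sum.reindex_cong[OF _ refl refl]) (use inj in \<open>auto simp: inj_on_def\<close>)
  also have "\<dots> = (\<Sum>V\<in>\<delta>. bdry d (slide m V) G)"
  proof (rule sum.mono_neutral_left[OF fin], blast, rule ballI)
    fix V assume V: "V \<in> \<delta> - {V \<in> \<delta>. d + 1 \<le> card (slide m V)}"
    have "finite (slide m V)"
      using slide_subset[of V m] cells[of V] m V finite_subset[of "slide m V" "{1..m}"] by auto
    then show "bdry d (slide m V) G = 0" by (rule bdry_card_le) (use V in auto)
  qed
  finally show ?thesis .
qed

lemma slide_cells_subdivision:
  assumes m: "d + 1 \<le> m" and \<delta>: "\<delta> \<in> subdivisions d (Suc m)"
  shows "slide_cells d m \<delta> \<in> subdivisions d m"
proof -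
  note cells = cellD[OF \<delta>]
  have m1: "1 \<le> m" using m by simp
  have sub: "X \<subseteq> {1..m}" "d + 1 \<le> card X" if "X \<in> slide_cells d m \<delta>" for X
    using that slide_subset[OF cells(1) m1] by (auto simp: slide_cells_def)
  have "(\<Sum>X\<in>slide_cells d m \<delta>. bdry d X G) = bdry d {1..m} G" for G
  proof (cases "G \<subseteq> {1..m}")
    case True
    have "(\<Sum>X\<in>slide_cells d m \<delta>. bdry d X G) = (\<Sum>V\<in>\<delta>. bdry d (slide m V) G)"
      by (rule sum_slide_cells[OF m cells(1) slide_inj[OF m \<delta>]])
    also have "\<dots> = (\<Sum>V\<in>\<delta>. bdry d V G + (if m \<in> G then bdry d V (lift m G) else 0))"
      by (rule sum.cong[OF refl bdry_slide[OF cells(1) m1 True]])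
    also have "\<dots> = bdry d {1..Suc m} G + (if m \<in> G then bdry d {1..Suc m} (lift m G) else 0)"
      using \<delta> by (simp add: sum.distrib subdivisions_def)
    also have "\<dots> = bdry d {1..m} G"
      using bdry_slide[OF _ m1 True, of "{1..Suc m}" d] slide_all[OF m1] by simp
    finally show ?thesis .
  next
    case False
    then have "bdry d X G = 0" if "X \<subseteq> {1..m}" for X by (intro bdry_eq_0) (use that in auto)
    then show ?thesis using sub(1) by (simp add: sum.neutral)
  qed
  then show ?thesis using sub by (auto simp: subdivisions_def)
qed

end

section \<open>Reconstructing a decomposition from its slide\<close>

context cyclic_subdivisions
begin

lemma slide_relabel: "X \<subseteq> {1..m} \<Longrightarrow> slide m (relabel m l X) = X"
  by (simp add: relabel_def slide_id slide_insert slide_lift)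

lemma relabel_subset: "X \<subseteq> {1..m} \<Longrightarrow> relabel m l X \<subseteq> {1..Suc m}"
  by (auto simp: relabel_def lift_def)

text \<open>With label 0 all facets through \<open>m\<close> stay; with label 1 the lower ones stay
  and the upper ones move to \<open>m + 1\<close>; with label 2 all move.\<close>

lemma bdry_relabel:
  assumes X: "X \<subseteq> {1..m}" and G: "G \<subseteq> {1..m}" "m \<in> G" and l: "m \<in> X \<Longrightarrow> l X \<in> {0, 1, 2}"
  shows "bdry d (relabel m l X) G
    = of_bool (G \<in> upper_facets d X \<and> l X = 0) - of_bool (G \<in> lower_facets d X \<and> l X \<noteq> 2)"
proof (cases "m \<in> X")
  case False
  then have "relabel m l X = X" by (simp add: relabel_def)
  moreover have "\<not> G \<subseteq> X" using False G by auto
  ultimately show ?thesis by (auto simp: bdry_def upper_facets_def lower_facets_def)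
next
  case True
  let ?V = "relabel m l X"
  have V: "?V \<subseteq> {1..Suc m}" by (rule relabel_subset[OF X])
  have X': "X \<subseteq> {1..Suc m}" "Suc m \<notin> X" using X by auto
  have core: "core_facet e d m ?V G = core_facet e d m X G" for e
    using core_facet_slide[OF V G(1), of e d] slide_relabel[OF X, of l] by simp
  have mem: "m \<in> ?V \<longleftrightarrow> l X \<noteq> 2" "Suc m \<in> ?V \<longleftrightarrow> l X \<noteq> 0"
    using True l[OF True] X'(2) by (auto simp: relabel_def lift_def)
  show ?thesis
    unfolding bdry_def upper_facets_parity lower_facets_parity
      parity_facet_with[OF V G] parity_facet_with[OF X'(1) G] core mem
    using True X'(2) l[OF True] by auto
qed

lemma bdry_wall:
  assumes F: "F \<subseteq> {1..m}" "card F = d" "m \<in> F" and G: "G \<subseteq> {1..m}" "card G = d" "m \<in> G"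
  shows "bdry d (insert (Suc m) F) G = - of_bool (G = F)"
proof -
  let ?V = "insert (Suc m) F"
  have V: "?V \<subseteq> {1..Suc m}" using F by auto
  have "core_facet e d m ?V G \<longleftrightarrow> G = F" for e
  proof
    assume "core_facet e d m ?V G"
    then have "G - {m} \<subseteq> ?V" by (simp add: core_facet_def)
    then have "G \<subseteq> F" using F G by auto
    then show "G = F" using F G card_subset_eq[of F G] finite_subset[OF F(1)] by auto
  qed (use G in \<open>auto simp: core_facet_def\<close>)
  then show ?thesis
    unfolding bdry_def upper_facets_parity lower_facets_parity parity_facet_with[OF V G(1,3)]
    using F by auto
qed

lemma sum_relabelled_cells:
  assumes r: "\<And>X. X \<in> r \<Longrightarrow> X \<subseteq> {1..m} \<and> d + 1 \<le> card X"
    and W: "\<And>F. F \<in> W \<Longrightarrow> F \<subseteq> {1..m} \<and> card F = d \<and> m \<in> F"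
  shows "(\<Sum>V\<in>relabel m l ` r \<union> insert (Suc m) ` W. g V)
    = (\<Sum>X\<in>r. g (relabel m l X)) + (\<Sum>F\<in>W. g (insert (Suc m) F) :: int)"
proof -
  have fin: "finite r" "finite W"
    using cells_finite[of r m] cells_finite[of W m] r W by blast+
  have "inj_on (relabel m l) r" by (rule inj_on_inverseI[of _ "slide m"]) (use r slide_relabel in blast)
  moreover have "inj_on (insert (Suc m)) W"
    by (rule inj_on_inverseI[of _ "slide m"]) (use W slide_insert in blast)
  moreover have "relabel m l ` r \<inter> insert (Suc m) ` W = {}"
  proof (rule ccontr)
    assume "\<not> ?thesis"
    then obtain X F where "X \<in> r" "F \<in> W" "relabel m l X = insert (Suc m) F" by blast
    then have "X = F" using slide_relabel[of X m l] slide_insert[of F m] r[of X] W[of F] by simp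
    then show False using r[OF \<open>X \<in> r\<close>] W[OF \<open>F \<in> W\<close>] by simp
  qed
  ultimately show ?thesis using fin by (simp add: sum.union_disjoint sum.reindex)
qed

lemma sum_relabelled_cells_with:
  assumes m: "d + 1 \<le> m" and r: "r \<in> subdivisions d m" and l: "\<And>X. X \<in> r \<Longrightarrow> m \<in> X \<Longrightarrow> l X \<in> {0, 1, 2}"
    and W: "\<And>F. F \<in> W \<Longrightarrow> F \<subseteq> {1..m} \<and> card F = d \<and> m \<in> F"
    and G: "G \<subseteq> {1..m}" "card G = d" "m \<in> G"
  shows "(\<Sum>V\<in>relabel m l ` r \<union> insert (Suc m) ` W. bdry d V G)
    = of_bool (\<exists>X\<in>r. G \<in> upper_facets d X \<and> l X = 0)
      - of_bool (\<exists>X\<in>r. G \<in> lower_facets d X \<and> l X \<noteq> 2) - of_bool (G \<in> W)"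
proof -
  note cells = cellD[OF r]
  have finr: "finite r" by (rule finite_subdivision[OF r])
  have finW: "finite W" using cells_finite[of W m] W by blast
  have "(\<Sum>V\<in>relabel m l ` r \<union> insert (Suc m) ` W. bdry d V G)
      = (\<Sum>X\<in>r. bdry d (relabel m l X) G) + (\<Sum>F\<in>W. bdry d (insert (Suc m) F) G)"
    by (rule sum_relabelled_cells) (use cells W in auto)
  also have "(\<Sum>X\<in>r. bdry d (relabel m l X) G)
      = (\<Sum>X\<in>r. of_bool (G \<in> upper_facets d X \<and> l X = 0)) - (\<Sum>X\<in>r. of_bool (G \<in> lower_facets d X \<and> l X \<noteq> 2))"
    unfolding sum_subtractf[symmetric] by (rule sum.cong[OF refl bdry_relabel[OF cells(1) G(1,3) l]])
  also have "(\<Sum>X\<in>r. of_bool (G \<in> upper_facets d X \<and> l X = 0) :: int)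
      = of_bool (\<exists>X\<in>r. G \<in> upper_facets d X \<and> l X = 0)"
    by (rule sum_at_most_one[OF finr]) (use upper_facet_unique[OF m r] in blast)
  also have "(\<Sum>X\<in>r. of_bool (G \<in> lower_facets d X \<and> l X \<noteq> 2) :: int)
      = of_bool (\<exists>X\<in>r. G \<in> lower_facets d X \<and> l X \<noteq> 2)"
    by (rule sum_at_most_one[OF finr]) (use lower_facet_unique[OF m r] in blast)
  also have "(\<Sum>F\<in>W. bdry d (insert (Suc m) F) G) = (\<Sum>F\<in>W. - of_bool (F = G))"
    by (rule sum.cong) (use bdry_wall[OF _ _ _ G] W in auto)
  also have "\<dots> = - of_bool (G \<in> W)"
    using sum_at_most_one[OF finW, of "\<lambda>F. F = G"] by (simp add: sum_negf)
  finally show ?thesis by simp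
qed

lemma bdry_Suc_with:
  assumes "G \<subseteq> {1..m}" "m \<in> G"
  shows "bdry d {1..Suc m} G = - of_bool (G \<in> lower_facets d {1..m})"
proof -
  have "1 \<le> m" using assms by auto
  have sub: "{1..m} \<subseteq> {1..Suc m}" "{1..Suc m} \<subseteq> {1..Suc m}" by auto
  have "core_facet e d m {1..Suc m} G = core_facet e d m {1..m} G" for e
    using core_facet_slide[OF sub(2) assms(1), of e d] slide_all[OF \<open>1 \<le> m\<close>] by simp
  then show ?thesis
    unfolding bdry_def upper_facets_parity lower_facets_parity
      parity_facet_with[OF sub(1) assms] parity_facet_with[OF sub(2) assms]
    using \<open>1 \<le> m\<close> by auto
qed

lemma boundary_facets_disjoint:
  "d + 1 \<le> m \<Longrightarrow> F \<in> upper_facets d {1..m} \<Longrightarrow> F \<in> lower_facets d {1..m} \<Longrightarrow> False"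
  using upper_lower_disjoint[of "{1..m}" d] by auto

text \<open>Across each ridge at \<open>m\<close> the cells below and above, possibly replaced by the outside of the
  polytope, carry valid labels exactly if the ridge is covered correctly before the slide.\<close>
lemma ridge_balance:
  assumes m: "d + 1 \<le> m" and r: "r \<in> subdivisions d m" and l: "\<And>X. X \<in> r \<Longrightarrow> m \<in> X \<Longrightarrow> l X \<in> {0, 1, 2}"
    and W: "\<And>F. F \<in> W \<Longrightarrow> F \<subseteq> {1..m} \<and> card F = d \<and> m \<in> F"
    and G: "G \<subseteq> {1..m}" "card G = d" "m \<in> G"
  shows "(\<Sum>V\<in>relabel m l ` r \<union> insert (Suc m) ` W. bdry d V G) = bdry d {1..Suc m} G \<longleftrightarrow>
    (\<forall>X\<in>r. \<forall>Y\<in>r. G \<in> upper_facets d X \<longrightarrow> G \<in> lower_facets d Y \<longrightarrow> l X = 0 \<or> l Y = 2) \<and>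
    (G \<in> W \<longleftrightarrow> G \<in> walls d m r l)"
proof -
  let ?a = "\<exists>X\<in>r. G \<in> upper_facets d X" and ?b = "\<exists>X\<in>r. G \<in> lower_facets d X"
  let ?p = "\<exists>X\<in>r. G \<in> upper_facets d X \<and> l X = 0" and ?q = "\<exists>X\<in>r. G \<in> lower_facets d X \<and> l X \<noteq> 2"
  let ?s = "\<exists>X\<in>r. G \<in> lower_facets d X \<and> l X = 2"
  let ?L = "G \<in> lower_facets d {1..m}" and ?U = "G \<in> upper_facets d {1..m}"
  have balance: "(of_bool ?a - of_bool ?b :: int) = of_bool ?U - of_bool ?L"
    using facet_balance[OF m r, of G] by (simp only: bdry_def)
  have excl: "\<not> (?U \<and> ?L)" using boundary_facets_disjoint[OF m] by blast
  have pa: "?p \<Longrightarrow> ?a" and qb: "?q \<Longrightarrow> ?b" and sb: "?s \<Longrightarrow> ?b" and bqs: "?b \<Longrightarrow> ?q \<or> ?s" by blast+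
  have qs: "\<not> (?q \<and> ?s)" using lower_facet_unique[OF m r] by blast
  have wall: "G \<in> walls d m r l \<longleftrightarrow> (?L \<or> ?p) \<and> (?U \<or> ?s)" using G by (simp add: walls_def)
  have valid: "(\<forall>X\<in>r. \<forall>Y\<in>r. G \<in> upper_facets d X \<longrightarrow> G \<in> lower_facets d Y \<longrightarrow> l X = 0 \<or> l Y = 2)
      \<longleftrightarrow> (?a \<and> ?b \<longrightarrow> ?p \<or> ?s)"
    using upper_facet_unique[OF m r] lower_facet_unique[OF m r] by blast
  have sum_eq: "(\<Sum>V\<in>relabel m l ` r \<union> insert (Suc m) ` W. bdry d V G)
      = of_bool ?p - of_bool ?q - of_bool (G \<in> W)"
    by (rule sum_relabelled_cells_with[OF m r l W G])
  have "(\<Sum>V\<in>relabel m l ` r \<union> insert (Suc m) ` W. bdry d V G) = bdry d {1..Suc m} G \<longleftrightarrow>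
      of_bool ?p - of_bool ?q - of_bool (G \<in> W) = (- of_bool ?L :: int)"
    by (simp only: sum_eq bdry_Suc_with[OF G(1,3)])
  also have "\<dots> \<longleftrightarrow> (?a \<and> ?b \<longrightarrow> ?p \<or> ?s) \<and> (G \<in> W \<longleftrightarrow> (?L \<or> ?p) \<and> (?U \<or> ?s))"
  proof -
    \<comment> \<open>A truth table: \<open>a\<close> and \<open>b\<close> say that a cell lies
      below or above the ridge, \<open>p\<close> that the lower one has label 0, \<open>s\<close>
      and \<open>q\<close> that the upper one has label 2 or not, \<open>U\<close> and
      \<open>L\<close> that the ridge is on the boundary.\<close>
    have arith: "of_bool p - of_bool q - of_bool w = (- of_bool L :: int) \<longleftrightarrow>
        (a \<and> b \<longrightarrow> p \<or> s) \<and> (w \<longleftrightarrow> (L \<or> p) \<and> (U \<or> s))"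
      if "(of_bool a - of_bool b :: int) = of_bool U - of_bool L" "\<not> (U \<and> L)"
        "p \<Longrightarrow> a" "q \<Longrightarrow> b" "s \<Longrightarrow> b" "b \<Longrightarrow> q \<or> s" "\<not> (q \<and> s)" for a b p q s U L w
      using that by (cases U; cases L; cases a; cases b; simp?; cases p; cases q; cases s; cases w; simp)
    show ?thesis by (rule arith[OF balance excl pa qb sb bqs qs])
  qed
  finally show ?thesis unfolding valid wall .
qed

lemma walls_subset: "F \<in> walls d m r l \<Longrightarrow> F \<subseteq> {1..m} \<and> card F = d \<and> m \<in> F"
  by (simp add: walls_def)

lemma unslide_cells:
  assumes r: "r \<in> subdivisions d m" and V: "V \<in> unslide d m r l"
  shows "V \<subseteq> {1..Suc m}" "d + 1 \<le> card V"
proof -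
  show "V \<subseteq> {1..Suc m}"
    using V relabel_subset[OF cellD(1)[OF r], of _ l] walls_subset[of _ m r l]
    by (fastforce simp: unslide_def)
  show "d + 1 \<le> card V"
  proof (cases "V \<in> relabel m l ` r")
    case True
    then obtain X where X: "X \<in> r" "V = relabel m l X" by blast
    note X' = cellD[OF r X(1)]
    have "Suc m \<notin> X" using X'(1) by auto
    then have "card X \<le> card (relabel m l X)"
      using X'(3) card_Suc_Diff1[OF X'(3), of m] by (auto simp: relabel_def lift_def)
    then show ?thesis using X'(2) X(2) by simp
  next
    case False
    then obtain F where F: "F \<in> walls d m r l" "V = insert (Suc m) F" using V by (auto simp: unslide_def)
    then show ?thesis using walls_subset[OF F(1)] finite_subset[of F "{1..m}"] by (auto simp: card_insert_if)
  qed
qed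

text \<open>The error \<open>E\<close> vanishes on ridges with \<open>m\<close> but not
  \<open>m + 1\<close> by validity of the labels. Comparison after the slide gives the ridges
  avoiding both vertices and those with \<open>m + 1\<close> only. Ridges with both are invisible to
  the slide; there \<open>E\<close> is a cycle that must vanish.\<close>

lemma unslide_subdivision:
  assumes m: "d + 1 \<le> m" and r: "r \<in> subdivisions d m" and l: "valid_labels d m r l"
  shows "unslide d m r l \<in> subdivisions d (Suc m)"
proof -
  note cells = cellD[OF r]
  let ?\<delta> = "unslide d m r l"
  have m1: "1 \<le> m" using m by simp
  note sub = unslide_cells[OF r]
  have l012: "l X \<in> {0, 1, 2}" if "X \<in> r" "m \<in> X" for X using l that by (simp add: valid_labels_def)
  have at_m: "(\<Sum>V\<in>?\<delta>. bdry d V G) = bdry d {1..Suc m} G"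
    if G: "G \<subseteq> {1..m}" "card G = d" "m \<in> G" for G
    unfolding unslide_def
    by (subst ridge_balance[OF m r l012 walls_subset G]) (use l G(3) in \<open>auto simp: valid_labels_def\<close>)
  have slid: "(\<Sum>V\<in>?\<delta>. bdry d (slide m V) G) = bdry d {1..m} G" for G
  proof -
    have "(\<Sum>V\<in>?\<delta>. bdry d (slide m V) G) = (\<Sum>X\<in>r. bdry d (slide m (relabel m l X)) G)
        + (\<Sum>F\<in>walls d m r l. bdry d (slide m (insert (Suc m) F)) G)"
      unfolding unslide_def by (rule sum_relabelled_cells) (use cells walls_subset in auto)
    also have "(\<Sum>X\<in>r. bdry d (slide m (relabel m l X)) G) = (\<Sum>X\<in>r. bdry d X G)"
      by (rule sum.cong) (use slide_relabel[OF cells(1)] in auto)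
    also have "(\<Sum>F\<in>walls d m r l. bdry d (slide m (insert (Suc m) F)) G) = 0"
    proof (rule sum.neutral, rule ballI)
      fix F assume "F \<in> walls d m r l"
      note F = walls_subset[OF this]
      then have "finite F" using finite_subset by blast
      then show "bdry d (slide m (insert (Suc m) F)) G = 0"
        using F slide_insert[of F m] bdry_card_le[of F d G] by simp
    qed
    finally show ?thesis using r by (simp add: subdivisions_def)
  qed
  have slid2: "(\<Sum>V\<in>?\<delta>. bdry d V G) + (if m \<in> G then \<Sum>V\<in>?\<delta>. bdry d V (lift m G) else 0)
      = bdry d {1..Suc m} G + (if m \<in> G then bdry d {1..Suc m} (lift m G) else 0)"
    if G: "G \<subseteq> {1..m}" for G
  proof -
    have "(\<Sum>V\<in>?\<delta>. bdry d V G) + (if m \<in> G then \<Sum>V\<in>?\<delta>. bdry d V (lift m G) else 0)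
        = (\<Sum>V\<in>?\<delta>. bdry d V G + (if m \<in> G then bdry d V (lift m G) else 0))"
      by (simp add: sum.distrib)
    also have "\<dots> = (\<Sum>V\<in>?\<delta>. bdry d (slide m V) G)"
      by (rule sum.cong[OF refl bdry_slide[OF sub(1) m1 G, symmetric]])
    also have "\<dots> = bdry d (slide m {1..Suc m}) G" unfolding slid slide_all[OF m1] ..
    also have "\<dots> = bdry d {1..Suc m} G + (if m \<in> G then bdry d {1..Suc m} (lift m G) else 0)"
      by (rule bdry_slide[OF subset_refl m1 G])
    finally show ?thesis .
  qed
  define E where "E G = (\<Sum>V\<in>?\<delta>. bdry d V G) - bdry d {1..Suc m} G" for G
  have "E G = 0" for G
  proof (rule cycle_supported_on_edge_eq_0[where d = d and m = m])
    fix H :: "nat set" assume H: "finite H" "Suc (card H) = d"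
    have cyc: "(\<Sum>u\<in>{1..Suc m} - H. (-1) ^ num_above H u * bdry d V (insert u H)) = 0"
      if V: "V \<subseteq> {1..Suc m}" for V
    proof -
      have "bdry d V (insert u H) = 0" if "u \<notin> V" for u
        using that by (intro bdry_eq_0) auto
      then have "(\<Sum>u\<in>{1..Suc m} - H. (-1) ^ num_above H u * bdry d V (insert u H))
          = (\<Sum>u\<in>V - H. (-1) ^ num_above H u * bdry d V (insert u H))"
        using V by (intro sum.mono_neutral_right) auto
      also have "\<dots> = 0" by (rule bdry_cycle) (use V H finite_subset in auto)
      finally show ?thesis .
    qed
    have "(\<Sum>u\<in>{1..Suc m} - H. (-1) ^ num_above H u * E (insert u H))
        = (\<Sum>V\<in>?\<delta>. \<Sum>u\<in>{1..Suc m} - H. (-1) ^ num_above H u * bdry d V (insert u H))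
          - (\<Sum>u\<in>{1..Suc m} - H. (-1) ^ num_above H u * bdry d {1..Suc m} (insert u H))"
      unfolding E_def right_diff_distrib sum_subtractf sum_distrib_left by (subst sum.swap) simp
    also have "\<dots> = 0" using cyc sub(1) by (simp add: sum.neutral)
    finally show "(\<Sum>u\<in>{1..Suc m} - H. (-1) ^ num_above H u * E (insert u H)) = 0" .
  next
    fix G assume nz: "E G \<noteq> 0"
    have G: "G \<subseteq> {1..Suc m} \<and> card G = d"
    proof (rule ccontr)
      assume "\<not> ?thesis"
      then have "bdry d V G = 0" if "V \<subseteq> {1..Suc m}" for V by (intro bdry_eq_0) (use that in auto)
      then show False using nz sub(1) by (simp add: E_def sum.neutral)
    qed
    have "Suc m \<in> G"
    proof (rule ccontr)
      assume "Suc m \<notin> G"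
      then have "G \<subseteq> {1..m}" using G by (auto simp: le_Suc_eq)
      then show False using nz at_m[of G] slid2[of G] G by (cases "m \<in> G") (auto simp: E_def)
    qed
    moreover have "m \<in> G"
    proof (rule ccontr)
      assume "m \<notin> G"
      let ?G = "insert m (G - {Suc m})"
      have lift: "lift m ?G = G" using \<open>Suc m \<in> G\<close> \<open>m \<notin> G\<close> by (auto simp: lift_def)
      have G': "?G \<subseteq> {1..m}" using G m1 by (auto simp: le_Suc_eq)
      have finG: "finite G" using G finite_subset by blast
      have "card ?G = d" using G finG \<open>m \<notin> G\<close> card_Suc_Diff1[OF finG \<open>Suc m \<in> G\<close>] by simp
      then show False using nz at_m[OF G'] slid2[OF G'] lift by (simp add: E_def)
    qed
    ultimately show "G \<subseteq> {1..Suc m} \<and> card G = d \<and> m \<in> G \<and> Suc m \<in> G" using G by blast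
  qed
  then show ?thesis using sub by (auto simp: subdivisions_def E_def)
qed

lemma slide_cells_unslide:
  assumes r: "r \<in> subdivisions d m"
  shows "slide_cells d m (unslide d m r l) = r"
proof -
  note cells = cellD[OF r]
  have "X \<in> slide_cells d m (unslide d m r l) \<longleftrightarrow> X \<in> r" for X
  proof
    assume "X \<in> slide_cells d m (unslide d m r l)"
    then obtain V where V: "V \<in> unslide d m r l" "X = slide m V" "d + 1 \<le> card X"
      by (auto simp: slide_cells_def)
    have "V \<notin> insert (Suc m) ` walls d m r l"
    proof
      assume "V \<in> insert (Suc m) ` walls d m r l"
      then obtain F where "F \<in> walls d m r l" "V = insert (Suc m) F" by blast
      then have "X = F" "card F = d" using V(2) slide_insert[of F m] walls_subset[of F m r l] by auto
      then show False using V(3) by simp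
    qed
    then obtain Y where "Y \<in> r" "V = relabel m l Y" using V(1) by (auto simp: unslide_def)
    then show "X \<in> r" using V(2) slide_relabel[OF cells(1), of Y l] by simp
  next
    assume X: "X \<in> r"
    then have "slide m (relabel m l X) = X" "relabel m l X \<in> unslide d m r l"
      using slide_relabel[OF cells(1)] by (auto simp: unslide_def)
    then show "X \<in> slide_cells d m (unslide d m r l)"
      using cells(2)[OF X] by (force simp: slide_cells_def)
  qed
  then show ?thesis by blast
qed

lemma label_unslide:
  assumes r: "r \<in> subdivisions d m" and X: "X \<in> r" "m \<in> X" and l: "l X \<in> {0, 1, 2}"
  shows "label m (unslide d m r l) X = l X"
proof -
  note cells = cellD[OF r]
  have Suc_notin: "Suc m \<notin> Y" if "Y \<in> r" for Y using cells(1)[OF that] by auto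
  have key: "V \<in> unslide d m r l \<longleftrightarrow> V = relabel m l X" if V: "slide m V = X" for V
  proof
    assume "V \<in> unslide d m r l"
    then consider Y where "Y \<in> r" "V = relabel m l Y" | F where "F \<in> walls d m r l" "V = insert (Suc m) F"
      by (auto simp: unslide_def)
    then show "V = relabel m l X"
    proof cases
      case 1
      then show ?thesis using V slide_relabel[OF cells(1), of Y l] by simp
    next
      case 2
      then have "X = F" "card F = d" using V slide_insert[of F m] walls_subset[of F m r l] by auto
      then show ?thesis using cells(2)[OF X(1)] by simp
    qed
  qed (use X in \<open>auto simp: unslide_def\<close>)
  have rel: "relabel m l X = (if l X = 0 then X else if l X = 1 then insert (Suc m) X else lift m X)"
    using X(2) by (simp add: relabel_def)
  have "m \<notin> lift m X" by (simp add: lift_def)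
  then have distinct: "X \<noteq> insert (Suc m) X" "X \<noteq> lift m X" "insert (Suc m) X \<noteq> lift m X"
    using X(2) Suc_notin[OF X(1)] by blast+
  have "X \<in> unslide d m r l \<longleftrightarrow> l X = 0"
    using key[of X] slide_id[OF cells(1)[OF X(1)]] distinct rel by simp
  moreover have "insert (Suc m) X \<in> unslide d m r l \<longleftrightarrow> l X = 1"
    using key[of "insert (Suc m) X"] slide_insert[OF cells(1)[OF X(1)] X(2)] distinct rel by simp
  ultimately show ?thesis using l by (auto simp: label_def)
qed

lemma unslide_cong:
  assumes r: "r \<in> subdivisions d m" and "\<And>X. X \<in> r \<Longrightarrow> m \<in> X \<Longrightarrow> l X = l' X"
  shows "unslide d m r l = unslide d m r l'"
proof -
  have facet: "m \<in> X" if "m \<in> F" "F \<in> upper_facets d X \<or> F \<in> lower_facets d X" for F X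
    using that by (auto simp: upper_facets_def lower_facets_def)
  have "relabel m l ` r = relabel m l' ` r"
    by (rule image_cong) (use assms(2) in \<open>auto simp: relabel_def\<close>)
  moreover have "walls d m r l = walls d m r l'"
  proof -
    have *: "(\<exists>X\<in>r. F \<in> upper_facets d X \<and> l X = c) \<longleftrightarrow> (\<exists>X\<in>r. F \<in> upper_facets d X \<and> l' X = c)"
      "(\<exists>X\<in>r. F \<in> lower_facets d X \<and> l X = c) \<longleftrightarrow> (\<exists>X\<in>r. F \<in> lower_facets d X \<and> l' X = c)"
      if "m \<in> F" for F c
      using facet[OF that] assms(2) by (auto intro!: bex_cong)
    then show ?thesis unfolding walls_def by (intro Collect_cong conj_cong refl) (simp_all only: *)
  qed
  ultimately show ?thesis by (simp add: unslide_def)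
qed

theorem unslide_slide_cells:
  assumes m: "d + 1 \<le> m" and \<delta>: "\<delta> \<in> subdivisions d (Suc m)"
  shows "valid_labels d m (slide_cells d m \<delta>) (label m \<delta>)"
    and "unslide d m (slide_cells d m \<delta>) (label m \<delta>) = \<delta>"
proof -
  define r where "r = slide_cells d m \<delta>"
  define l where "l = label m \<delta>"
  note cells = cellD[OF \<delta>]
  have m1: "1 \<le> m" using m by simp
  have r: "r \<in> subdivisions d m" unfolding r_def by (rule slide_cells_subdivision[OF m \<delta>])
  have l012: "l X \<in> {0, 1, 2}" for X by (simp add: l_def label_def)
  \<comment> \<open>The cells that collapse, taken from \<open>\<delta>\<close> itself.
    \<open>ridge_balance\<close> allows an arbitrary \<open>W\<close>, and the balance on ridges
    through \<open>m\<close> then forces it to be \<open>walls d m r l\<close>.\<close>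
  define W where "W = {F. F \<subseteq> {1..m} \<and> card F = d \<and> m \<in> F \<and> insert (Suc m) F \<in> \<delta>}"
  have relab: "relabel m l (slide m V) = V" if V: "V \<in> \<delta>" "d + 1 \<le> card (slide m V)" for V
  proof -
    let ?X = "slide m V"
    have X: "?X \<subseteq> {1..m}" using slide_subset[OF cells(1)[OF V(1)] m1] .
    have eqV: "U = V" if "U \<in> \<delta>" "slide m U = ?X" for U
      using slide_inj[OF m \<delta> V(1) that(1)] that(2) V(2) by simp
    consider "Suc m \<notin> V" | "Suc m \<in> V" "m \<in> V" | "Suc m \<in> V" "m \<notin> V" by blast
    then show ?thesis
    proof cases
      case 1
      then have "?X = V" by (simp add: slide_def)
      then show ?thesis using V(1) by (auto simp: relabel_def l_def label_def)
    next
      case 2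
      then have eq: "insert (Suc m) ?X = V" "m \<in> ?X" by (auto simp: slide_def)
      have "?X \<notin> \<delta>"
      proof
        assume "?X \<in> \<delta>"
        then have "?X = V" using eqV[of ?X] slide_id[OF X] by simp
        then show False using 2 X by auto
      qed
      then show ?thesis using eq V(1) by (simp add: relabel_def l_def label_def)
    next
      case 3
      then have eq: "lift m ?X = V" "m \<in> ?X" by (auto simp: slide_def lift_def)
      have "?X \<notin> \<delta>"
      proof
        assume "?X \<in> \<delta>"
        then have "?X = V" using eqV[of ?X] slide_id[OF X] by simp
        then show False using 3 X by auto
      qed
      moreover have "insert (Suc m) ?X \<notin> \<delta>"
      proof
        assume "insert (Suc m) ?X \<in> \<delta>"
        then have "insert (Suc m) ?X = V" using eqV[of "insert (Suc m) ?X"] slide_insert[OF X eq(2)] by simp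
        then show False using 3 eq(2) by auto
      qed
      ultimately show ?thesis using eq by (simp add: relabel_def l_def label_def)
    qed
  qed
  have \<delta>_eq: "\<delta> = relabel m l ` r \<union> insert (Suc m) ` W"
  proof (rule set_eqI, rule iffI)
    fix V assume V: "V \<in> \<delta>"
    show "V \<in> relabel m l ` r \<union> insert (Suc m) ` W"
    proof (cases "d + 1 \<le> card (slide m V)")
      case True
      then have "slide m V \<in> r" using V by (auto simp: r_def slide_cells_def)
      then show ?thesis using relab[OF V True] by (metis UnI1 imageI)
    next
      case False
      let ?F = "V - {Suc m}"
      note cV = cells[OF V]
      have "Suc m \<in> V" using False cV(2) by (auto simp: slide_def split: if_splits)
      then have "Suc (card ?F) = card V" by (rule card_Suc_Diff1[OF cV(3)])
      moreover have "m \<in> V"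
      proof (rule ccontr)
        assume "m \<notin> V"
        then have "card (slide m V) = Suc (card ?F)" using \<open>Suc m \<in> V\<close> cV(3) by (simp add: slide_def)
        then show False using False cV(2) calculation by simp
      qed
      then have "slide m V = ?F" using \<open>Suc m \<in> V\<close> by (auto simp: slide_def)
      ultimately have "card ?F = d" using False cV(2) by simp
      moreover have "?F \<subseteq> {1..m}" using cV(1) by (auto simp: le_Suc_eq)
      moreover have ins: "insert (Suc m) ?F = V" using \<open>Suc m \<in> V\<close> by blast
      ultimately have "?F \<in> W" using \<open>m \<in> V\<close> V by (simp add: W_def)
      then show ?thesis using ins by (metis UnI2 imageI)
    qed
  next
    fix V assume "V \<in> relabel m l ` r \<union> insert (Suc m) ` W"
    then show "V \<in> \<delta>" using relab by (auto simp: r_def slide_cells_def W_def)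
  qed
  have W: "F \<subseteq> {1..m} \<and> card F = d \<and> m \<in> F" if "F \<in> W" for F using that by (simp add: W_def)
  have bal: "(\<forall>X\<in>r. \<forall>Y\<in>r. G \<in> upper_facets d X \<longrightarrow> G \<in> lower_facets d Y \<longrightarrow> l X = 0 \<or> l Y = 2) \<and>
    (G \<in> W \<longleftrightarrow> G \<in> walls d m r l)" if G: "G \<subseteq> {1..m}" "card G = d" "m \<in> G" for G
  proof -
    have "(\<Sum>V\<in>relabel m l ` r \<union> insert (Suc m) ` W. bdry d V G) = bdry d {1..Suc m} G"
      using \<delta> unfolding \<delta>_eq[symmetric] subdivisions_def by blast
    then show ?thesis using ridge_balance[where l = l and W = W and r = r, OF m r l012 W G] by blast
  qed
  have W_eq: "W = walls d m r l"
  proof (intro set_eqI iffI)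
    show "F \<in> walls d m r l" if "F \<in> W" for F using bal[of F] W[OF that] that by blast
    show "F \<in> W" if "F \<in> walls d m r l" for F using bal[of F] walls_subset[OF that] that by blast
  qed
  have "unslide d m r l = relabel m l ` r \<union> insert (Suc m) ` W"
    by (simp only: unslide_def W_eq[symmetric])
  also have "\<dots> = \<delta>" by (rule \<delta>_eq[symmetric])
  finally show "unslide d m (slide_cells d m \<delta>) (label m \<delta>) = \<delta>"
    by (simp only: r_def l_def)
  have "l X = 0 \<or> l Y = 2"
    if "X \<in> r" "Y \<in> r" "m \<in> F" "F \<in> upper_facets d X" "F \<in> lower_facets d Y" for X Y F
  proof -
    have "F \<subseteq> {1..m}" "card F = d"
      using that cellD(1)[OF r that(1)] by (auto simp: upper_facets_def)
    then show ?thesis using bal[of F] that by blast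
  qed
  then show "valid_labels d m (slide_cells d m \<delta>) (label m \<delta>)"
    unfolding valid_labels_def using l012 by (auto simp: r_def l_def)
qed

end

section \<open>Refinement in terms of labels\<close>

context cyclic_subdivisions
begin

lemma refinement_antisym:
  assumes n: "d + 1 \<le> n" and \<delta>: "\<delta> \<in> subdivisions d n" "\<delta>' \<in> subdivisions d n"
    and le: "refinement_of \<delta> \<delta>'" "refinement_of \<delta>' \<delta>"
  shows "\<delta> = \<delta>'"
proof -
  have "A \<subseteq> B" if A: "A \<in> subdivisions d n" and AB: "refinement_of A B" and BA: "refinement_of B A" for A B
  proof
    fix V assume V: "V \<in> A"
    then obtain W where W: "W \<in> B" "V \<subseteq> W" using AB unfolding refinement_of_def by blast
    then obtain V' where V': "V' \<in> A" "W \<subseteq> V'" using BA unfolding refinement_of_def by blast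
    have "V = V'"
      by (rule cells_share_little[OF n A V V'(1) subset_refl _ cellD(2)[OF A V]]) (use W V' in blast)
    with W V' show "V \<in> B" by auto
  qed
  then show ?thesis using \<delta> le by (intro subset_antisym)
qed

lemma porder_on_subdivisions:
  assumes "d + 1 \<le> n"
  shows "porder_on (subdivisions d n) refinement_of"
  by (rule porder_onI)
    (rule refinement_of_refl, metis refinement_antisym[OF assms], metis refinement_of_trans)

lemma coarser_than_trivial:
  assumes n: "d + 1 \<le> n" and r: "r \<in> subdivisions d n" and le: "refinement_of {{1..n}} r"
  shows "r = {{1..n}}"
proof -
  have "refinement_of r {{1..n}}" using cellD(1)[OF r] by (auto simp: refinement_of_def)
  then show ?thesis using refinement_antisym[OF n r trivial_in_subdivisions[OF n]] le by blast
qed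

lemma facet_of_subset:
  assumes "F \<subseteq> X" "X \<subseteq> Y"
  shows "F \<in> upper_facets d Y \<Longrightarrow> F \<in> upper_facets d X"
    and "F \<in> lower_facets d Y \<Longrightarrow> F \<in> lower_facets d X"
  using assms by (auto simp: upper_facets_def lower_facets_def)

lemma facetD:
  "F \<in> upper_facets d X \<Longrightarrow> F \<subseteq> X \<and> card F = d"
  "F \<in> lower_facets d X \<Longrightarrow> F \<subseteq> X \<and> card F = d"
  by (auto simp: upper_facets_def lower_facets_def)

lemma no_opposite_facets:
  assumes "finite X" "d + 1 \<le> card X" "X \<subseteq> Y"
  shows "F \<in> upper_facets d X \<Longrightarrow> F \<in> lower_facets d Y \<Longrightarrow> False"
    and "F \<in> lower_facets d X \<Longrightarrow> F \<in> upper_facets d Y \<Longrightarrow> False"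
proof -
  have disj: "upper_facets d X \<inter> lower_facets d X = {}"
    using upper_lower_disjoint[of X d] assms by simp
  show False if "F \<in> upper_facets d X" "F \<in> lower_facets d Y"
    using disj facet_of_subset(2)[of F X Y] facetD(1)[OF that(1)] that assms(3) by blast
  show False if "F \<in> lower_facets d X" "F \<in> upper_facets d Y"
    using disj facet_of_subset(1)[of F X Y] facetD(2)[OF that(1)] that assms(3) by blast
qed

lemma cell_unique:
  assumes m: "d + 1 \<le> n" and r0: "r0 \<in> subdivisions d n" "W \<in> r0" "W' \<in> r0"
    and X: "d + 1 \<le> card X" "X \<subseteq> W" "X \<subseteq> W'"
  shows "W = W'"
  by (rule cells_share_little[OF m r0 X(2,3,1)])

text \<open>Label 1 is above 0 and 2, since a cell with both vertices can contain a cell with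
  either; 0 and 2 are incomparable.\<close>

definition label_le :: "nat \<Rightarrow> nat set set \<Rightarrow> (nat set \<Rightarrow> nat) \<Rightarrow> nat set set \<Rightarrow> (nat set \<Rightarrow> nat) \<Rightarrow> bool" where
  "label_le m r l r' l' \<longleftrightarrow> refinement_of r r' \<and>
     (\<forall>X\<in>r. \<forall>Y\<in>r'. m \<in> X \<longrightarrow> X \<subseteq> Y \<longrightarrow> l X = l' Y \<or> l' Y = 1)"

lemma relabel_mem:
  assumes "X \<subseteq> {1..m}" "m \<in> X" "l X \<in> {0, 1, 2}"
  shows "m \<in> relabel m l X \<longleftrightarrow> l X \<noteq> 2" "Suc m \<in> relabel m l X \<longleftrightarrow> l X \<noteq> 0"
  using assms by (auto simp: relabel_def lift_def)

lemma relabel_mono: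
  assumes X: "X \<subseteq> Y" "Y \<subseteq> {1..m}" and l: "m \<in> X \<Longrightarrow> l X = l' Y \<or> l' Y = 1" "m \<in> X \<Longrightarrow> l X \<in> {0, 1, 2}"
  shows "relabel m l X \<subseteq> relabel m l' Y"
proof (cases "m \<in> X")
  case False
  then show ?thesis using X by (auto simp: relabel_def lift_def)
next
  case True
  then have "m \<in> Y" using X by blast
  then show ?thesis using l[OF True] X True by (auto simp: relabel_def lift_def)
qed

text \<open>A relabelled cell cannot lie in a wall, which slides to only \<open>d\<close> vertices.
  Conversely a wall of the finer family either lies in a cell labelled 1 or is again a wall of the
  coarser family.\<close>

lemma unslide_refinement_iff:
  assumes m: "d + 1 \<le> m" and r: "r \<in> subdivisions d m" "valid_labels d m r l"
    and r': "r' \<in> subdivisions d m" "valid_labels d m r' l'"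
  shows "refinement_of (unslide d m r l) (unslide d m r' l') \<longleftrightarrow> label_le m r l r' l'"
proof
  have m1: "1 \<le> m" using m by simp
  have l012: "l X \<in> {0, 1, 2}" if "X \<in> r" "m \<in> X" for X using r(2) that by (simp add: valid_labels_def)
  have l'012: "l' X \<in> {0, 1, 2}" if "X \<in> r'" "m \<in> X" for X using r'(2) that by (simp add: valid_labels_def)
  note cells = cellD[OF r(1)] and cells' = cellD[OF r'(1)]
  assume le: "refinement_of (unslide d m r l) (unslide d m r' l')"
  have step: "\<exists>Y\<in>r'. X \<subseteq> Y \<and> relabel m l X \<subseteq> relabel m l' Y" if X: "X \<in> r" for X
  proof -
    have "relabel m l X \<in> unslide d m r l" using X by (auto simp: unslide_def)
    then obtain V where V: "V \<in> unslide d m r' l'" "relabel m l X \<subseteq> V" using le by (auto simp: refinement_of_def)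
    have "slide m (relabel m l X) \<subseteq> slide m V" using V(2) by (auto simp: slide_def)
    then have XV: "X \<subseteq> slide m V" using slide_relabel[OF cells(1)[OF X]] by simp
    show ?thesis
    proof (cases "V \<in> relabel m l' ` r'")
      case True
      then obtain Y where Y: "Y \<in> r'" "V = relabel m l' Y" by blast
      then show ?thesis using XV V(2) slide_relabel[OF cells'(1)[OF Y(1)]] by auto
    next
      case False
      then obtain F where F: "F \<in> walls d m r' l'" "V = insert (Suc m) F" using V(1) by (auto simp: unslide_def)
      note F' = walls_subset[OF F(1)]
      then have "X \<subseteq> F" using XV F(2) slide_insert[of F m] by simp
      then have "card X \<le> d" using F' card_mono[of F X] finite_subset[of F "{1..m}"] by auto
      then show ?thesis using cells(2)[OF X] by simp
    qed
  qed
  have "l X = l' Y \<or> l' Y = 1" if XY: "X \<in> r" "Y \<in> r'" "m \<in> X" "X \<subseteq> Y" for X Y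
  proof -
    obtain Z where Z: "Z \<in> r'" "X \<subseteq> Z" "relabel m l X \<subseteq> relabel m l' Z" using step[OF XY(1)] by blast
    have "Z = Y" by (rule cell_unique[OF m r'(1) Z(1) XY(2) cells(2)[OF XY(1)] Z(2) XY(4)])
    then have "relabel m l X \<subseteq> relabel m l' Y" using Z(3) by simp
    moreover have "m \<in> Y" using XY by blast
    ultimately show ?thesis
      using relabel_mem[of X m l] relabel_mem[of Y m l'] cells(1)[OF XY(1)] cells'(1)[OF XY(2)]
        l012[OF XY(1,3)] l'012[OF XY(2)] XY(3) by auto
  qed
  then show "label_le m r l r' l'"
    using step unfolding label_le_def refinement_of_def by blast
next
  note cells = cellD[OF r(1)] and cells' = cellD[OF r'(1)]
  have l012: "l X \<in> {0, 1, 2}" if "X \<in> r" "m \<in> X" for X using r(2) that by (simp add: valid_labels_def)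
  assume le: "label_le m r l r' l'"
  have coarse: "\<exists>Y\<in>r'. X \<subseteq> Y \<and> (m \<in> X \<longrightarrow> l X = l' Y \<or> l' Y = 1)" if "X \<in> r" for X
    using le that unfolding label_le_def refinement_of_def by blast
  have by_label: "\<exists>V\<in>unslide d m r' l'. insert (Suc m) F \<subseteq> V"
    if "Y \<in> r'" "l' Y = 1" "F \<subseteq> Y" "m \<in> F" for F Y
  proof -
    have "m \<in> Y" using that by blast
    then have "relabel m l' Y = insert (Suc m) Y" using that(2) by (simp add: relabel_def)
    then have "insert (Suc m) Y \<in> unslide d m r' l'" using that(1) unfolding unslide_def by blast
    then show ?thesis using that(3) by blast
  qed
  show "refinement_of (unslide d m r l) (unslide d m r' l')"
    unfolding refinement_of_def
  proof
    fix V assume V: "V \<in> unslide d m r l"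
    show "\<exists>W\<in>unslide d m r' l'. V \<subseteq> W"
    proof (cases "V \<in> relabel m l ` r")
      case True
      then obtain X where X: "X \<in> r" "V = relabel m l X" by blast
      obtain Y where Y: "Y \<in> r'" "X \<subseteq> Y" "m \<in> X \<longrightarrow> l X = l' Y \<or> l' Y = 1" using coarse[OF X(1)] by blast
      have "V \<subseteq> relabel m l' Y"
        unfolding X(2) by (rule relabel_mono[OF Y(2) cells'(1)[OF Y(1)]]) (use Y(3) l012[OF X(1)] in auto)
      then show ?thesis using Y(1) by (auto simp: unslide_def)
    next
      case False
      then obtain F where F: "F \<in> walls d m r l" "V = insert (Suc m) F" using V by (auto simp: unslide_def)
      note F' = walls_subset[OF F(1)]
      have below: "(\<exists>Y\<in>r'. F \<subseteq> Y \<and> l' Y = 1) \<or> F \<in> lower_facets d {1..m} \<or>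
          (\<exists>X\<in>r. \<exists>Y\<in>r'. X \<subseteq> Y \<and> F \<in> upper_facets d X \<and> l' Y = 0)"
      proof (cases "F \<in> lower_facets d {1..m}")
        case False
        then obtain X where X: "X \<in> r" "F \<in> upper_facets d X" "l X = 0" using F(1) by (auto simp: walls_def)
        obtain Y where "Y \<in> r'" "X \<subseteq> Y" "m \<in> X \<longrightarrow> l X = l' Y \<or> l' Y = 1" using coarse[OF X(1)] by blast
        then show ?thesis using X facetD(1)[OF X(2)] F' by (metis in_mono order_trans)
      qed simp
      have above: "(\<exists>Y\<in>r'. F \<subseteq> Y \<and> l' Y = 1) \<or> F \<in> upper_facets d {1..m} \<or>
          (\<exists>X\<in>r. \<exists>Y\<in>r'. X \<subseteq> Y \<and> F \<in> lower_facets d X \<and> l' Y = 2)"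
      proof (cases "F \<in> upper_facets d {1..m}")
        case False
        then obtain X where X: "X \<in> r" "F \<in> lower_facets d X" "l X = 2" using F(1) by (auto simp: walls_def)
        obtain Y where "Y \<in> r'" "X \<subseteq> Y" "m \<in> X \<longrightarrow> l X = l' Y \<or> l' Y = 1" using coarse[OF X(1)] by blast
        then show ?thesis using X facetD(2)[OF X(2)] F' by (metis in_mono order_trans)
      qed simp
      show ?thesis
      proof (cases "\<exists>Y\<in>r'. F \<subseteq> Y \<and> l' Y = 1")
        case True
        then show ?thesis using by_label F(2) F' by blast
      next
        case False
        \<comment> \<open>Otherwise \<open>F\<close> is in a coarse cell \<open>Y\<close> with label
          0 without being a facet of it. Then \<open>F\<close> is not on the upper boundary, so it
          lies in a second coarse cell, with label 2; but a ridge common to two cells is a facet of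
          both.\<close>
        have 1: "F \<in> lower_facets d {1..m} \<or> (\<exists>Y\<in>r'. F \<in> upper_facets d Y \<and> l' Y = 0)"
        proof (rule ccontr)
          assume no: "\<not> ?thesis"
          then obtain X Y where XY: "X \<in> r" "Y \<in> r'" "X \<subseteq> Y" "F \<in> upper_facets d X" "l' Y = 0"
            using below False by blast
          have FY: "F \<subseteq> Y" using XY facetD(1)[OF XY(4)] by blast
          have nlow: "F \<notin> lower_facets d Y"
            using no_opposite_facets(1)[OF cells(3,2)[OF XY(1)] XY(3,4)] by blast
          have nupp: "F \<notin> upper_facets d Y" using no XY by blast
          show False
          proof (cases "F \<in> upper_facets d {1..m}")
            case True
            then show False using facet_of_subset(1)[OF FY cells'(1)[OF XY(2)]] nupp by blast
          next
            case False
            then obtain X2 Y2 where XY2: "X2 \<in> r" "Y2 \<in> r'" "X2 \<subseteq> Y2" "F \<in> lower_facets d X2" "l' Y2 = 2"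
              using above \<open>\<not> (\<exists>Y\<in>r'. F \<subseteq> Y \<and> l' Y = 1)\<close> by blast
            have "F \<subseteq> Y2" using XY2 facetD(2)[OF XY2(4)] by blast
            moreover have "Y \<noteq> Y2" using XY(5) XY2(5) by auto
            ultimately show False
              using common_facet[OF m r'(1) XY(2) XY2(2) _ FY] F' nlow nupp by blast
          qed
        qed
        have 2: "F \<in> upper_facets d {1..m} \<or> (\<exists>Y\<in>r'. F \<in> lower_facets d Y \<and> l' Y = 2)"
        proof (rule ccontr)
          assume no: "\<not> ?thesis"
          then obtain X Y where XY: "X \<in> r" "Y \<in> r'" "X \<subseteq> Y" "F \<in> lower_facets d X" "l' Y = 2"
            using above False by blast
          have FY: "F \<subseteq> Y" using XY facetD(2)[OF XY(4)] by blast
          have nupp: "F \<notin> upper_facets d Y"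
            using no_opposite_facets(2)[OF cells(3,2)[OF XY(1)] XY(3,4)] by blast
          have nlow: "F \<notin> lower_facets d Y" using no XY by blast
          show False
          proof (cases "F \<in> lower_facets d {1..m}")
            case True
            then show False using facet_of_subset(2)[OF FY cells'(1)[OF XY(2)]] nlow by blast
          next
            case False
            then obtain X2 Y2 where XY2: "X2 \<in> r" "Y2 \<in> r'" "X2 \<subseteq> Y2" "F \<in> upper_facets d X2" "l' Y2 = 0"
              using below \<open>\<not> (\<exists>Y\<in>r'. F \<subseteq> Y \<and> l' Y = 1)\<close> by blast
            have "F \<subseteq> Y2" using XY2 facetD(1)[OF XY2(4)] by blast
            moreover have "Y \<noteq> Y2" using XY(5) XY2(5) by auto
            ultimately show False
              using common_facet[OF m r'(1) XY(2) XY2(2) _ FY] F' nlow nupp by blast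
          qed
        qed
        have "F \<in> walls d m r' l'" using 1 2 F' by (simp add: walls_def)
        then show ?thesis using F(2) by (auto simp: unslide_def)
      qed
    qed
  qed
qed

end

text \<open>In dimension at most three every cell has at most one lower facet through its last vertex,
  hence the cells around a vertex form a forest under adjacency. The depth below is strictly
  monotone along its edges.\<close>
definition depth :: "nat \<Rightarrow> nat \<Rightarrow> nat set \<Rightarrow> nat" where
  "depth d m X = (if d = 2 then Min X else Max (X - {m}) - Min X)"

text \<open>Gale's criterion solved for small \<open>d\<close>: for \<open>d = 2\<close> all other
  vertices precede the edge, for \<open>d = 3\<close> they lie between the two smaller vertices of
  the triangle.\<close>

definition lower_facet_at :: "nat \<Rightarrow> nat \<Rightarrow> nat set \<Rightarrow> nat set" where
  "lower_facet_at d m X = (if d = 2 then {m, Max (X - {m})} else {m, Min X, Max (X - {m})})"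

lemma card_one_or_two_above:
  fixes a b v :: nat
  shows "card {u. u = a \<and> v < u} = of_bool (v < a)"
    and "a \<noteq> b \<Longrightarrow> card {u. (u = a \<or> u = b) \<and> v < u} = of_bool (v < a) + of_bool (v < b)"
    and "a \<noteq> b \<Longrightarrow> a \<noteq> c \<Longrightarrow> b \<noteq> c \<Longrightarrow>
      card {u. (u = a \<or> u = b \<or> u = c) \<and> v < u} = of_bool (v < a) + of_bool (v < b) + of_bool (v < c)"
proof -
  let ?S = "\<lambda>x. if v < x then {x} else {}"
  have "{u. u = a \<and> v < u} = ?S a" by auto
  then show "card {u. u = a \<and> v < u} = of_bool (v < a)" by simp
  have "{u. (u = a \<or> u = b) \<and> v < u} = ?S a \<union> ?S b" by auto
  then show "card {u. (u = a \<or> u = b) \<and> v < u} = of_bool (v < a) + of_bool (v < b)" if "a \<noteq> b"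
    using that by simp
  have "{u. (u = a \<or> u = b \<or> u = c) \<and> v < u} = ?S a \<union> ?S b \<union> ?S c" by auto
  then show "card {u. (u = a \<or> u = b \<or> u = c) \<and> v < u} = of_bool (v < a) + of_bool (v < b) + of_bool (v < c)"
    if "a \<noteq> b" "a \<noteq> c" "b \<noteq> c"
    using that by simp
qed

lemma ridge_through_last_vertex:
  fixes d m :: nat
  assumes d: "d = 2 \<or> d = 3" and F: "F \<subseteq> {1..m}" "card F = d" "m \<in> F"
  obtains b where "d = 2" "F = {m, b}" "b < m" | a b where "d = 3" "F = {m, a, b}" "a < b" "b < m"
proof -
  have c: "card (F - {m}) = d - 1" using card_Diff_singleton[OF F(3)] F(2) by simp
  have less: "x < m" if "x \<in> F - {m}" for x using subsetD[OF F(1), of x] that by (cases "x = m") auto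
  from d show thesis
  proof
    assume "d = 2"
    then have "card (F - {m}) = 1" using c by simp
    then obtain b where b: "F - {m} = {b}" by (rule card_1_singletonE)
    then have "F = {m, b}" using insert_Diff[OF F(3)] by simp
    then show thesis using that(1)[OF \<open>d = 2\<close>, of b] less[of b] b F(3) by blast
  next
    assume "d = 3"
    then have "card (F - {m}) = 2" using c by simp
    then obtain a b where ab: "F - {m} = {a, b}" "a \<noteq> b" by (auto simp: card_2_iff)
    then have F_eq: "F = {m, a, b}" using F(3) by blast
    have lt: "a < m" "b < m" using less ab by auto
    show thesis
    proof (cases "a < b")
      case True
      then show thesis using that(2)[OF \<open>d = 3\<close> F_eq] lt by blast
    next
      case False
      moreover have "F = {m, b, a}" using F_eq by blast
      ultimately show thesis using ab(2) lt(1) by (intro that(2)[OF \<open>d = 3\<close>, of b a]) auto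
    qed
  qed
qed

context
  fixes d m :: nat and X :: "nat set"
  assumes X: "X \<subseteq> {1..m}" "d + 1 \<le> card X" "m \<in> X" and d: "d = 2 \<or> d = 3"
begin

lemma cell_basics:
  shows "finite X" "X - {m} \<noteq> {}" "Max (X - {m}) \<in> X - {m}" "Max (X - {m}) < m" "Min X \<in> X"
    "Min X < Max (X - {m})" "\<And>v. v \<in> X \<Longrightarrow> Min X \<le> v" "\<And>v. v \<in> X \<Longrightarrow> v \<noteq> m \<Longrightarrow> v \<le> Max (X - {m})"
proof -
  show fin: "finite X" using X(1) finite_subset by blast
  have c: "2 \<le> card (X - {m})" using X fin d by auto
  then show ne: "X - {m} \<noteq> {}" using card.empty by fastforce
  show mx: "Max (X - {m}) \<in> X - {m}" using Max_in[of "X - {m}"] fin ne by blast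
  then show "Max (X - {m}) < m" using X(1) by fastforce
  show "Min X \<in> X" using fin X(3) by (intro Min_in) auto
  show mn: "Min X \<le> v" if "v \<in> X" for v using that fin by simp
  show mxv: "v \<le> Max (X - {m})" if "v \<in> X" "v \<noteq> m" for v using that fin by simp
  have "\<not> X - {m} \<subseteq> {Max (X - {m})}"
  proof
    assume "X - {m} \<subseteq> {Max (X - {m})}"
    then have "card (X - {m}) \<le> card {Max (X - {m})}" by (intro card_mono) auto
    also have "\<dots> = 1" by simp
    finally show False using c by linarith
  qed
  then obtain v where "v \<in> X - {m}" "v \<noteq> Max (X - {m})" by blast
  then show "Min X < Max (X - {m})" using mn[of v] mxv[of v] by force
qed

lemma lower_facet_at_in: "lower_facet_at d m X \<in> lower_facets d X"
proof -
  note B = cell_basics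
  have ne: "m \<noteq> Max (X - {m})" "m \<noteq> Min X" "Min X \<noteq> Max (X - {m})" using B(4,6) by auto
  have "even (card {u \<in> lower_facet_at d m X. v < u})" if v: "v \<in> X - lower_facet_at d m X" for v
  proof -
    have "v \<in> X" "v \<noteq> m" "v \<noteq> Max (X - {m})" using v by (auto simp: lower_facet_at_def split: if_splits)
    then have "v < m" "v < Max (X - {m})" "\<not> v < Min X" using B(4) B(7,8)[of v] by auto
    then show ?thesis
      using ne d by (auto simp: lower_facet_at_def card_one_or_two_above)
  qed
  moreover have "lower_facet_at d m X \<subseteq> X" using B X(3) by (auto simp: lower_facet_at_def)
  moreover have "card (lower_facet_at d m X) = d" using ne d by (auto simp: lower_facet_at_def)
  ultimately show ?thesis by (simp add: lower_facets_def)
qed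

lemma lower_facet_at_unique:
  assumes F: "F \<in> lower_facets d X" "m \<in> F"
  shows "F = lower_facet_at d m X"
proof -
  note B = cell_basics
  have F': "F \<subseteq> X" "card F = d" and ev: "\<And>v. v \<in> X - F \<Longrightarrow> even (card {u \<in> F. v < u})"
    using F(1) by (auto simp: lower_facets_def)
  have sub: "F \<subseteq> {1..m}" using F'(1) X(1) by blast
  show ?thesis
  proof (rule ridge_through_last_vertex[OF d sub F'(2) F(2)])
    fix b assume *: "d = 2" "F = {m, b}" "b < m"
    have "v < b" if "v \<in> X - F" for v
    proof -
      have "v < m" using subsetD[OF X(1), of v] that F(2) by (cases "v = m") auto
      then show ?thesis using ev[OF that] * by (auto simp: card_one_or_two_above split: if_splits)
    qed
    then have "b = Max (X - {m})" using B(3) B(8)[of b] F' * by force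
    then show ?thesis using * by (simp add: lower_facet_at_def)
  next
    fix a b assume *: "d = 3" "F = {m, a, b}" "a < b" "b < m"
    have v: "a < v \<and> v < b" if "v \<in> X - F" for v
    proof -
      have "v < m" using subsetD[OF X(1), of v] that F(2) by (cases "v = m") auto
      moreover have "v \<noteq> a" "v \<noteq> b" using that * by auto
      ultimately show ?thesis using ev[OF that] * by (auto simp: card_one_or_two_above split: if_splits)
    qed
    have "b = Max (X - {m})"
    proof (cases "Max (X - {m}) \<in> F")
      case True
      then show ?thesis using B(3) B(8)[of b] F' * by auto
    qed (use v[of "Max (X - {m})"] B(3) B(8)[of b] F' * in auto)
    moreover have "a = Min X"
    proof (cases "Min X \<in> F")
      case True
      then show ?thesis using B(4,6) B(7)[of a] F' * by auto
    qed (use v[of "Min X"] B(5) B(7)[of a] F' * in auto)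
    ultimately show ?thesis using * by (auto simp: lower_facet_at_def)
  qed
qed

text \<open>For \<open>d = 2\<close> the further vertices of \<open>X\<close> lie above the smaller
  end of \<open>F\<close>, so \<open>X\<close> begins where \<open>Y\<close> has its last vertex
  before \<open>m\<close>. For \<open>d = 3\<close> they lie outside the interval that
  \<open>Y\<close> spans without \<open>m\<close>, so \<open>X\<close> spans a longer one.\<close>

lemma depth_less:
  assumes F: "F \<in> upper_facets d X" "F = lower_facet_at d m Y" "m \<in> F"
    and Y: "Min Y < Max (Y - {m})" "Max (Y - {m}) < m"
  shows "depth d m Y < depth d m X"
proof -
  note B = cell_basics
  have F': "F \<subseteq> X" "card F = d" and od: "\<And>v. v \<in> X - F \<Longrightarrow> odd (card {u \<in> F. v < u})"
    using F(1) by (auto simp: upper_facets_def)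
  have finF: "finite F" using F'(1) B(1) finite_subset by blast
  have "\<not> X \<subseteq> F" using X(2) F'(2) card_mono[OF finF, of X] by auto
  then obtain w where w: "w \<in> X - F" by blast
  let ?b = "Max (Y - {m})"
  from d show ?thesis
  proof
    assume d2: "d = 2"
    then have Fe: "F = {m, ?b}" using F(2) by (simp add: lower_facet_at_def)
    have "?b \<le> v" if "v \<in> X" for v
    proof (cases "v \<in> F")
      case False
      then have "v < m" using that X(1) F(3) by (metis atLeastAtMost_iff in_mono le_neq_implies_less)
      then show ?thesis using od[of v] that False Y(2) Fe by (auto simp: card_one_or_two_above split: if_splits)
    qed (use Fe Y in auto)
    then have "?b \<le> Min X" using B(5) by blast
    then show ?thesis using Y(1) d2 by (simp add: depth_def)
  next
    assume d3: "d = 3"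
    then have Fe: "F = {m, Min Y, ?b}" using F(2) by (simp add: lower_facet_at_def)
    have ab: "Min Y \<in> X" "?b \<in> X" "?b \<noteq> m" using Fe F'(1) Y by auto
    have "w < m" using w X(1) F(3) by (metis Diff_iff atLeastAtMost_iff in_mono le_neq_implies_less)
    moreover have "w \<noteq> Min Y" "w \<noteq> ?b" using w Fe by auto
    ultimately have "w < Min Y \<or> ?b < w"
      using od[OF w] Y Fe by (auto simp: card_one_or_two_above split: if_splits)
    then have "?b - Min Y < Max (X - {m}) - Min X"
      using B(7)[of w] B(8)[of w] B(7)[OF ab(1)] B(8)[OF ab(2,3)] w \<open>w < m\<close> Y by auto
    then show ?thesis using d3 by (simp add: depth_def)
  qed
qed

end

text \<open>On a line the last vertex is the upper end of its segment, so no two segments are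
  adjacent there.\<close>

lemma no_lower_facet_dim_one:
  assumes "X \<subseteq> {1..m}" "2 \<le> card X" "F \<in> lower_facets 1 X" "m \<in> F"
  shows False
proof -
  have "F \<subseteq> X" "card F = 1" using assms(3) by (auto simp: lower_facets_def)
  then have F: "F = {m}" using assms(4) by (metis card_1_singletonE singletonD)
  have "\<not> X \<subseteq> {m}" using assms(2) card_mono[of "{m}" X] by auto
  then obtain v where v: "v \<in> X" "v \<noteq> m" by blast
  then have "v < m" using assms(1) by fastforce
  then have "card {u \<in> F. v < u} = 1" using F by (simp add: card_one_or_two_above)
  moreover have "even (card {u \<in> F. v < u})" using assms(3) v F by (simp add: lower_facets_def)
  ultimately show False by simp
qed

lemma unique_lower_facet:
  assumes d: "1 \<le> d" "d \<le> 3" and X: "X \<subseteq> {1..m}" "d + 1 \<le> card X"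
    and F: "F \<in> lower_facets d X" "m \<in> F" "G \<in> lower_facets d X" "m \<in> G"
  shows "F = G"
proof (cases "d = 1")
  case True
  then show ?thesis using no_lower_facet_dim_one[of X m F] X F by simp
next
  case False
  moreover have "m \<in> X" using F by (auto simp: lower_facets_def)
  moreover have "d = 2 \<or> d = 3" using d \<open>d \<noteq> 1\<close> by auto
  ultimately show ?thesis
    using lower_facet_at_unique[OF X, of F] lower_facet_at_unique[OF X, of G] F by simp
qed

text \<open>The facet of \<open>X\<close> excludes \<open>d = 1\<close>; in dimensions two and three
  \<open>lower_facet_at\<close> is always available.\<close>

lemma ex_lower_facet:
  assumes d: "1 \<le> d" "d \<le> 3" and X: "X \<subseteq> {1..m}" "d + 1 \<le> card X" and F: "F \<in> lower_facets d X" "m \<in> F"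
    and Y: "Y \<subseteq> {1..m}" "d + 1 \<le> card Y" "m \<in> Y"
  obtains G where "G \<in> lower_facets d Y" "m \<in> G"
proof (cases "d = 1")
  case True
  then show ?thesis using no_lower_facet_dim_one[of X m F] X F by simp
next
  case False
  then have "d = 2 \<or> d = 3" using d by auto
  from lower_facet_at_in[OF Y this] show ?thesis
    by (rule that) (simp add: lower_facet_at_def)
qed

lemma depth_strict_mono:
  assumes d: "1 \<le> d" "d \<le> 3" and X: "X \<subseteq> {1..m}" "d + 1 \<le> card X" and Y: "Y \<subseteq> {1..m}" "d + 1 \<le> card Y"
    and F: "F \<in> upper_facets d X" "F \<in> lower_facets d Y" "m \<in> F"
  shows "depth d m Y < depth d m X"
proof (cases "d = 1")
  case True
  then show ?thesis using no_lower_facet_dim_one[of Y m F] Y F by simp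
next
  case False
  then have d': "d = 2 \<or> d = 3" using d by auto
  have "m \<in> X" "m \<in> Y" using F by (auto simp: upper_facets_def lower_facets_def)
  then show ?thesis
    using depth_less[OF X _ d' F(1) _ F(3)] lower_facet_at_unique[OF Y _ d' F(2,3)]
      cell_basics(4,6)[OF Y _ d'] by blast
qed

section \<open>Contractible fibres\<close>

text \<open>In geometric terms, a decomposition is pushed inside \<open>W\<close> by letting the cells in \<open>W\<close> end at the
  vertex \<open>m + 1\<close> only, and it is merged inside \<open>W\<close> by replacing them with \<open>W \<union> {m + 1}\<close>.\<close>
definition push_labels :: "nat set set \<Rightarrow> (nat set \<Rightarrow> nat) \<Rightarrow> nat set \<Rightarrow> nat" where
  "push_labels U l X = (if \<exists>W\<in>U. X \<subseteq> W then 2 else l X)"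

definition pushed_in :: "nat \<Rightarrow> nat set \<Rightarrow> nat set set \<Rightarrow> (nat set \<Rightarrow> nat) \<Rightarrow> bool" where
  "pushed_in m W r l \<longleftrightarrow> (\<forall>X\<in>r. m \<in> X \<longrightarrow> X \<subseteq> W \<longrightarrow> l X = 2)"

text \<open>If the inside of \<open>W\<close> is pushed already, cells below \<open>W\<close> may
  have any label, and label 1 on \<open>W\<close> need not be valid next to them. Hence nothing is
  merged in that case.\<close>

definition merge_cells :: "nat \<Rightarrow> nat set \<Rightarrow> nat set set \<Rightarrow> (nat set \<Rightarrow> nat) \<Rightarrow> nat set set" where
  "merge_cells m W r l = (if pushed_in m W r l then r else insert W {X\<in>r. \<not> X \<subseteq> W})"

definition merge_labels :: "nat \<Rightarrow> nat set \<Rightarrow> nat set set \<Rightarrow> (nat set \<Rightarrow> nat) \<Rightarrow> nat set \<Rightarrow> nat" where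
  "merge_labels m W r l = (if pushed_in m W r l then l else l(W := 1))"

context cyclic_subdivisions
begin

context
  fixes m :: nat and r0 :: "nat set set"
  assumes m: "d + 1 \<le> m" and r0: "r0 \<in> subdivisions d m" and d3: "d \<le> 3"
begin

text \<open>The pairs that \<open>unslide\<close> turns into elements of the fibre over
  \<open>r0\<close>, with \<open>label_le\<close> as their order.\<close>

definition refines :: "nat set set \<Rightarrow> (nat set \<Rightarrow> nat) \<Rightarrow> bool" where
  "refines r l \<longleftrightarrow> r \<in> subdivisions d m \<and> refinement_of r r0 \<and> valid_labels d m r l"

lemma refinesD:
  assumes "refines r l"
  shows "r \<in> subdivisions d m" "refinement_of r r0" "valid_labels d m r l"
  using assms by (auto simp: refines_def)

lemma valid_labelsD:
  assumes "valid_labels d m r l"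
  shows "X \<in> r \<Longrightarrow> m \<in> X \<Longrightarrow> l X \<in> {0, 1, 2}"
    and "X \<in> r \<Longrightarrow> Y \<in> r \<Longrightarrow> m \<in> F \<Longrightarrow> F \<in> upper_facets d X \<Longrightarrow> F \<in> lower_facets d Y \<Longrightarrow> l X = 0 \<or> l Y = 2"
  using assms unfolding valid_labels_def by blast+

text \<open>\<open>F\<close> is in both coarse cells and thus a facet of both; the finer cell
  \<open>X\<close> decides the side.\<close>

lemma adjacent_coarse:
  assumes X: "X \<subseteq> {1..m}" "d + 1 \<le> card X" "X \<subseteq> W" and Y: "Y \<subseteq> W'"
    and W: "W \<in> r0" "W' \<in> r0" "W \<noteq> W'" and F: "F \<in> upper_facets d X" "F \<in> lower_facets d Y"
  shows "F \<in> upper_facets d W" "F \<in> lower_facets d W'"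
proof -
  have F': "F \<subseteq> W" "F \<subseteq> W'" "card F = d" using facetD(1)[OF F(1)] facetD(2)[OF F(2)] X Y by auto
  have "finite X" using X(1) finite_subset by blast
  then have "F \<notin> lower_facets d W" using no_opposite_facets(1)[OF _ X(2,3) F(1)] by blast
  then show "F \<in> upper_facets d W" "F \<in> lower_facets d W'"
    using common_facet[OF m r0 W F'] by blast+
qed

lemma adjacent_depth:
  assumes X: "X \<subseteq> {1..m}" "d + 1 \<le> card X" "X \<subseteq> W" and Y: "Y \<subseteq> W'"
    and W: "W \<in> r0" "W' \<in> r0" "W \<noteq> W'" and F: "F \<in> upper_facets d X" "F \<in> lower_facets d Y" "m \<in> F"
  shows "depth d m W' < depth d m W"
  by (rule depth_strict_mono[OF d_pos d3 cellD(1,2)[OF r0 W(1)] cellD(1,2)[OF r0 W(2)]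
        adjacent_coarse[OF X Y W F(1,2)] F(3)])

lemma coarse_cell:
  assumes "refines r l" "X \<in> r"
  obtains W where "W \<in> r0" "X \<subseteq> W"
  using refinesD(2)[OF assms(1)] assms(2) unfolding refinement_of_def by blast

text \<open>The cell above a ridge has the smaller depth. With each of its cells \<open>U\<close>
  contains all shallower ones at \<open>m\<close>, in particular the neighbours above it.\<close>

definition closed_below :: "nat set set \<Rightarrow> bool" where
  "closed_below U \<longleftrightarrow> U \<subseteq> r0 \<and> (\<forall>W\<in>U. \<forall>W'\<in>r0. m \<in> W' \<longrightarrow> depth d m W' < depth d m W \<longrightarrow> W' \<in> U)"

text \<open>Pushing a cell is valid if its upper neighbours at \<open>m\<close> have label 2. These
  lie in the same coarse cell or in a shallower one, which belongs to \<open>U\<close>.\<close>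

lemma refines_push:
  assumes U: "closed_below U" and r: "refines r l"
  shows "refines r (push_labels U l)"
proof -
  note cells = cellD[OF refinesD(1)[OF r]] and val = valid_labelsD[OF refinesD(3)[OF r]]
  have "push_labels U l X = 0 \<or> push_labels U l Y = 2"
    if XY: "X \<in> r" "Y \<in> r" and F: "m \<in> F" "F \<in> upper_facets d X" "F \<in> lower_facets d Y" for X Y F
  proof (rule ccontr)
    assume n: "\<not> ?thesis"
    then have Y: "\<not> (\<exists>W\<in>U. Y \<subseteq> W)" "l Y \<noteq> 2" by (auto simp: push_labels_def split: if_splits)
    then have "l X = 0" using val(2)[OF XY F] by blast
    then obtain W where W: "W \<in> U" "X \<subseteq> W" using n by (auto simp: push_labels_def split: if_splits)
    obtain W' where W': "W' \<in> r0" "Y \<subseteq> W'" using coarse_cell[OF r XY(2)] .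
    have "W \<in> r0" "W \<noteq> W'" using U W W' Y(1) by (auto simp: closed_below_def)
    from adjacent_depth[OF cells(1,2)[OF XY(1)] W(2) W'(2) this(1) W'(1) this(2) F(2,3,1)]
    have "depth d m W' < depth d m W" .
    moreover have "m \<in> W'" using facetD(2)[OF F(3)] F(1) W'(2) by blast
    ultimately show False using U W W' Y(1) unfolding closed_below_def by blast
  qed
  moreover have "push_labels U l X \<in> {0, 1, 2}" if "X \<in> r" "m \<in> X" for X
    using val(1)[OF that] by (simp add: push_labels_def)
  ultimately show ?thesis
    using refinesD[OF r] by (simp add: refines_def valid_labels_def)
qed

lemma merged_subdivision:
  assumes r: "r \<in> subdivisions d m" "refinement_of r r0" and W: "W \<in> r0"
  shows "insert W {X\<in>r. \<not> X \<subseteq> W} \<in> subdivisions d m"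
proof -
  note fin = finite_subdivision[OF r(1)]
  have "(\<Sum>V\<in>insert W {X\<in>r. \<not> X \<subseteq> W}. bdry d V F) = bdry d {1..m} F" for F
  proof -
    have "(\<Sum>V\<in>insert W {X\<in>r. \<not> X \<subseteq> W}. bdry d V F)
      = (\<Sum>V\<in>{X\<in>r. X \<subseteq> W}. bdry d V F) + (\<Sum>V\<in>{X\<in>r. \<not> X \<subseteq> W}. bdry d V F)"
      using refinement_sum[OF m r(1) r0 r(2) W] fin by simp
    also have "\<dots> = (\<Sum>V\<in>{X\<in>r. X \<subseteq> W} \<union> {X\<in>r. \<not> X \<subseteq> W}. bdry d V F)"
      by (rule sum.union_disjoint[symmetric]) (use fin in auto)
    also have "{X\<in>r. X \<subseteq> W} \<union> {X\<in>r. \<not> X \<subseteq> W} = r" by blast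
    finally show ?thesis using r(1) by (simp add: subdivisions_def)
  qed
  then show ?thesis using cellD(1,2)[OF r(1)] cellD(1,2)[OF r0 W] by (auto simp: subdivisions_def)
qed

text \<open>If one cell inside \<open>W\<close> that lies on the lower facet of \<open>W\<close> through \<open>m\<close> is labelled 2, then
  walking up from the lower facet of any other cell inside \<open>W\<close> reaches it, so all of them are.\<close>
lemma pushed_in_if_lowest:
  assumes r: "refines r l" and W: "W \<in> r0"
    and Y: "Y \<in> r" "Y \<subseteq> W" "l Y = 2" and F: "F \<in> lower_facets d Y" "F \<in> lower_facets d W" "m \<in> F"
  shows "pushed_in m W r l"
proof (rule ccontr)
  note r1 = refinesD(1)[OF r]
  note cells = cellD[OF r1] and val = valid_labelsD[OF refinesD(3)[OF r]]
  let ?B = "{Z\<in>r. m \<in> Z \<and> Z \<subseteq> W \<and> l Z \<noteq> 2}"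
  assume "\<not> ?thesis"
  then have "?B \<noteq> {}" by (auto simp: pushed_in_def)
  moreover have finB: "finite (depth d m ` ?B)" using finite_subdivision[OF r1] by simp
  \<comment> \<open>\<open>Z\<close> is the deepest cell inside \<open>W\<close> without label 2.
    The cell under its lower facet has label 0 and is deeper, so it would have to lie outside
    \<open>W\<close>; but then that facet would be the lower facet of \<open>W\<close>, where
    \<open>Y\<close> sits.\<close>
  ultimately have "Max (depth d m ` ?B) \<in> depth d m ` ?B" by (intro Max_in) auto
  then obtain Z where Z: "Z \<in> ?B" "depth d m Z = Max (depth d m ` ?B)" by auto
  have max: "depth d m Z' \<le> depth d m Z" if "Z' \<in> ?B" for Z'
    unfolding Z(2) using that finB by (intro Max_ge) blast+
  from Z(1) have Z': "Z \<in> r" "m \<in> Z" "Z \<subseteq> W" "l Z \<noteq> 2" by auto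
  obtain G where G: "G \<in> lower_facets d Z" "m \<in> G"
    using ex_lower_facet[OF d_pos d3 cells(1,2)[OF Y(1)] F(1,3) cells(1,2)[OF Z'(1)] Z'(2)] .
  have GW: "G \<notin> lower_facets d W"
  proof
    assume "G \<in> lower_facets d W"
    then have "G = F"
      using unique_lower_facet[OF d_pos d3 cellD(1,2)[OF r0 W] _ G(2) F(2,3)] by blast
    then have "Y = Z" using lower_facet_unique[OF m r1 Y(1) Z'(1) F(1)] G(1) by blast
    then show False using Y Z' by blast
  qed
  have "G \<subseteq> W" using facetD(2)[OF G(1)] Z'(3) by blast
  then have "G \<notin> lower_facets d {1..m}"
    using facet_of_subset(2)[OF _ cellD(1)[OF r0 W]] GW by blast
  then have "bdry d {1..m} G \<ge> 0" by (simp add: bdry_def)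
  then have "\<exists>X\<in>r. G \<in> upper_facets d X"
    using facet_balance[OF m r1, of G] G(1) Z'(1) by (auto split: if_splits simp: of_bool_def)
  then obtain X where X: "X \<in> r" "G \<in> upper_facets d X" by blast
  have "l X = 0" using val(2)[OF X(1) Z'(1) G(2) X(2) G(1)] Z'(4) by blast
  have "m \<in> X" using facetD(1)[OF X(2)] G(2) by blast
  have dl: "depth d m Z < depth d m X"
    by (rule depth_strict_mono[OF d_pos d3 cells(1,2)[OF X(1)] cells(1,2)[OF Z'(1)] X(2) G])
  show False
  proof (cases "X \<subseteq> W")
    case True
    then have "X \<in> ?B" using X \<open>l X = 0\<close> \<open>m \<in> X\<close> by simp
    then show False using max dl by (meson leD)
  next
    case False
    obtain W' where W': "W' \<in> r0" "X \<subseteq> W'" using coarse_cell[OF r X(1)] .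
    then have "W' \<noteq> W" using False by blast
    from adjacent_coarse(2)[OF cells(1,2)[OF X(1)] W'(2) Z'(3) W'(1) W this X(2) G(1)] GW
    show False by blast
  qed
qed

text \<open>Label 1 on \<open>W\<close> demands label 2 on the neighbours above, which is hypothesis
  \<open>above\<close>, and label 0 on those below. The cell inside \<open>W\<close> on the common
  ridge does not have label 2, as otherwise \<open>pushed_in_if_lowest\<close> would apply; so
  validity before the merge gives label 0 below it.\<close>

lemma refines_merge:
  assumes r: "refines r l" and W: "W \<in> r0"
    and above: "\<And>X W'. X \<in> r \<Longrightarrow> m \<in> X \<Longrightarrow> W' \<in> r0 \<Longrightarrow> X \<subseteq> W' \<Longrightarrow> depth d m W' < depth d m W \<Longrightarrow> l X = 2"
  shows "refines (merge_cells m W r l) (merge_labels m W r l)"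
proof (cases "pushed_in m W r l")
  case True
  then show ?thesis using r by (simp add: merge_cells_def merge_labels_def)
next
  case False
  note r1 = refinesD(1)[OF r]
  note cells = cellD[OF r1] and val = valid_labelsD[OF refinesD(3)[OF r]]
  let ?r = "insert W {X\<in>r. \<not> X \<subseteq> W}" and ?l = "l(W := 1)"
  have sub: "?r \<in> subdivisions d m" by (rule merged_subdivision[OF r1 refinesD(2)[OF r] W])
  have "?l X = 0 \<or> ?l Y = 2"
    if XY: "X \<in> ?r" "Y \<in> ?r" and F: "m \<in> F" "F \<in> upper_facets d X" "F \<in> lower_facets d Y" for X Y F
  proof -
    have "X \<noteq> Y" using facets_disjoint[OF sub XY(1) F(2)] F(3) by blast
    consider "X \<noteq> W" "Y \<noteq> W" | "X = W" "Y \<noteq> W" | "X \<noteq> W" "Y = W" using \<open>X \<noteq> Y\<close> by blast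
    then show ?thesis
    proof cases
      case 1
      then show ?thesis using val(2)[of X Y F] XY F by auto
    next
      case 2
      then have Y: "Y \<in> r" "\<not> Y \<subseteq> W" using XY by auto
      obtain W' where W': "W' \<in> r0" "Y \<subseteq> W'" using coarse_cell[OF r Y(1)] .
      then have "W \<noteq> W'" using Y by blast
      have FW: "F \<in> upper_facets d W" using F(2) 2 by simp
      have "depth d m W' < depth d m W"
        by (rule adjacent_depth[OF cellD(1,2)[OF r0 W] subset_refl W'(2) W W'(1) \<open>W \<noteq> W'\<close> FW F(3,1)])
      moreover have "m \<in> Y" using facetD(2)[OF F(3)] F(1) by blast
      ultimately show ?thesis using above[OF Y(1) _ W'] 2 by simp
    next
      case 3
      then have X: "X \<in> r" "\<not> X \<subseteq> W" using XY by auto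
      have FW: "F \<in> lower_facets d W" using F(3) 3 by simp
      \<comment> \<open>The merged family shows that the ridge is interior to the polytope; hence
        \<open>r\<close> also has a cell above it.\<close>
      have "\<exists>X\<in>?r. F \<in> upper_facets d X" "\<exists>X\<in>?r. F \<in> lower_facets d X" using XY F by blast+
      then have "bdry d {1..m} F = 0" using facet_balance[OF m sub, of F] by simp
      moreover have "\<exists>X\<in>r. F \<in> upper_facets d X" using X F by blast
      ultimately have "\<exists>Y\<in>r. F \<in> lower_facets d Y"
        using facet_balance[OF m r1, of F] by (auto split: if_splits simp: of_bool_def)
      then obtain Y' where Y': "Y' \<in> r" "F \<in> lower_facets d Y'" by blast
      have "Y' \<subseteq> W"
      proof (rule ccontr)
        assume n: "\<not> Y' \<subseteq> W"
        then have "Y' \<in> ?r" using Y' by simp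
        then have "Y' = W" using lower_facet_unique[OF m sub _ _ Y'(2) FW] by blast
        then show False using n by blast
      qed
      then have "l Y' \<noteq> 2"
        using pushed_in_if_lowest[OF r W Y'(1) _ _ Y'(2) FW F(1)] False by blast
      then have "l X = 0" using val(2)[OF X(1) Y'(1) F(1,2) Y'(2)] by blast
      then show ?thesis using 3 by simp
    qed
  qed
  moreover have "?l X \<in> {0, 1, 2}" if "X \<in> ?r" "m \<in> X" for X
    using val(1)[of X] that by auto
  moreover have "refinement_of ?r r0" using refinesD(2)[OF r] W by (auto simp: refinement_of_def)
  ultimately show ?thesis
    using sub False by (simp add: refines_def valid_labels_def merge_cells_def merge_labels_def)
qed

lemma subset_coarse_iff:
  assumes "refines r l" "refines r' l'" "X \<in> r" "Y \<in> r'" "X \<subseteq> Y" "W \<in> r0"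
  shows "X \<subseteq> W \<longleftrightarrow> Y \<subseteq> W"
proof
  assume "X \<subseteq> W"
  obtain W' where W': "W' \<in> r0" "Y \<subseteq> W'" using coarse_cell[OF assms(2,4)] .
  have "W = W'"
    by (rule cell_unique[OF m r0 assms(6) W'(1) cellD(2)[OF refinesD(1)[OF assms(1)] assms(3)] \<open>X \<subseteq> W\<close>])
      (use W' assms(5) in blast)
  then show "Y \<subseteq> W" using W' by simp
qed (use assms(5) in blast)

lemma push_labels_mono:
  assumes r: "refines r l" "refines r' l'" and U: "U \<subseteq> r0" and le: "label_le m r l r' l'"
  shows "label_le m r (push_labels U l) r' (push_labels U l')"
proof -
  have "(\<exists>W\<in>U. X \<subseteq> W) \<longleftrightarrow> (\<exists>W\<in>U. Y \<subseteq> W)" if "X \<in> r" "Y \<in> r'" "X \<subseteq> Y" for X Y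
    using subset_coarse_iff[OF r that] U by blast
  then show ?thesis using le by (auto simp: label_le_def push_labels_def)
qed

lemma coarse_in_merged:
  assumes r: "refines r l" and W: "W \<in> r0" and Y: "Y \<in> insert W {X\<in>r. \<not> X \<subseteq> W}" and X: "X \<subseteq> Y" "X \<subseteq> W" "d + 1 \<le> card X"
  shows "Y = W"
proof (rule ccontr)
  assume "Y \<noteq> W"
  then have Y': "Y \<in> r" "\<not> Y \<subseteq> W" using Y by auto
  obtain W' where W': "W' \<in> r0" "Y \<subseteq> W'" using coarse_cell[OF r Y'(1)] .
  have "W = W'" by (rule cell_unique[OF m r0 W W'(1) X(3,2)]) (use X W' in blast)
  then show False using W' Y' by blast
qed

text \<open>Being pushed inside \<open>W\<close> passes to finer elements, so along the order
  \<open>merge_cells\<close> can change only from not merging to merging.\<close>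

lemma merge_mono:
  assumes r: "refines r l" "refines r' l'" and W: "W \<in> r0" and le: "label_le m r l r' l'"
  shows "label_le m (merge_cells m W r l) (merge_labels m W r l) (merge_cells m W r' l') (merge_labels m W r' l')"
proof -
  note cells = cellD[OF refinesD(1)[OF r(1)]]
  note cellW = cellD[OF r0 W]
  have ref: "\<exists>Y\<in>r'. X \<subseteq> Y" if "X \<in> r" for X using le that by (auto simp: label_le_def refinement_of_def)
  have lab: "l X = l' Y \<or> l' Y = 1" if "X \<in> r" "Y \<in> r'" "m \<in> X" "X \<subseteq> Y" for X Y
    using le that by (auto simp: label_le_def)
  have iff: "X \<subseteq> W \<longleftrightarrow> Y \<subseteq> W" if "X \<in> r" "Y \<in> r'" "X \<subseteq> Y" for X Y
    by (rule subset_coarse_iff[OF r that W])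
  show ?thesis
  proof (cases "pushed_in m W r' l'")
    case True
    have "pushed_in m W r l"
      unfolding pushed_in_def
    proof (intro ballI impI)
      fix X assume X: "X \<in> r" "m \<in> X" "X \<subseteq> W"
      from ref[OF X(1)] obtain Y where Y: "Y \<in> r'" "X \<subseteq> Y" by blast
      have "l' Y = 2" using True iff[OF X(1) Y] X Y by (auto simp: pushed_in_def)
      then show "l X = 2" using lab[OF X(1) Y(1) X(2) Y(2)] by simp
    qed
    then show ?thesis using True le by (simp add: merge_cells_def merge_labels_def)
  next
    case False
    let ?r' = "insert W {X\<in>r'. \<not> X \<subseteq> W}" and ?l' = "l'(W := 1)"
    have ref': "\<exists>Y\<in>?r'. X \<subseteq> Y" if "X \<in> r" for X
    proof -
      from ref[OF that] obtain Y where "Y \<in> r'" "X \<subseteq> Y" by blast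
      then show ?thesis using iff[OF that] by (cases "X \<subseteq> W") auto
    qed
    have lab': "l X = ?l' Y \<or> ?l' Y = 1" if "X \<in> r" "Y \<in> ?r'" "m \<in> X" "X \<subseteq> Y" for X Y
      using lab[OF that(1) _ that(3,4)] that(2) by auto
    show ?thesis
    proof (cases "pushed_in m W r l")
      case True
      then show ?thesis using False ref' lab'
        by (simp add: merge_cells_def merge_labels_def label_le_def refinement_of_def)
    next
      case nr: False
      have "refinement_of (insert W {X\<in>r. \<not> X \<subseteq> W}) ?r'"
        using ref' unfolding refinement_of_def by blast
      moreover have "(l(W := 1)) X = ?l' Y \<or> ?l' Y = 1"
        if X: "X \<in> insert W {X\<in>r. \<not> X \<subseteq> W}" and Y: "Y \<in> ?r'" "m \<in> X" "X \<subseteq> Y" for X Y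
      proof (cases "X = W")
        case True
        then have "Y = W" using coarse_in_merged[OF r(2) W Y(1,3)] cellW(2) by simp
        then show ?thesis by simp
      next
        case False
        then show ?thesis using lab'[of X Y] X Y by simp
      qed
      ultimately show ?thesis
        using False nr by (simp add: merge_cells_def merge_labels_def label_le_def)
    qed
  qed
qed

text \<open>When a merge takes place, the labels \<open>l'\<close> inside \<open>W\<close> are
  arbitrary. Thus both the map before pushing \<open>W\<close> and the map after it lie below the
  merging map.\<close>

lemma label_le_merge:
  assumes r: "refines r l" and W: "W \<in> r0"
    and l': "\<And>X. X \<in> r \<Longrightarrow> m \<in> X \<Longrightarrow> \<not> X \<subseteq> W \<or> pushed_in m W r l \<Longrightarrow> l' X = l X"
  shows "label_le m r l' (merge_cells m W r l) (merge_labels m W r l)"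
proof (cases "pushed_in m W r l")
  case True
  have "l' X = l Y" if XY: "X \<in> r" "Y \<in> r" "m \<in> X" "X \<subseteq> Y" for X Y
  proof -
    have "X = Y"
      by (rule cells_share_little[OF m refinesD(1)[OF r] XY(1,2) subset_refl XY(4) cellD(2)[OF refinesD(1)[OF r] XY(1)]])
    then show ?thesis using l'[OF XY(1,3)] True by simp
  qed
  then show ?thesis
    using True refinement_of_refl[of r] by (simp add: label_le_def merge_cells_def merge_labels_def)
next
  case False
  let ?r = "insert W {X\<in>r. \<not> X \<subseteq> W}"
  have "l' X = (l(W := 1)) Y \<or> (l(W := 1)) Y = 1" if XY: "X \<in> r" "Y \<in> ?r" "m \<in> X" "X \<subseteq> Y" for X Y
  proof (cases "Y = W")
    case Y: False
    then have "Y \<in> r" "\<not> Y \<subseteq> W" using XY by auto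
    moreover have "X = Y"
      by (rule cells_share_little[OF m refinesD(1)[OF r] XY(1) \<open>Y \<in> r\<close> subset_refl XY(4) cellD(2)[OF refinesD(1)[OF r] XY(1)]])
    ultimately show ?thesis using l'[OF XY(1,3)] Y by simp
  qed simp
  then show ?thesis
    using False by (auto simp: label_le_def merge_cells_def merge_labels_def refinement_of_def)
qed

section \<open>The fibre over a decomposition and its contraction\<close>

definition fibre :: "nat set set set" where
  "fibre = {\<delta> \<in> subdivisions d (Suc m). refinement_of (slide_cells d m \<delta>) r0}"

lemma refines_fibre:
  assumes "\<delta> \<in> fibre"
  shows "refines (slide_cells d m \<delta>) (label m \<delta>)"
  using assms slide_cells_subdivision[OF m, of \<delta>] unslide_slide_cells(1)[OF m, of \<delta>]
  by (simp add: fibre_def refines_def)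

lemma unslide_in_fibre:
  assumes "refines r l"
  shows "unslide d m r l \<in> fibre"
  using refinesD[OF assms] unslide_subdivision[OF m, of r l] slide_cells_unslide[of r m l]
  by (simp add: fibre_def)

lemma unslide_le_iff:
  assumes "refines r l" "refines r' l'"
  shows "refinement_of (unslide d m r l) (unslide d m r' l') \<longleftrightarrow> label_le m r l r' l'"
  using unslide_refinement_iff[OF m] refinesD[OF assms(1)] refinesD[OF assms(2)] by blast

lemma fibre_le_iff:
  assumes "\<delta> \<in> fibre" "\<delta>' \<in> fibre"
  shows "refinement_of \<delta> \<delta>' \<longleftrightarrow>
    label_le m (slide_cells d m \<delta>) (label m \<delta>) (slide_cells d m \<delta>') (label m \<delta>')"
  using unslide_le_iff[OF refines_fibre[OF assms(1)] refines_fibre[OF assms(2)]]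
    unslide_slide_cells(2)[OF m, of \<delta>] unslide_slide_cells(2)[OF m, of \<delta>'] assms
  by (simp add: fibre_def)

definition push :: "nat set set \<Rightarrow> nat set set \<Rightarrow> nat set set" where
  "push U \<delta> = unslide d m (slide_cells d m \<delta>) (push_labels U (label m \<delta>))"

definition push_merge :: "nat set set \<Rightarrow> nat set \<Rightarrow> nat set set \<Rightarrow> nat set set" where
  "push_merge U W \<delta> = (let r = slide_cells d m \<delta>; l = push_labels U (label m \<delta>)
     in unslide d m (merge_cells m W r l) (merge_labels m W r l))"

lemma push_map:
  assumes U: "closed_below U"
  shows "push U \<in> fibre \<rightarrow> fibre" "monotone_on fibre refinement_of refinement_of (push U)"
proof -
  have sub: "U \<subseteq> r0" using U by (simp add: closed_below_def)
  show "push U \<in> fibre \<rightarrow> fibre"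
    using unslide_in_fibre[OF refines_push[OF U refines_fibre]] by (auto simp: push_def)
  show "monotone_on fibre refinement_of refinement_of (push U)"
  proof (rule monotone_onI)
    fix \<delta> \<delta>' assume \<delta>: "\<delta> \<in> fibre" "\<delta>' \<in> fibre" "refinement_of \<delta> \<delta>'"
    note r = refines_fibre[OF \<delta>(1)] refines_fibre[OF \<delta>(2)]
    show "refinement_of (push U \<delta>) (push U \<delta>')"
      unfolding push_def unslide_le_iff[OF refines_push[OF U r(1)] refines_push[OF U r(2)]]
      by (rule push_labels_mono[OF r sub]) (use fibre_le_iff[OF \<delta>(1,2)] \<delta>(3) in blast)
  qed
qed

text \<open>Cells are processed downwards from the shallowest one: pushing one more cell \<open>W\<close> is connected
  to the previous map through the map that additionally merges everything inside \<open>W\<close>.\<close>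
lemma fence_push_insert:
  assumes U: "closed_below U" and W: "W \<in> r0"
    and min: "\<And>W'. W' \<in> r0 \<Longrightarrow> m \<in> W' \<Longrightarrow> depth d m W' < depth d m W \<Longrightarrow> W' \<in> U"
    and fence: "fence fibre refinement_of (push U)"
  shows "closed_below (insert W U)" "fence fibre refinement_of (push (insert W U))"
proof -
  show UW: "closed_below (insert W U)"
    using U W min unfolding closed_below_def by blast
  have good: "refines (slide_cells d m \<delta>) (push_labels U (label m \<delta>))" if "\<delta> \<in> fibre" for \<delta>
    by (rule refines_push[OF U refines_fibre[OF that]])
  have good': "refines (slide_cells d m \<delta>) (push_labels (insert W U) (label m \<delta>))" if "\<delta> \<in> fibre" for \<delta>
    by (rule refines_push[OF UW refines_fibre[OF that]])
  have merged: "refines (merge_cells m W (slide_cells d m \<delta>) (push_labels U (label m \<delta>)))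
      (merge_labels m W (slide_cells d m \<delta>) (push_labels U (label m \<delta>)))" if "\<delta> \<in> fibre" for \<delta>
  \<comment> \<open>All shallower coarse cells at \<open>m\<close> are in \<open>U\<close>, so the
    cells above \<open>W\<close> have label 2 already.\<close>
  proof (rule refines_merge[OF good[OF that] W])
    fix X W' assume "X \<in> slide_cells d m \<delta>" "m \<in> X" and *: "W' \<in> r0" "X \<subseteq> W'" "depth d m W' < depth d m W"
    then have "W' \<in> U" using min[OF *(1) _ *(3)] by blast
    then show "push_labels U (label m \<delta>) X = 2" using *(2) by (auto simp: push_labels_def)
  qed
  have "fence fibre refinement_of (push_merge U W)"
  proof (rule fence_step[OF fence])
    show "push_merge U W \<in> fibre \<rightarrow> fibre"
      using unslide_in_fibre[OF merged] by (simp add: push_merge_def Let_def)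
    show "monotone_on fibre refinement_of refinement_of (push_merge U W)"
    proof (rule monotone_onI)
      fix \<delta> \<delta>' assume \<delta>: "\<delta> \<in> fibre" "\<delta>' \<in> fibre" "refinement_of \<delta> \<delta>'"
      have "refinement_of (push U \<delta>) (push U \<delta>')"
        using push_map(2)[OF U] \<delta> by (simp add: monotone_on_def)
      then have "label_le m (slide_cells d m \<delta>) (push_labels U (label m \<delta>))
          (slide_cells d m \<delta>') (push_labels U (label m \<delta>'))"
        unfolding push_def unslide_le_iff[OF good[OF \<delta>(1)] good[OF \<delta>(2)]] .
      then show "refinement_of (push_merge U W \<delta>) (push_merge U W \<delta>')"
        unfolding push_merge_def Let_def unslide_le_iff[OF merged[OF \<delta>(1)] merged[OF \<delta>(2)]]
        by (rule merge_mono[OF good[OF \<delta>(1)] good[OF \<delta>(2)] W])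
    qed
    have "refinement_of (push U \<delta>) (push_merge U W \<delta>)" if \<delta>: "\<delta> \<in> fibre" for \<delta>
      unfolding push_def push_merge_def Let_def unslide_le_iff[OF good[OF \<delta>] merged[OF \<delta>]]
      by (rule label_le_merge[OF good[OF \<delta>] W]) simp
    then show "(\<forall>\<delta>\<in>fibre. refinement_of (push U \<delta>) (push_merge U W \<delta>)) \<or>
        (\<forall>\<delta>\<in>fibre. refinement_of (push_merge U W \<delta>) (push U \<delta>))" by blast
  qed
  then show "fence fibre refinement_of (push (insert W U))"
  proof (rule fence_step)
    have "refinement_of (push (insert W U) \<delta>) (push_merge U W \<delta>)" if \<delta>: "\<delta> \<in> fibre" for \<delta>
      unfolding push_def push_merge_def Let_def unslide_le_iff[OF good'[OF \<delta>] merged[OF \<delta>]]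
      by (rule label_le_merge[OF good[OF \<delta>] W]) (auto simp: push_labels_def pushed_in_def)
    then show "(\<forall>\<delta>\<in>fibre. refinement_of (push_merge U W \<delta>) (push (insert W U) \<delta>)) \<or>
        (\<forall>\<delta>\<in>fibre. refinement_of (push (insert W U) \<delta>) (push_merge U W \<delta>))" by blast
  qed (use push_map[OF UW] in auto)
qed

lemma fence_push:
  assumes "k \<le> card {W\<in>r0. m \<in> W}"
  shows "\<exists>U\<subseteq>{W\<in>r0. m \<in> W}. card U = k \<and> closed_below U \<and> fence fibre refinement_of (push U)"
  using assms
proof (induction k)
  case 0
  have closed: "closed_below {}" by (simp add: closed_below_def)
  have "push_labels {} l = l" for l by (simp add: push_labels_def fun_eq_iff)
  then have id: "push {} \<delta> = \<delta>" if "\<delta> \<in> fibre" for \<delta>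
    using unslide_slide_cells(2)[OF m, of \<delta>] that by (simp add: push_def fibre_def)
  have "fence fibre refinement_of (push {})"
    by (rule fence_step[OF fence_id push_map[OF closed]]) (simp add: id refinement_of_refl)
  then show ?case using closed by (intro exI[of _ "{}"]) simp
next
  case (Suc k)
  let ?P = "{W\<in>r0. m \<in> W}"
  have finP: "finite ?P" using finite_subdivision[OF r0] by simp
  obtain U where U: "U \<subseteq> ?P" "card U = k" "closed_below U" "fence fibre refinement_of (push U)"
    using Suc by auto
  then have "U \<noteq> ?P" using Suc.prems by auto
  then have "?P - U \<noteq> {}" using U(1) by blast
  \<comment> \<open>The next cell is a shallowest one not yet pushed.\<close>
  then have "Min (depth d m ` (?P - U)) \<in> depth d m ` (?P - U)" using finP by (intro Min_in) auto
  then obtain W where W: "W \<in> ?P - U" "depth d m W = Min (depth d m ` (?P - U))" by auto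
  have W0: "W \<in> r0" using W(1) by blast
  have min: "W' \<in> U" if "W' \<in> r0" "m \<in> W'" "depth d m W' < depth d m W" for W'
  proof (rule ccontr)
    assume "W' \<notin> U"
    then have "depth d m W' \<in> depth d m ` (?P - U)" using that by blast
    then have "depth d m W \<le> depth d m W'" unfolding W(2) using finP by (intro Min_le) auto
    then show False using that(3) by simp
  qed
  note step = fence_push_insert[OF U(3) W0 min U(4)]
  have "finite U" using U(1) finP finite_subset by blast
  then have "card (insert W U) = Suc k" using W(1) U(2) by simp
  moreover have "insert W U \<subseteq> ?P" using W(1) U(1) by blast
  ultimately show ?case using step by blast
qed

theorem fence_contractible_fibre: "fence_contractible fibre refinement_of"
proof -
  let ?P = "{W\<in>r0. m \<in> W}"
  have finP: "finite ?P" using finite_subdivision[OF r0] by simp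
  obtain U where U: "U \<subseteq> ?P" "card U = card ?P" "closed_below U" "fence fibre refinement_of (push U)"
    using fence_push[OF order_refl] by blast
  have UP: "U = ?P" using card_subset_eq[OF finP U(1,2)] .
  \<comment> \<open>\<open>r0\<close> with every cell moved to \<open>m + 1\<close>. After all
    coarse cells are pushed each image has label 2 throughout and refines it, which gives the last
    step of the fence.\<close>
  let ?c = "unslide d m r0 (\<lambda>_. 2)"
  have top: "refines r0 (\<lambda>_. 2)"
    using r0 refinement_of_refl[of r0] by (simp add: refines_def valid_labels_def)
  have "refinement_of (push U \<delta>) ?c" if \<delta>: "\<delta> \<in> fibre" for \<delta>
  proof -
    note r = refines_fibre[OF \<delta>]
    have "push_labels U (label m \<delta>) X = 2" if X: "X \<in> slide_cells d m \<delta>" "m \<in> X" for X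
    proof -
      obtain W where W: "W \<in> r0" "X \<subseteq> W" using coarse_cell[OF r X(1)] .
      then have "W \<in> U" using X(2) UP by blast
      then show ?thesis using W(2) by (auto simp: push_labels_def)
    qed
    then show ?thesis
      unfolding push_def unslide_le_iff[OF refines_push[OF U(3) r] top]
      using refinesD(2)[OF r] by (simp add: label_le_def)
  qed
  moreover have c: "?c \<in> fibre" by (rule unslide_in_fibre[OF top])
  ultimately have "fence fibre refinement_of (\<lambda>_. ?c)"
    by (intro fence_step[OF U(4)]) (auto simp: monotone_on_def refinement_of_refl)
  then show ?thesis using c unfolding fence_contractible_def by blast
qed

end

end

section \<open>One more vertex is one more suspension\<close>

context cyclic_subdivisions
begin

text \<open>The two sections of the slide. Constant labels 0 or 2 are valid over any subdivision,
  since either alternative then holds across each ridge.\<close>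

definition lift_all :: "nat \<Rightarrow> bool \<Rightarrow> nat set set \<Rightarrow> nat set set" where
  "lift_all m b r = unslide d m r (\<lambda>_. if b then 0 else 2)"

lemma finite_subdivisions: "finite (subdivisions d n)"
  by (rule finite_subset[of _ "Pow (Pow {1..n})"]) (auto simp: subdivisions_def)

lemma label_leD: "label_le m r l r' l' \<Longrightarrow> refinement_of r r'"
  by (simp add: label_le_def)

context
  fixes m :: nat
  assumes m: "d + 1 \<le> m"
begin

lemma lift_all:
  assumes "r \<in> subdivisions d m"
  shows "lift_all m b r \<in> subdivisions d (Suc m)" "slide_cells d m (lift_all m b r) = r"
    "X \<in> r \<Longrightarrow> m \<in> X \<Longrightarrow> label m (lift_all m b r) X = (if b then 0 else 2)"
proof -
  have "valid_labels d m r (\<lambda>_. if b then 0 else 2)" by (simp add: valid_labels_def)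
  then show "lift_all m b r \<in> subdivisions d (Suc m)"
    unfolding lift_all_def by (rule unslide_subdivision[OF m assms])
  show "slide_cells d m (lift_all m b r) = r"
    unfolding lift_all_def by (rule slide_cells_unslide[OF assms])
  show "label m (lift_all m b r) X = (if b then 0 else 2)" if "X \<in> r" "m \<in> X"
    unfolding lift_all_def by (rule label_unslide[OF assms that]) simp
qed

lemma refinement_iff_label_le:
  assumes "\<delta> \<in> subdivisions d (Suc m)" "\<delta>' \<in> subdivisions d (Suc m)"
  shows "refinement_of \<delta> \<delta>' \<longleftrightarrow>
    label_le m (slide_cells d m \<delta>) (label m \<delta>) (slide_cells d m \<delta>') (label m \<delta>')"
  using unslide_refinement_iff[OF m slide_cells_subdivision[OF m assms(1)] unslide_slide_cells(1)[OF m assms(1)]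
      slide_cells_subdivision[OF m assms(2)] unslide_slide_cells(1)[OF m assms(2)]]
  by (simp add: unslide_slide_cells(2)[OF m] assms)

lemma eq_lift_all_iff:
  assumes "\<delta> \<in> subdivisions d (Suc m)"
  shows "\<delta> = lift_all m b (slide_cells d m \<delta>) \<longleftrightarrow>
    (\<forall>X\<in>slide_cells d m \<delta>. m \<in> X \<longrightarrow> label m \<delta> X = (if b then 0 else 2))"
proof -
  note r = slide_cells_subdivision[OF m assms]
  have "\<delta> = lift_all m b (slide_cells d m \<delta>)"
    if "\<forall>X\<in>slide_cells d m \<delta>. m \<in> X \<longrightarrow> label m \<delta> X = (if b then 0 else 2)"
    using unslide_cong[OF r, of "label m \<delta>" "\<lambda>_. if b then 0 else 2"] that
      unslide_slide_cells(2)[OF m assms] by (simp add: lift_all_def)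
  then show ?thesis using lift_all(3)[OF r, of _ b] by metis
qed

lemma slide_trivial: "slide_cells d m {{1..Suc m}} = {{1..m}}" "label m {{1..Suc m}} {1..m} = 1"
proof -
  have "slide m {1..Suc m} = {1..m}" by (rule slide_all) (use m in simp)
  moreover have "{V. V = {1..Suc m} \<and> Suc d \<le> card (slide m V)} = {{1..Suc m}}"
    using m calculation by auto
  ultimately show "slide_cells d m {{1..Suc m}} = {{1..m}}"
    by (simp add: slide_cells_def)
  have "{1..m} \<noteq> {1..Suc m}" by (metis atLeastAtMost_iff le_add1 plus_1_eq_Suc order_refl not_less_eq_eq)
  moreover have "insert (Suc m) {1..m} = {1..Suc m}" by auto
  ultimately show "label m {{1..Suc m}} {1..m} = 1" unfolding label_def by simp
qed

text \<open>There is a single cell, so its label is the only freedom.\<close>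

lemma over_trivial:
  assumes \<delta>: "\<delta> \<in> subdivisions d (Suc m)" "slide_cells d m \<delta> = {{1..m}}"
  shows "\<delta> = {{1..Suc m}} \<and> label m \<delta> {1..m} = 1 \<or> \<delta> = lift_all m True {{1..m}} \<or> \<delta> = lift_all m False {{1..m}}"
proof -
  have mm: "m \<in> {1..m}" using m by simp
  have triv: "{{1..Suc m}} \<in> subdivisions d (Suc m)" by (rule trivial_in_subdivisions) (use m in simp)
  have "label m \<delta> {1..m} \<in> {0, 1, 2}"
    using unslide_slide_cells(1)[OF m \<delta>(1)] \<delta>(2) mm by (simp add: valid_labels_def)
  moreover have "\<delta> = lift_all m True {{1..m}}" if "label m \<delta> {1..m} = 0"
    using eq_lift_all_iff[OF \<delta>(1), of True] \<delta>(2) that by simp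
  moreover have "\<delta> = lift_all m False {{1..m}}" if "label m \<delta> {1..m} = 2"
    using eq_lift_all_iff[OF \<delta>(1), of False] \<delta>(2) that by simp
  moreover have "\<delta> = {{1..Suc m}}" if "label m \<delta> {1..m} = 1"
  proof -
    have "unslide d m {{1..m}} (label m \<delta>) = unslide d m {{1..m}} (label m {{1..Suc m}})"
      by (rule unslide_cong[OF trivial_in_subdivisions[OF m]]) (use slide_trivial(2) that in simp)
    then show ?thesis
      using unslide_slide_cells(2)[OF m \<delta>(1)] unslide_slide_cells(2)[OF m triv] slide_trivial(1) \<delta>(2) by simp
  qed
  ultimately show ?thesis by auto
qed

lemma lift_all_trivial_proper: "lift_all m b {{1..m}} \<noteq> {{1..Suc m}}"
  using lift_all(3)[OF trivial_in_subdivisions[OF m], of "{1..m}" b] slide_trivial(2) m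
  by (auto split: if_splits)

text \<open>The coarse cell has label 0 or 2, not 1, so every finer cell at \<open>m\<close> must
  carry the same label.\<close>

lemma below_lift_all_iff:
  assumes \<delta>: "\<delta> \<in> subdivisions d (Suc m)"
  shows "refinement_of \<delta> (lift_all m b {{1..m}}) \<longleftrightarrow> \<delta> = lift_all m b (slide_cells d m \<delta>)"
proof -
  note triv = trivial_in_subdivisions[OF m]
  let ?r = "slide_cells d m \<delta>"
  have sub: "X \<subseteq> {1..m}" if "X \<in> ?r" for X
    using cellD(1)[OF slide_cells_subdivision[OF m \<delta>] that] .
  define c :: nat where "c = (if b then 0 else 2)"
  have "label m (lift_all m b {{1..m}}) {1..m} = c"
    unfolding c_def by (rule lift_all(3)[OF triv]) (use m in auto)
  moreover have "c \<noteq> 1" by (simp add: c_def)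
  ultimately have "refinement_of \<delta> (lift_all m b {{1..m}}) \<longleftrightarrow>
      refinement_of ?r {{1..m}} \<and> (\<forall>X\<in>?r. m \<in> X \<longrightarrow> X \<subseteq> {1..m} \<longrightarrow> label m \<delta> X = c)"
    by (simp add: refinement_iff_label_le[OF \<delta> lift_all(1)[OF triv]] lift_all(2)[OF triv] label_le_def del: One_nat_def)
  also have "\<dots> \<longleftrightarrow> (\<forall>X\<in>?r. m \<in> X \<longrightarrow> label m \<delta> X = c)"
    using sub by (auto simp: refinement_of_def)
  finally show ?thesis unfolding eq_lift_all_iff[OF \<delta>] c_def .
qed

lemma above_lift_all:
  assumes \<delta>: "\<delta> \<in> subdivisions d (Suc m)" "\<delta> \<noteq> {{1..Suc m}}" and le: "refinement_of (lift_all m b {{1..m}}) \<delta>"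
  shows "\<delta> = lift_all m b {{1..m}}"
proof -
  note triv = trivial_in_subdivisions[OF m]
  have mm: "m \<in> {1..m}" using m by simp
  have lle: "label_le m {{1..m}} (label m (lift_all m b {{1..m}})) (slide_cells d m \<delta>) (label m \<delta>)"
    using le refinement_iff_label_le[OF lift_all(1)[OF triv] \<delta>(1), of b] lift_all(2)[OF triv, of b] by simp
  have r: "slide_cells d m \<delta> = {{1..m}}"
    by (rule coarser_than_trivial[OF m slide_cells_subdivision[OF m \<delta>(1)] label_leD[OF lle]])
  have "label m \<delta> {1..m} = (if b then 0 else 2) \<or> label m \<delta> {1..m} = 1"
    using lle lift_all(3)[OF triv _ mm, of b] mm unfolding r label_le_def by (cases b) auto
  moreover have "label m \<delta> {1..m} \<noteq> 1"
    using over_trivial[OF \<delta>(1) r] \<delta>(2) lift_all(3)[OF triv _ mm] by auto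
  ultimately show ?thesis using eq_lift_all_iff[OF \<delta>(1), of b] r by simp
qed

theorem suspend_proper_subdivisions:
  assumes d3: "d \<le> 3"
  shows "order_polyhedron (suspension k (subdivisions d (Suc m) - {{{1..Suc m}}})) (suspension_le refinement_of)
    homotopy_eqv
    order_polyhedron (suspension (Suc k) (subdivisions d m - {{{1..m}}})) (suspension_le refinement_of)"
proof -
  note triv = trivial_in_subdivisions[OF m]
  have mm: "m \<in> {1..m}" using m by simp
  have m': "d + 1 \<le> Suc m" using m by simp
  let ?f = "slide_cells d m"
  define Q where "Q = {\<delta>\<in>subdivisions d (Suc m). ?f \<delta> \<noteq> {{1..m}}}"
  define R where "R = subdivisions d m - {{{1..m}}}"
  define a where "a = (\<lambda>b. lift_all m b {{1..m}})"
  have QS: "\<delta> \<in> subdivisions d (Suc m)" "?f \<delta> \<noteq> {{1..m}}" if "\<delta> \<in> Q" for \<delta>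
    using that by (auto simp: Q_def)
  have RS: "r \<in> subdivisions d m" "r \<noteq> {{1..m}}" if "r \<in> R" for r
    using that by (auto simp: R_def)
  have proper: "subdivisions d (Suc m) - {{{1..Suc m}}} = Q \<union> range a"
  proof (intro subset_antisym subsetI)
    fix \<delta> assume "\<delta> \<in> subdivisions d (Suc m) - {{{1..Suc m}}}"
    then show "\<delta> \<in> Q \<union> range a"
      using over_trivial[of \<delta>] by (cases "?f \<delta> = {{1..m}}") (auto simp: Q_def a_def)
  next
    fix \<delta> assume "\<delta> \<in> Q \<union> range a"
    then show "\<delta> \<in> subdivisions d (Suc m) - {{{1..Suc m}}}"
      using lift_all(1)[OF triv] lift_all_trivial_proper slide_trivial(1) by (auto simp: Q_def a_def)
  qed
  have lift_Q: "lift_all m b r \<in> Q" if "r \<in> R" for b r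
    using lift_all(1,2)[OF RS(1)[OF that], of b] RS(2)[OF that] by (simp add: Q_def)
  have f_mono: "refinement_of (?f \<delta>) (?f \<delta>')"
    if "\<delta> \<in> Q" "\<delta>' \<in> Q" "refinement_of \<delta> \<delta>'" for \<delta> \<delta>'
    using label_leD refinement_iff_label_le[OF QS(1)[OF that(1)] QS(1)[OF that(2)]] that(3) by blast
  have lift_mono: "refinement_of (lift_all m b r) (lift_all m b r')"
    if "r \<in> R" "r' \<in> R" "refinement_of r r'" for b r r'
    using that(3) lift_all(3)[OF RS(1)[OF that(1)], of _ b] lift_all(3)[OF RS(1)[OF that(2)], of _ b]
    by (auto simp: refinement_iff_label_le[OF lift_all(1)[OF RS(1)[OF that(1)]] lift_all(1)[OF RS(1)[OF that(2)]]]
        lift_all(2)[OF RS(1)[OF that(1)]] lift_all(2)[OF RS(1)[OF that(2)]] label_le_def)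
  have "order_polyhedron (suspension k (Q \<union> range a)) (suspension_le refinement_of) homotopy_eqv
    order_polyhedron (suspension (Suc k) R) (suspension_le refinement_of)"
  proof (rule suspension_step[where f = ?f and s = "lift_all m"])
    show "finite Q" "finite R" using finite_subdivisions by (simp_all add: Q_def R_def)
    show "porder_on (Q \<union> range a) refinement_of"
      unfolding proper[symmetric] by (rule porder_on_subset[OF porder_on_subdivisions[OF m']]) blast
    show "porder_on R refinement_of"
      unfolding R_def by (rule porder_on_subset[OF porder_on_subdivisions[OF m]]) blast
    show "a b \<notin> Q" for b using lift_all(2)[OF triv, of b] by (simp add: Q_def a_def)
    show "a True \<noteq> a False"
      using lift_all(3)[OF triv _ mm, of True] lift_all(3)[OF triv _ mm, of False] by (auto simp: a_def)
    show "p = a b" if "p \<in> Q \<union> range a" "refinement_of (a b) p" for b p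
      using above_lift_all[of p b] that proper by (auto simp: a_def)
    show "?f \<in> Q \<rightarrow> R"
      using slide_cells_subdivision[OF m QS(1)] QS(2) by (auto simp: R_def)
    show "monotone_on Q refinement_of refinement_of ?f"
      using f_mono by (intro monotone_onI) blast
    show "lift_all m b \<in> R \<rightarrow> Q" for b using lift_Q by blast
    show "monotone_on R refinement_of refinement_of (lift_all m b)" for b
      using lift_mono by (intro monotone_onI) blast
    show "?f (lift_all m b r) = r" if "r \<in> R" for b r by (rule lift_all(2)[OF RS(1)[OF that]])
    show "refinement_of q (a b) \<longleftrightarrow> q \<in> lift_all m b ` R" if q: "q \<in> Q" for b q
    proof -
      have "?f q \<in> R" using slide_cells_subdivision[OF m QS(1)[OF q]] QS(2)[OF q] by (simp add: R_def)
      then have "q = lift_all m b (?f q) \<longleftrightarrow> q \<in> lift_all m b ` R"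
        using lift_all(2)[OF RS(1), of _ b] by auto
      then show ?thesis using below_lift_all_iff[OF QS(1)[OF q], of b] by (simp add: a_def)
    qed
    show "fence_contractible {q\<in>Q. refinement_of (?f q) r} refinement_of" if r: "r \<in> R" for r
    proof -
      \<comment> \<open>No refinement of a proper \<open>r\<close> is trivial, so the set over
        \<open>r\<close> inside \<open>Q\<close> is the full fibre.\<close>
      have "?f \<delta> \<noteq> {{1..m}}" if "refinement_of (?f \<delta>) r" for \<delta>
        using coarser_than_trivial[OF m RS(1)[OF r]] RS(2)[OF r] that by auto
      then have "{q\<in>Q. refinement_of (?f q) r} = fibre m r"
        unfolding Q_def fibre_def[OF m RS(1)[OF r] d3] by (intro Collect_cong) auto
      then show ?thesis using fence_contractible_fibre[OF m RS(1)[OF r] d3] by simp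
    qed
  qed
  then show ?thesis unfolding proper R_def .
qed

end

text \<open>The base of the induction: a simplex has no proper decomposition, so only the poles
  remain. The empty family is excluded because \<open>{1..d}\<close> is a lower facet of the simplex
  and its boundary coefficient is not 0.\<close>

lemma subdivisions_simplex: "subdivisions d (d + 1) = {{{1..d + 1}}}"
proof -
  have "\<delta> = {{1..d + 1}}" if \<delta>: "\<delta> \<in> subdivisions d (d + 1)" for \<delta>
  proof -
    have "V = {1..d + 1}" if "V \<in> \<delta>" for V
      using card_subset_eq[of "{1..d + 1}" V] cellD(1,2)[OF \<delta> that] card_mono[of "{1..d + 1}" V] by auto
    moreover have "\<delta> \<noteq> {}"
    proof
      assume e: "\<delta> = {}"
      have "bdry d {1..d + 1} {1..d} = 0" using \<delta> e by (simp add: subdivisions_def)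
      moreover have "{1..d} \<in> lower_facets d {1..d + 1}"
      proof -
        have "even (card {u \<in> {1..d}. v < u})" if "v \<in> {1..d + 1} - {1..d}" for v
        proof -
          have "{u \<in> {1..d}. v < u} = {}" using that by auto
          then show ?thesis by (simp only: card.empty even_zero)
        qed
        then show ?thesis by (simp add: lower_facets_def)
      qed
      moreover have "upper_facets d {1..d + 1} \<inter> lower_facets d {1..d + 1} = {}"
        by (rule upper_lower_disjoint) simp_all
      ultimately show False unfolding bdry_def by (auto split: if_splits simp: of_bool_def)
    qed
    ultimately show ?thesis by blast
  qed
  then show ?thesis using trivial_in_subdivisions[of "d + 1"] by blast
qed

text \<open>Each vertex beyond \<open>d + 1\<close> is exchanged for a pair of poles, so
  \<open>k + i\<close> stays fixed while \<open>i\<close> drops to 0; hence \<open>k\<close> is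
  arbitrary in the induction.\<close>

theorem proper_subdivisions_sphere:
  assumes d3: "d \<le> 3"
  shows "top_of_set (order_polyhedron (suspension k (subdivisions d (d + 1 + i) - {{{1..d + 1 + i}}})) (suspension_le refinement_of))
    homotopy_equivalent_space sphere_space (int (k + i) - 1)"
proof (induction i arbitrary: k)
  case 0
  show ?case using suspension_empty_homotopy_eqv_sphere[of k refinement_of] by (simp add: subdivisions_simplex[simplified])
next
  case (Suc i)
  have m: "d + 1 \<le> d + 1 + i" by simp
  have "order_polyhedron (suspension k (subdivisions d (Suc (d + 1 + i)) - {{{1..Suc (d + 1 + i)}}})) (suspension_le refinement_of)
    homotopy_eqv
    order_polyhedron (suspension (Suc k) (subdivisions d (d + 1 + i) - {{{1..d + 1 + i}}})) (suspension_le refinement_of)"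
    by (rule suspend_proper_subdivisions[OF m d3])
  from homotopy_eqv_trans[OF this Suc.IH]
  show ?case by simp
qed

end

theorem theorem1p2:
  fixes n d :: nat
  assumes "CARD('d::{finite,linorder}) = d"
    and "1 \<le> d" and "d \<le> 3"
    and "n \<ge> d + 1"
  shows "geometric_realization (order_complex (Baues TYPE('d) n) refinement_of)
           homotopy_equivalent_space sphere_space (int n - int d - 2)"
proof -
  interpret cyclic_subdivisions d
    by unfold_locales
      (use assms subdivision_common_facet[where 'd = 'd] subdivision_refinement_sum[where 'd = 'd] in auto)
  obtain i where i: "n = d + 1 + i" using assms(4) le_Suc_ex by blast
  let ?P = "Baues TYPE('d) n"
  have P: "?P = subdivisions d (d + 1 + i) - {{{1..d + 1 + i}}}"
    using polytopal_decomposition_iff_subdivision[where 'd = 'd and n = n] assms i by (auto simp: Baues_def)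
  have "bij_betw Base ?P (suspension 0 ?P)"
    by (auto simp: bij_betw_def inj_on_def suspension_def)
  then have "order_polyhedron ?P refinement_of homotopy_eqv
      order_polyhedron (suspension 0 ?P) (suspension_le refinement_of)"
    by (rule order_iso_homotopy_eqv[OF finite_Baues]) simp
  moreover have "top_of_set (order_polyhedron (suspension 0 ?P) (suspension_le refinement_of))
      homotopy_equivalent_space sphere_space (int (0 + i) - 1)"
    unfolding P by (rule proper_subdivisions_sphere) (rule assms(3))
  ultimately have "top_of_set (order_polyhedron ?P refinement_of) homotopy_equivalent_space sphere_space (int (0 + i) - 1)"
    by (rule homotopy_eqv_trans)
  moreover have "int (0 + i) - 1 = int n - int d - 2" using i by simp
  ultimately show ?thesis
    using geometric_realization_order_complex[OF finite_Baues[where 'd = 'd and n = n], where le = refinement_of] by (simp only:)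
qed

end
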